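(* Let $\Phi(x)=(2\pi)^{-1/2}\int_{-\infty}^{x}e^{-y^2/2}\,dy$ be the Gaussian distribution function. Let $n\in\mathbb{N}$, $p\ge 2$, let $A\subset\mathbb{R}^n$ be a Borel set and $x\in\mathbb{R}$. Then $$\mu_{p,n}(A)=\Phi(x)\ \Rightarrow\ \mu_{p,n}\big(A+18\sqrt2\,tB_2^n\big)\ge\Phi(x+t)\quad\text{for all }t>0.$$ In particular there exists a universal constant $C>0$ (independent of $p\geq 2$, $n$ and $A$) such that $$\mu_{p,n}^{+}(A)\ge\frac1C\min\Big\{\mu_{p,n}(A)\sqrt{\ln\tfrac1{\mu_{p,n}(A)}},\ (1-\mu_{p,n}(A))\sqrt{\ln\tfrac1{1-\mu_{p,n}(A)}}\Big\}.$$
   Context: $B_p^n=\{x\in\mathbb{R}^n:\|x\|_p\le1\}$ is the unit ball of $\ell_p^n$; $r_{p,n}>0$ is chosen so that $r_{p,n}B_p^n$ has Lebesgue measure $1$, and $\mu_{p,n}$ is the uniform probability measure on $r_{p,n}B_p^n$. For a probability measure $\mu$ and a Borel set $A\subset\mathbb{R}^n$, $\mu^+(A):=\liminf_{t\to0+}\frac{\mu(A+tB_2^n)-\mu(A)}{t}$. The convention $0\cdot\sqrt{\ln(1/0)}=0$ is used. *)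

theory Defs
  imports "HOL-Probability.Probability"
begin

text \<open>
  The constant in the isoperimetric inequality is uniform in the dimension, so the dimension has to
  be a natural number rather than a type. A point of \<open>n\<close>-space is a function in
  \<open>{..<n} \<rightarrow>\<^sub>E UNIV\<close>: its coordinates are the values at \<open>0, \<dots>, n - 1\<close>, and its value
  elsewhere is \<^term>\<open>undefined\<close>. The Borel sets are those of the \<open>n\<close>-fold product of the real Borel
  \<open>\<sigma>\<close>-algebra.
\<close>

definition lborel_n :: "nat \<Rightarrow> (nat \<Rightarrow> real) measure" where
  "lborel_n n = (\<Pi>\<^sub>M i\<in>{..<n}. lborel)"

definition lebesgue_n :: "nat \<Rightarrow> (nat \<Rightarrow> real) measure" where
  "lebesgue_n n = completion (lborel_n n)"

definition scale_n :: "nat \<Rightarrow> real \<Rightarrow> (nat \<Rightarrow> real) set \<Rightarrow> (nat \<Rightarrow> real) set" where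
  "scale_n n c A = {(\<lambda>i\<in>{..<n}. c * a i) | a. a \<in> A}"

definition sum_n :: "nat \<Rightarrow> (nat \<Rightarrow> real) set \<Rightarrow> (nat \<Rightarrow> real) set \<Rightarrow> (nat \<Rightarrow> real) set" where
  "sum_n n A B = {(\<lambda>i\<in>{..<n}. a i + b i) | a b. a \<in> A \<and> b \<in> B}"

definition lp_norm :: "real \<Rightarrow> nat \<Rightarrow> (nat \<Rightarrow> real) \<Rightarrow> real" where
  "lp_norm p n x = (\<Sum>i<n. \<bar>x i\<bar> powr p) powr (1 / p)"

definition lp_ball :: "real \<Rightarrow> nat \<Rightarrow> (nat \<Rightarrow> real) set" where
  "lp_ball p n = {x \<in> {..<n} \<rightarrow>\<^sub>E UNIV. lp_norm p n x \<le> 1}"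

definition lp_radius :: "real \<Rightarrow> nat \<Rightarrow> real" where
  "lp_radius p n = (THE r. r > 0 \<and> emeasure (lebesgue_n n) (scale_n n r (lp_ball p n)) = 1)"

text \<open>
  The measure is defined on all Lebesgue measurable sets: for a Borel set \<open>A\<close> the enlargement
  \<open>A + t B\<close> by a closed ball is Lebesgue measurable but need not be Borel, and
  \<^const>\<open>measure\<close> is \<open>0\<close> outside the \<open>\<sigma>\<close>-algebra.
\<close>

definition mu :: "real \<Rightarrow> nat \<Rightarrow> (nat \<Rightarrow> real) measure" where
  "mu p n = uniform_measure (lebesgue_n n) (scale_n n (lp_radius p n) (lp_ball p n))"

text \<open>The lower limit may be infinite, hence it is taken in the extended reals.\<close>

definition mu_plus :: "nat \<Rightarrow> (nat \<Rightarrow> real) measure \<Rightarrow> (nat \<Rightarrow> real) set \<Rightarrow> ereal" where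
  "mu_plus n M A = Liminf (at_right 0)
     (\<lambda>t::real. ereal ((measure M (sum_n n A (scale_n n t (lp_ball 2 n))) - measure M A) / t))"

definition Phi :: "real \<Rightarrow> real" where
  "Phi x = (LINT y:{..x}|lborel. std_normal_density y)"

end

theory Submission
  imports Defs
begin

text \<open>
  The standard Gaussian measure on \<open>n\<close>-space satisfies the isoperimetric inequality with constant 1,
  and the uniform measure on the normalised \<open>\<ell>\<^sub>p\<close>-ball, \<open>p \<ge> 2\<close>, is the image of the Gaussian measure
  under a map \<open>gauss_to_ball p n\<close> that is 18-Lipschitz for the Euclidean distance, whatever \<open>p\<close> and
  \<open>n\<close> are. The map carries the \<open>t\<close>-enlargement of a preimage into the \<open>18 t\<close>-enlargement of the set, so
  the first claim follows; the gap between 18 and \<open>18 * sqrt 2\<close> makes room for an open enlargement,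
  which is a Borel set. The second claim follows from the first by letting \<open>t\<close> tend to 0, because the Gaussian density at \<open>x\<close> dominates, up to a constant,
  \<open>m * sqrt (ln (1 / m))\<close> for the smaller one \<open>m\<close> of the numbers \<open>Phi x\<close> and \<open>1 - Phi x\<close>.

  Gaussian isoperimetry is obtained in a functional form that tensorizes without loss
  (\<open>Phi_shift_integral_le\<close>): if \<open>u\<close> and \<open>v\<close> take values in \<open>[0, 1]\<close> and
  \<open>Phi_inv (v y) \<ge> Phi_inv (u x) + sqrt (t\<^sup>2 - \<bar>x - y\<bar>\<^sup>2)\<close> whenever \<open>\<bar>x - y\<bar> \<le> t\<close>, then
  \<open>Phi_inv (\<integral>v) \<ge> Phi_inv (\<integral>u) + t\<close>. This is the isoperimetric inequality for the subgraph of
  \<open>Phi_inv \<circ> u\<close> in one more dimension; indicator functions give it for sets, and integrating out one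
  coordinate reproduces the hypothesis in one dimension less. On the line it is proved by running the
  heat flow for a time \<open>s\<close> on both functions: with \<open>t\<^sup>2 - (x - y)\<^sup>2 / (1 - s)\<close> under the root the
  hypothesis is preserved (\<open>maximum_principle\<close>), and at \<open>s = 1\<close> it has become the conclusion.

  The Lipschitz map first applies to each coordinate the increasing map from the Gaussian measure to
  the density proportional to \<open>exp (- \<bar>x\<bar> powr p)\<close>, and then moves each point along its ray so that the
  density \<open>exp (- (\<Sum>i<n. \<bar>x i\<bar> powr p))\<close> becomes constant. For \<open>p > 2\<close> the second map alone has no
  Lipschitz bound independent of \<open>n\<close>: a point with one very large coordinate is moved too quickly when that coordinate
  changes. There, however, the coordinate map is slow. Its slope at the image point \<open>x\<close> is at most
  a constant multiple of \<open>\<bar>x\<bar> powr (1 - p / 2) / sqrt p\<close> (\<open>gauss_to_lp_slope_bounds\<close>), and this is exactly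
  what the composition needs (\<open>gauss_to_ball_lipschitz\<close>).

  The enlargement of a Borel set by a closed ball need not be Borel. It is Lebesgue measurable because
  it differs from the open enlargement by a subset of the points at distance exactly \<open>r\<close> from the set,
  and these form a null set (\<open>sum_scaled_ball_lebesgue_measurable\<close>).
\<close>

section \<open>Distribution functions and quantiles of positive densities\<close>

definition positive_density :: "(real \<Rightarrow> real) \<Rightarrow> bool" where
  "positive_density \<rho> \<longleftrightarrow> continuous_on UNIV \<rho> \<and> (\<forall>x. 0 < \<rho> x)
     \<and> integrable lborel \<rho> \<and> integral\<^sup>L lborel \<rho> = 1"

definition dist_fun :: "(real \<Rightarrow> real) \<Rightarrow> real \<Rightarrow> real" where
  "dist_fun \<rho> x = (LINT y:{..x}|lborel. \<rho> y)"

definition quantile :: "(real \<Rightarrow> real) \<Rightarrow> real \<Rightarrow> real" where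
  "quantile \<rho> = inv (dist_fun \<rho>)"

context
  fixes \<rho> :: "real \<Rightarrow> real"
  assumes \<rho>: "positive_density \<rho>"
begin

lemma positive_density_measurable: "\<rho> \<in> borel_measurable borel"
  using \<rho> by (auto simp: positive_density_def intro: borel_measurable_continuous_onI)

lemma real_distribution_density: "real_distribution (density lborel \<rho>)"
proof -
  have "emeasure (density lborel \<rho>) UNIV = 1"
    using \<rho> positive_density_measurable
    by (subst emeasure_density) (auto simp: positive_density_def nn_integral_eq_integral less_imp_le)
  then have "prob_space (density lborel \<rho>)"
    by (intro prob_spaceI) simp
  then show ?thesis
    by (simp add: real_distribution_def real_distribution_axioms_def)
qed

lemma cdf_density: "cdf (density lborel \<rho>) = dist_fun \<rho>"
proof
  fix x
  have "measure (density lborel \<rho>) {..x} = (\<integral>y. indicator {..x} y *\<^sub>R \<rho> y \<partial>lborel)"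
  proof -
    have "emeasure (density lborel \<rho>) {..x} = (\<integral>\<^sup>+y. ennreal (indicator {..x} y *\<^sub>R \<rho> y) \<partial>lborel)"
      using positive_density_measurable
      by (subst emeasure_density) (auto intro!: nn_integral_cong simp: indicator_def)
    also have "\<dots> = ennreal (\<integral>y. indicator {..x} y *\<^sub>R \<rho> y \<partial>lborel)"
      using \<rho> positive_density_measurable
      by (intro nn_integral_eq_integral integrable_mult_indicator)
        (auto simp: positive_density_def less_imp_le)
    finally show ?thesis
      using \<rho> by (subst measure_def) (auto intro!: enn2real_ennreal integral_nonneg_AE simp: positive_density_def less_imp_le)
  qed
  then show "cdf (density lborel \<rho>) x = dist_fun \<rho> x"
    by (simp add: cdf_def2 dist_fun_def set_lebesgue_integral_def)
qed

lemma dist_fun_has_derivative: "(dist_fun \<rho> has_real_derivative \<rho> x) (at x)"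
proof -
  have int: "set_integrable lborel A \<rho>" if "A \<in> sets borel" for A
    using \<rho> that unfolding set_integrable_def positive_density_def
    by (intro integrable_mult_indicator) auto
  have cont: "continuous_on A \<rho>" for A
    using \<rho> continuous_on_subset by (auto simp: positive_density_def)
  define G where "G = (\<lambda>y. dist_fun \<rho> (x - 1) + integral {x-1..y} \<rho>)"
  have eq: "dist_fun \<rho> y = G y" if "x - 1 < y" for y
  proof -
    have "{..y} = {..x-1} \<union> {x-1<..y}" using that by auto
    then have "dist_fun \<rho> y = dist_fun \<rho> (x-1) + (LINT z:{x-1<..y}|lborel. \<rho> z)"
      unfolding dist_fun_def
      using set_integral_Un[of "{..x-1}" "{x-1<..y}" lborel \<rho>] int
      by (simp add: disjoint_iff)
    also have "(LINT z:{x-1<..y}|lborel. \<rho> z) = (LINT z:{x-1..y}|lborel. \<rho> z)"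
      unfolding set_lebesgue_integral_def
      by (intro integral_cong_AE)
        (use positive_density_measurable AE_lborel_singleton[of "x-1"] in \<open>auto simp: indicator_def elim!: eventually_mono\<close>)
    also have "\<dots> = integral {x-1..y} \<rho>"
      by (intro set_borel_integral_eq_integral int) auto
    finally show ?thesis by (simp add: G_def)
  qed
  have "(G has_real_derivative \<rho> x) (at x within {x-1..x+1})"
    unfolding G_def by (auto intro!: derivative_eq_intros integral_has_real_derivative cont)
  then have "(G has_real_derivative \<rho> x) (at x)"
    by (simp add: at_within_Icc_at)
  then show ?thesis
    by (rule has_field_derivative_transform_within_open[where S="{x-1<..}"]) (auto simp: eq)
qed

lemma dist_fun_strict_mono: "x < y \<Longrightarrow> dist_fun \<rho> x < dist_fun \<rho> y"
  by (rule DERIV_pos_imp_increasing[of x y "dist_fun \<rho>"])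
    (use \<rho> dist_fun_has_derivative in \<open>force simp: positive_density_def\<close>)+

lemma dist_fun_le_iff: "dist_fun \<rho> x \<le> dist_fun \<rho> y \<longleftrightarrow> x \<le> y"
  using dist_fun_strict_mono[of x y] dist_fun_strict_mono[of y x] by (cases x y rule: linorder_cases) auto

lemma dist_fun_at_top: "(dist_fun \<rho> \<longlongrightarrow> 1) at_top"
  using real_distribution.cdf_lim_at_top_prob[OF real_distribution_density] by (simp add: cdf_density)

lemma dist_fun_at_bot: "(dist_fun \<rho> \<longlongrightarrow> 0) at_bot"
proof -
  interpret real_distribution "density lborel \<rho>" by (rule real_distribution_density)
  show ?thesis using cdf_lim_at_bot by (simp add: cdf_density)
qed

lemma dist_fun_bounds: "0 < dist_fun \<rho> x" "dist_fun \<rho> x < 1"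
proof -
  interpret real_distribution "density lborel \<rho>" by (rule real_distribution_density)
  have "0 \<le> dist_fun \<rho> (x-1)" "dist_fun \<rho> (x+1) \<le> 1"
    using cdf_nonneg cdf_bounded_prob by (simp_all add: cdf_density[symmetric])
  then show "0 < dist_fun \<rho> x" "dist_fun \<rho> x < 1"
    using dist_fun_strict_mono[of "x-1" x] dist_fun_strict_mono[of x "x+1"] by auto
qed

lemma isCont_dist_fun: "isCont (dist_fun \<rho>) x"
  using dist_fun_has_derivative DERIV_isCont by blast

lemma dist_fun_surj:
  assumes "0 < m" "m < 1"
  shows "\<exists>x. dist_fun \<rho> x = m"
proof -
  have "\<forall>\<^sub>F x in at_bot. dist_fun \<rho> x < m"
    using dist_fun_at_bot assms by (auto dest: order_tendstoD)
  then obtain a where a: "dist_fun \<rho> a < m"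
    by (meson eventually_happens trivial_limit_at_bot_linorder)
  have "\<forall>\<^sub>F x in at_top. m < dist_fun \<rho> x"
    using dist_fun_at_top assms by (auto dest: order_tendstoD)
  then obtain b where b: "m < dist_fun \<rho> b"
    by (meson eventually_happens trivial_limit_at_top_linorder)
  have "a \<le> b" using a b dist_fun_le_iff[of a b] by linarith
  then show ?thesis
    using IVT[of "dist_fun \<rho>" a m b] a b isCont_dist_fun by auto
qed

lemma quantile_dist_fun [simp]: "quantile \<rho> (dist_fun \<rho> x) = x"
  unfolding quantile_def
proof (rule inv_f_f, rule injI)
  fix x y assume "dist_fun \<rho> x = dist_fun \<rho> y"
  then show "x = y" using dist_fun_le_iff[of x y] dist_fun_le_iff[of y x] by simp
qed

lemma dist_fun_quantile: "0 < m \<Longrightarrow> m < 1 \<Longrightarrow> dist_fun \<rho> (quantile \<rho> m) = m"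
  using dist_fun_surj by fastforce

lemma quantile_mono: "0 < m \<Longrightarrow> m \<le> m' \<Longrightarrow> m' < 1 \<Longrightarrow> quantile \<rho> m \<le> quantile \<rho> m'"
  using dist_fun_le_iff[of "quantile \<rho> m" "quantile \<rho> m'"] by (simp add: dist_fun_quantile)

lemma isCont_quantile:
  assumes "0 < m" "m < 1" shows "isCont (quantile \<rho>) m"
proof -
  obtain x where x: "m = dist_fun \<rho> x" using dist_fun_surj assms by metis
  have "isCont (quantile \<rho>) (dist_fun \<rho> x)"
    by (rule isCont_inverse_function[where d=1]) (auto simp: isCont_dist_fun)
  then show ?thesis using x by simp
qed

lemma quantile_has_derivative:
  assumes "0 < m" "m < 1"
  shows "(quantile \<rho> has_real_derivative 1 / \<rho> (quantile \<rho> m)) (at m)"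
proof -
  have "(quantile \<rho> has_real_derivative inverse (\<rho> (quantile \<rho> m))) (at m)"
  proof (rule DERIV_inverse_function[where f="dist_fun \<rho>" and a=0 and b=1])
    show "(dist_fun \<rho> has_real_derivative \<rho> (quantile \<rho> m)) (at (quantile \<rho> m))"
      by (rule dist_fun_has_derivative)
    show "\<rho> (quantile \<rho> m) \<noteq> 0" using \<rho> by (metis less_irrefl positive_density_def)
  qed (use assms in \<open>auto simp: dist_fun_quantile isCont_quantile\<close>)
  then show ?thesis by (simp add: inverse_eq_divide)
qed

end

section \<open>A maximum principle for quantiles of the heat flow\<close>

lemma second_derivative_at_min_nonneg:
  fixes g :: "real \<Rightarrow> real"
  assumes d1: "\<And>x. (g has_real_derivative g1 x) (at x)"
    and d2: "(g1 has_real_derivative D) (at y)"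
    and "0 < r" and min: "\<And>x. \<bar>x - y\<bar> < r \<Longrightarrow> g y \<le> g x"
  shows "g1 y = 0" "0 \<le> D"
proof -
  show z: "g1 y = 0"
    using DERIV_local_min[OF d1[of y] \<open>0 < r\<close>] min by (simp add: abs_minus_commute)
  show "0 \<le> D"
  proof (rule ccontr)
    assume "\<not> 0 \<le> D"
    then obtain d where d: "0 < d" "\<And>h. 0 < h \<Longrightarrow> h < d \<Longrightarrow> g1 (y + h) < 0"
      using DERIV_neg_dec_right[OF d2] z by auto
    define h where "h = min d r / 2"
    have h: "0 < h" "h < d" "h < r" using d \<open>0 < r\<close> by (auto simp: h_def)
    obtain \<xi> where \<xi>: "y < \<xi>" "\<xi> < y + h" "g (y + h) - g y = (y + h - y) * g1 \<xi>"
      using MVT2[of y "y + h" g g1] h d1 by auto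
    have "g1 \<xi> < 0" using d(2)[of "\<xi> - y"] \<xi> h by auto
    then have "h * g1 \<xi> < 0" using h by (simp add: mult_pos_neg)
    then have "g (y + h) < g y" using \<xi> by simp
    moreover have "g y \<le> g (y + h)" using h by (intro min) auto
    ultimately show False by simp
  qed
qed

text \<open>
  The functions \<open>U s\<close> and \<open>V s\<close> stand for \<open>Phi_inv\<close> of two solutions of the heat equation, so both solve
  \<open>U\<^sub>s = (U\<^sub>x\<^sub>x - U * U\<^sub>x\<^sup>2) / 2\<close>. The equation is assumed along differentiable curves \<open>\<xi>\<close>, which replaces
  differentiability in two variables.

  The points \<open>x\<close> with \<open>(x - y)\<^sup>2 \<le> t\<^sup>2 * (1 - s)\<close> are written as \<open>y + t * sqrt (1 - s) * sin \<theta>\<close>; then the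
  root of \<open>t\<^sup>2 - (x - y)\<^sup>2 / (1 - s)\<close> is \<open>t * \<bar>cos \<theta>\<bar>\<close>, and replacing it by \<open>t * cos \<theta>\<close> gives a function that is
  smooth in \<open>\<theta>\<close> and has no boundary. Let \<open>W = V - U - t * cos \<theta>\<close> and \<open>d = U\<^sub>x\<close>. At a minimum in \<open>y\<close> and
  \<open>\<theta>\<close> one has \<open>V\<^sub>y = d\<close>, \<open>V\<^sub>y\<^sub>y \<ge> U\<^sub>x\<^sub>x\<close> and \<open>t * sin \<theta> = sqrt (1 - s) * d * t * cos \<theta>\<close>, and these turn the time
  derivative of \<open>W\<close> into \<open>(V\<^sub>y\<^sub>y - U\<^sub>x\<^sub>x) / 2 - d\<^sup>2 * W / 2\<close>, which is nonnegative where \<open>W < 0\<close>. Hence \<open>W\<close>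
  cannot become more negative than it is at the initial time or far out.
\<close>

lemma maximum_principle:
  fixes U V U1 V1 U2 V2 :: "real \<Rightarrow> real \<Rightarrow> real" and s0 s1 t e R :: real
  assumes s: "0 < s0" "s1 < 1" and "0 \<le> e"
    and Ux: "\<And>s x. s \<in> {s0..s1} \<Longrightarrow> (U s has_real_derivative U1 s x) (at x)"
    and Uxx: "\<And>s x. s \<in> {s0..s1} \<Longrightarrow> (U1 s has_real_derivative U2 s x) (at x)"
    and Us: "\<And>s \<xi> \<xi>'. s \<in> {s0..s1} \<Longrightarrow> (\<xi> has_real_derivative \<xi>') (at s) \<Longrightarrow>
       ((\<lambda>s. U s (\<xi> s)) has_real_derivative
          ((U2 s (\<xi> s) - U s (\<xi> s) * (U1 s (\<xi> s))\<^sup>2) / 2 + U1 s (\<xi> s) * \<xi>')) (at s)"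
    and Uc: "continuous_on ({s0..s1} \<times> UNIV) (\<lambda>(s, x). U s x)"
    and Vx: "\<And>s x. s \<in> {s0..s1} \<Longrightarrow> (V s has_real_derivative V1 s x) (at x)"
    and Vxx: "\<And>s x. s \<in> {s0..s1} \<Longrightarrow> (V1 s has_real_derivative V2 s x) (at x)"
    and Vs: "\<And>s \<xi> \<xi>'. s \<in> {s0..s1} \<Longrightarrow> (\<xi> has_real_derivative \<xi>') (at s) \<Longrightarrow>
       ((\<lambda>s. V s (\<xi> s)) has_real_derivative
          ((V2 s (\<xi> s) - V s (\<xi> s) * (V1 s (\<xi> s))\<^sup>2) / 2 + V1 s (\<xi> s) * \<xi>')) (at s)"
    and Vc: "continuous_on ({s0..s1} \<times> UNIV) (\<lambda>(s, x). V s x)"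
    and init: "\<And>y \<theta>. U s0 (y + t * sqrt (1 - s0) * sin \<theta>) + t * cos \<theta> - e \<le> V s0 y"
    and far: "\<And>s y \<theta>. s \<in> {s0..s1} \<Longrightarrow> R \<le> \<bar>y\<bar> \<Longrightarrow>
       U s (y + t * sqrt (1 - s) * sin \<theta>) + t * cos \<theta> - e \<le> V s y"
    and st: "st \<in> {s0..s1}"
  shows "U st (yt + t * sqrt (1 - st) * sin \<theta>t) + t * cos \<theta>t - e \<le> V st yt"
proof (cases "R \<le> \<bar>yt\<bar>")
  case True
  then show ?thesis using far st by auto
next
  case yR: False
  define W where "W = (\<lambda>s y \<theta>. V s y - U s (y + t * sqrt (1 - s) * sin \<theta>) - t * cos \<theta>)"
  have "U st (yt + t * sqrt (1 - st) * sin \<theta>t) + t * cos \<theta>t - e \<le> V st yt + \<epsilon>" if "0 < \<epsilon>" for \<epsilon>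
  proof (cases "s0 = s1")
    case True
    then have "st = s0" using st by auto
    then show ?thesis using init[of yt \<theta>t] \<open>0 < \<epsilon>\<close> by auto
  next
    case False
    with st have s01: "s0 < s1" by auto
    \<comment> \<open>The term \<open>\<kappa> * (s - s0)\<close> forces a strictly negative time derivative of \<open>W\<close> at a minimum after \<open>s0\<close>.\<close>
    define \<kappa> where "\<kappa> = \<epsilon> / (s1 - s0)"
    have \<kappa>: "0 < \<kappa>" "\<kappa> * (s1 - s0) = \<epsilon>" using s01 \<open>0 < \<epsilon>\<close> by (auto simp: \<kappa>_def)
    define f where "f = (\<lambda>(s, y, \<theta>). W s y \<theta> + \<kappa> * (s - s0))"
    define D where "D = {s0..s1} \<times> {-R..R} \<times> {0..2*pi}"
    obtain \<theta>' where \<theta>': "0 \<le> \<theta>'" "\<theta>' < 2 * pi" "cos \<theta>t = cos \<theta>'" "sin \<theta>t = sin \<theta>'"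
      using sincos_total_2pi[of "cos \<theta>t" "sin \<theta>t"] by (auto simp: add.commute)
    have stD: "(st, yt, \<theta>') \<in> D" using st yR \<theta>' by (auto simp: D_def)
    have cont: "continuous_on D f"
    proof -
      have "continuous_on D (\<lambda>w. (\<lambda>(s, x). V s x) (fst w, fst (snd w)))"
        by (rule continuous_on_compose2[OF Vc]) (auto simp: D_def intro!: continuous_intros)
      moreover have "continuous_on D (\<lambda>w. (\<lambda>(s, x). U s x)
          (fst w, fst (snd w) + t * sqrt (1 - fst w) * sin (snd (snd w))))"
        by (rule continuous_on_compose2[OF Uc]) (auto simp: D_def intro!: continuous_intros)
      ultimately show ?thesis
        unfolding f_def W_def split_beta by (auto intro!: continuous_intros)
    qed
    have "compact D" unfolding D_def by (intro compact_Times compact_Icc)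
    then obtain s y \<theta> where m: "(s, y, \<theta>) \<in> D" "\<And>w. w \<in> D \<Longrightarrow> f (s, y, \<theta>) \<le> f w"
      using continuous_attains_inf[OF _ _ cont] stD by (metis empty_iff prod_cases3)
    have sI: "s \<in> {s0..s1}" using m by (auto simp: D_def)
    have "- e \<le> f (s, y, \<theta>)"
    proof (rule ccontr)
      assume neg: "\<not> - e \<le> f (s, y, \<theta>)"
      have "\<kappa> * (s - s0) \<ge> 0" using \<kappa> sI by auto
      with neg have Wneg: "W s y \<theta> < - e" by (auto simp: f_def)
      have "s \<noteq> s0" using Wneg init[of y \<theta>] by (auto simp: W_def)
      with sI have ss0: "s0 < s" by auto
      have yR': "\<bar>y\<bar> < R" using Wneg far[OF sI, of y \<theta>] by (force simp: W_def)
      define \<sigma> where "\<sigma> = sqrt (1 - s)"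
      have \<sigma>: "0 < \<sigma>" using sI s by (auto simp: \<sigma>_def)
      define x where "x = y + t * \<sigma> * sin \<theta>"
      define d where "d = U1 s x"
      \<comment> \<open>Only \<open>sin \<theta>\<close> and \<open>cos \<theta>\<close> enter, so a minimum over one period is a minimum over all angles.\<close>
      have minth: "W s y \<theta> \<le> W s y \<theta>2" for \<theta>2
      proof -
        obtain \<theta>3 where t3: "0 \<le> \<theta>3" "\<theta>3 < 2 * pi" "cos \<theta>2 = cos \<theta>3" "sin \<theta>2 = sin \<theta>3"
          using sincos_total_2pi[of "cos \<theta>2" "sin \<theta>2"] by (auto simp: add.commute)
        have "f (s, y, \<theta>) \<le> f (s, y, \<theta>3)" using m t3 by (intro m(2)) (auto simp: D_def)
        then show ?thesis using t3 by (simp add: f_def W_def)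
      qed
      have "((\<lambda>\<theta>. W s y \<theta>) has_real_derivative (- (d * (t * \<sigma> * cos \<theta>)) + t * sin \<theta>)) (at \<theta>)"
        unfolding W_def \<sigma>_def[symmetric] d_def x_def
        by (rule derivative_eq_intros DERIV_chain2[OF Ux[OF sI]] refl | simp)+
      then have "- (d * (t * \<sigma> * cos \<theta>)) + t * sin \<theta> = 0"
        by (rule DERIV_local_min[where d=1]) (auto simp: minth)
      then have crit: "t * sin \<theta> = d * (t * \<sigma> * cos \<theta>)" by simp
      define g where "g = (\<lambda>z. V s z - U s (z + t * \<sigma> * sin \<theta>))"
      define g1 where "g1 = (\<lambda>z. V1 s z - U1 s (z + t * \<sigma> * sin \<theta>))"
      have g1: "(g has_real_derivative g1 z) (at z)" for z
        unfolding g_def g1_def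
        by (rule derivative_eq_intros Vx[OF sI] DERIV_chain2[OF Ux[OF sI]] refl | simp)+
      have g2: "(g1 has_real_derivative (V2 s y - U2 s x)) (at y)"
        unfolding g1_def x_def
        by (rule derivative_eq_intros Vxx[OF sI] DERIV_chain2[OF Uxx[OF sI]] refl | simp)+
      have gmin: "g y \<le> g z" if "\<bar>z - y\<bar> < R - \<bar>y\<bar>" for z
      proof -
        have "f (s, y, \<theta>) \<le> f (s, z, \<theta>)" using m that by (intro m(2)) (auto simp: D_def)
        then show ?thesis by (simp add: f_def W_def g_def \<sigma>_def)
      qed
      have V1: "V1 s y = d" and V2: "0 \<le> V2 s y - U2 s x"
        using second_derivative_at_min_nonneg[OF g1 g2, of "R - \<bar>y\<bar>"] gmin yR'
        by (auto simp: g1_def d_def x_def)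
      define Ws where "Ws = (V2 s y - V s y * d\<^sup>2) / 2
          - ((U2 s x - U s x * d\<^sup>2) / 2 + d * (- (t * sin \<theta>) / (2 * \<sigma>)))"
      have "((\<lambda>s. y + t * sqrt (1 - s) * sin \<theta>) has_real_derivative (- (t * sin \<theta>) / (2 * \<sigma>))) (at s)"
        using \<sigma> unfolding \<sigma>_def by (auto intro!: derivative_eq_intros simp: field_simps)
      from Us[OF sI this]
      have Uder: "((\<lambda>s. U s (y + t * sqrt (1 - s) * sin \<theta>)) has_real_derivative
          ((U2 s x - U s x * d\<^sup>2) / 2 + d * (- (t * sin \<theta>) / (2 * \<sigma>)))) (at s)"
        by (simp add: x_def \<sigma>_def d_def)
      have Vder: "((\<lambda>s. V s y) has_real_derivative ((V2 s y - V s y * d\<^sup>2) / 2)) (at s)"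
        using Vs[OF sI DERIV_const[of y]] V1 by simp
      have "((\<lambda>s. f (s, y, \<theta>)) has_real_derivative (Ws + \<kappa>)) (at s)"
        unfolding f_def W_def Ws_def prod.case
        by (rule derivative_eq_intros Uder Vder refl | simp)+
      moreover have "Ws + \<kappa> > 0"
      proof -
        have "d * (t * sin \<theta>) / (2 * \<sigma>) = d\<^sup>2 * (t * cos \<theta>) / 2"
          using \<sigma> by (subst crit) (simp add: power2_eq_square)
        then have "Ws = (V2 s y - U2 s x) / 2 - d\<^sup>2 / 2 * W s y \<theta>"
          by (simp add: Ws_def W_def x_def \<sigma>_def[symmetric] algebra_simps diff_divide_distrib add_divide_distrib)
        moreover have "d\<^sup>2 / 2 * W s y \<theta> \<le> 0"
          using Wneg \<open>0 \<le> e\<close> by (intro mult_nonneg_nonpos) auto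
        moreover have "0 \<le> (V2 s y - U2 s x) / 2" using V2 by simp
        ultimately show ?thesis using \<kappa>(1) by linarith
      qed
      ultimately obtain dd where dd: "0 < dd" "\<And>h. 0 < h \<Longrightarrow> h < dd \<Longrightarrow> f (s - h, y, \<theta>) < f (s, y, \<theta>)"
        using DERIV_pos_inc_left by blast
      define h where "h = min dd (s - s0) / 2"
      have h: "0 < h" "h < dd" "h \<le> s - s0" using dd ss0 by (auto simp: h_def)
      have "f (s, y, \<theta>) \<le> f (s - h, y, \<theta>)" using m h by (intro m(2)) (auto simp: D_def)
      with dd(2)[of h] h show False by auto
    qed
    also have "\<dots> \<le> f (st, yt, \<theta>')" by (rule m(2)[OF stD])
    also have "\<dots> \<le> W st yt \<theta>t + \<epsilon>"
    proof -
      have "\<kappa> * (st - s0) \<le> \<kappa> * (s1 - s0)" using st \<kappa> by (intro mult_left_mono) auto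
      then show ?thesis using \<theta>' \<kappa> by (simp add: f_def W_def)
    qed
    finally show ?thesis by (simp add: W_def)
  qed
  then show ?thesis by (rule field_le_epsilon)
qed

section \<open>The heat flow of a step function\<close>

abbreviation gauss :: "real measure" where
  "gauss \<equiv> density lborel std_normal_density"

abbreviation Phi_inv :: "real \<Rightarrow> real" where
  "Phi_inv \<equiv> quantile std_normal_density"

lemma positive_density_std_normal: "positive_density std_normal_density"
  unfolding positive_density_def
  by (auto simp: normal_density_def intro!: continuous_intros integrable_normal_density)

lemma Phi_eq_dist_fun: "Phi = dist_fun std_normal_density"
  by (rule ext) (simp add: Phi_def dist_fun_def)

lemmas gauss_real_distribution = real_distribution_density[OF positive_density_std_normal]
lemmas Phi_has_derivative = dist_fun_has_derivative[OF positive_density_std_normal, folded Phi_eq_dist_fun]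
lemmas Phi_strict_mono = dist_fun_strict_mono[OF positive_density_std_normal, folded Phi_eq_dist_fun]
lemmas Phi_le_iff = dist_fun_le_iff[OF positive_density_std_normal, folded Phi_eq_dist_fun]
lemmas Phi_at_top = dist_fun_at_top[OF positive_density_std_normal, folded Phi_eq_dist_fun]
lemmas Phi_at_bot = dist_fun_at_bot[OF positive_density_std_normal, folded Phi_eq_dist_fun]
lemmas Phi_bounds = dist_fun_bounds[OF positive_density_std_normal, folded Phi_eq_dist_fun]
lemmas isCont_Phi = isCont_dist_fun[OF positive_density_std_normal, folded Phi_eq_dist_fun]
lemmas Phi_surj = dist_fun_surj[OF positive_density_std_normal, folded Phi_eq_dist_fun]
lemmas Phi_inv_Phi = quantile_dist_fun[OF positive_density_std_normal, folded Phi_eq_dist_fun]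
lemmas Phi_Phi_inv = dist_fun_quantile[OF positive_density_std_normal, folded Phi_eq_dist_fun]
lemmas Phi_inv_mono = quantile_mono[OF positive_density_std_normal]
lemmas isCont_Phi_inv = isCont_quantile[OF positive_density_std_normal]
lemmas Phi_inv_has_derivative = quantile_has_derivative[OF positive_density_std_normal]

declare Phi_inv_Phi [simp]

interpretation gauss: real_distribution gauss
  by (rule gauss_real_distribution)

lemma measure_gauss_atMost: "measure gauss {..x} = Phi x"
  using cdf_density[OF positive_density_std_normal] by (simp add: cdf_def2 fun_eq_iff Phi_eq_dist_fun)

lemma std_normal_density_has_derivative:
  "(std_normal_density has_real_derivative - x * std_normal_density x) (at x)"
proof -
  have "std_normal_density = (\<lambda>x. 1 / sqrt (2 * pi) * exp (- x\<^sup>2 / 2))"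
    by (simp add: fun_eq_iff std_normal_density_def)
  moreover have "((\<lambda>x. C * exp (- x\<^sup>2 / 2)) has_real_derivative - x * (C * exp (- x\<^sup>2 / 2))) (at x)" for C :: real
    by (auto intro!: derivative_eq_intros)
  ultimately show ?thesis by metis
qed

lemma std_normal_density_pos [simp]: "0 < std_normal_density x"
  by (simp add: normal_density_def)

text \<open>
  The Gaussian measure of the \<open>t\<close>-enlargement of a half-space of measure \<open>m\<close>. The values at 0 and 1 are
  those for \<open>Phi_inv 0 = - \<infinity>\<close> and \<open>Phi_inv 1 = \<infinity>\<close>.
\<close>

definition Phi_shift :: "real \<Rightarrow> real \<Rightarrow> real" where
  "Phi_shift t m = (if m \<le> 0 then 0 else if 1 \<le> m then 1 else Phi (Phi_inv m + t))"

lemma Phi_shift_eq: "0 < m \<Longrightarrow> m < 1 \<Longrightarrow> Phi_shift t m = Phi (Phi_inv m + t)"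
  by (simp add: Phi_shift_def)

lemma Phi_shift_bounds: "0 \<le> Phi_shift t m" "Phi_shift t m \<le> 1"
  using Phi_bounds[of "Phi_inv m + t"] by (auto simp: Phi_shift_def)

lemma Phi_shift_mono: assumes "t \<le> t'" "m \<le> m'" shows "Phi_shift t m \<le> Phi_shift t' m'"
  using assms Phi_shift_bounds[of t' m'] Phi_shift_bounds[of t m] Phi_inv_mono[of m m']
  by (cases "m \<le> 0"; cases "1 \<le> m'") (auto simp: Phi_shift_def Phi_le_iff)

definition gauss_tail :: "real \<Rightarrow> real" where
  "gauss_tail r = measure gauss {z. r < \<bar>z\<bar>}"

lemma gauss_tail_tendsto: "(gauss_tail \<longlongrightarrow> 0) at_top"
proof (rule tendsto_sandwich[OF _ _ tendsto_const])
  have "gauss_tail r \<le> Phi (- r) + (1 - Phi r)" for r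
  proof -
    have "gauss_tail r \<le> measure gauss ({..-r} \<union> (UNIV - {..r}))"
      unfolding gauss_tail_def by (intro gauss.finite_measure_mono) auto
    also have "\<dots> \<le> measure gauss {..-r} + measure gauss (UNIV - {..r})"
      by (intro measure_Un_le) auto
    also have "measure gauss (UNIV - {..r}) = 1 - measure gauss {..r}"
      using gauss.prob_compl[of "{..r}"] by simp
    finally show ?thesis by (simp add: measure_gauss_atMost)
  qed
  then show "\<forall>\<^sub>F r in at_top. gauss_tail r \<le> Phi (- r) + (1 - Phi r)" by simp
  have "((\<lambda>r. Phi (- r) + (1 - Phi r)) \<longlongrightarrow> 0 + (1 - 1)) at_top"
    by (intro tendsto_intros Phi_at_top filterlim_compose[OF Phi_at_bot filterlim_uminus_at_bot_at_top])
  then show "((\<lambda>r. Phi (- r) + (1 - Phi r)) \<longlongrightarrow> 0) at_top" by simp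
qed (auto simp: gauss_tail_def)

definition step_fun :: "real \<Rightarrow> 'k set \<Rightarrow> ('k \<Rightarrow> real) \<Rightarrow> ('k \<Rightarrow> real) \<Rightarrow> real \<Rightarrow> real" where
  "step_fun c0 K c a x = c0 + (\<Sum>k\<in>K. c k * indicator {..a k} x)"

text \<open>
  The mean of the step function under the normal law with mean \<open>x\<close> and variance \<open>s\<close>
  (\<open>heat_eq_integral\<close>). For a step function this is a finite combination of values of \<open>Phi\<close>, so that its
  smoothness and the heat equation can be read off.
\<close>

definition heat :: "real \<Rightarrow> 'k set \<Rightarrow> ('k \<Rightarrow> real) \<Rightarrow> ('k \<Rightarrow> real) \<Rightarrow> real \<Rightarrow> real \<Rightarrow> real" where
  "heat c0 K c a s x = c0 + (\<Sum>k\<in>K. c k * Phi ((a k - x) / sqrt s))"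

context
  fixes c0 :: real and K :: "'k set" and c a :: "'k \<Rightarrow> real"
  assumes K: "finite K"
begin

abbreviation "the_step \<equiv> step_fun c0 K c a"
abbreviation "the_heat \<equiv> heat c0 K c a"

lemma step_fun_measurable [measurable]: "the_step \<in> borel_measurable borel"
  unfolding step_fun_def by measurable

lemma step_fun_finite_range: "finite (range the_step)"
proof -
  have "the_step x \<in> (\<lambda>L. c0 + sum c L) ` Pow K" for x
  proof -
    have "the_step x = c0 + sum c {k\<in>K. x \<le> a k}"
      unfolding step_fun_def using K
      by (simp add: sum.inter_filter)
    then show ?thesis by auto
  qed
  then have "range the_step \<subseteq> (\<lambda>L. c0 + sum c L) ` Pow K" by auto
  then show ?thesis using K finite_subset by blast
qed

lemma step_fun_integrable: "integrable gauss (\<lambda>z. the_step (x + s * z))"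
proof -
  obtain B where "\<And>y. y \<in> range the_step \<Longrightarrow> norm y \<le> B"
    using finite_imp_bounded[OF step_fun_finite_range] by (meson bounded_iff)
  then show ?thesis by (intro gauss.integrable_const_bound[where B=B]) auto
qed

lemma heat_eq_integral:
  assumes "0 < s" shows "the_heat s x = (\<integral>z. the_step (x + sqrt s * z) \<partial>gauss)"
proof -
  have "(\<integral>z. indicat_real {..b} (x + sqrt s * z) \<partial>gauss) = Phi ((b - x) / sqrt s)" for b
  proof -
    have "(\<integral>z. indicat_real {..b} (x + sqrt s * z) \<partial>gauss) = (\<integral>z. indicat_real {..(b - x) / sqrt s} z \<partial>gauss)"
      using assms by (intro Bochner_Integration.integral_cong) (auto simp: indicator_def field_simps)
    then show ?thesis by (simp add: measure_gauss_atMost)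
  qed
  moreover have "integrable gauss (\<lambda>z. indicat_real {..b} (x + sqrt s * z))" for b
    by (intro gauss.integrable_const_bound[where B=1]) auto
  ultimately have "has_bochner_integral gauss (\<lambda>z. c k * indicat_real {..a k} (x + sqrt s * z)) (c k * Phi ((a k - x) / sqrt s))" for k
    by (intro has_bochner_integral_mult_right) (simp add: has_bochner_integral_iff)
  moreover have "has_bochner_integral gauss (\<lambda>z. c0) c0"
    using gauss.prob_space[unfolded gauss.space_eq_univ] by (simp add: has_bochner_integral_iff)
  ultimately show ?thesis
    unfolding step_fun_def heat_def using K
    by (intro has_bochner_integral_integral_eq[symmetric] has_bochner_integral_add has_bochner_integral_sum) auto
qed

text \<open>
  Up to a Gaussian tail the value at \<open>x\<close> only depends on the step function within distance
  \<open>r * sqrt s\<close> of \<open>x\<close>. This, with its counterpart \<open>heat_ge\<close>, takes the place of continuity at time 0, which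
  fails for step functions.
\<close>

lemma heat_le:
  assumes "0 < s" "\<And>z. \<bar>z\<bar> \<le> r \<Longrightarrow> the_step (x + sqrt s * z) \<le> M" "\<And>x. the_step x \<le> 1" "0 \<le> M"
  shows "the_heat s x \<le> M + gauss_tail r"
proof -
  have "the_heat s x \<le> (\<integral>z. M + indicat_real {z. r < \<bar>z\<bar>} z \<partial>gauss)"
    unfolding heat_eq_integral[OF assms(1)]
  proof (rule integral_mono)
    show "integrable gauss (\<lambda>z. M + indicat_real {z. r < \<bar>z\<bar>} z)"
      by (intro gauss.integrable_const_bound[where B="M + 1"]) (use assms in \<open>auto simp: indicator_def\<close>)
    fix z show "the_step (x + sqrt s * z) \<le> M + indicat_real {z. r < \<bar>z\<bar>} z"
      using assms(2)[of z] assms(3)[of "x + sqrt s * z"] assms(4) by (auto simp: indicator_def)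
  qed (rule step_fun_integrable)
  also have "\<dots> = M + gauss_tail r"
    unfolding gauss_tail_def
    by (subst Bochner_Integration.integral_add)
      (auto intro!: gauss.integrable_const_bound[where B=1] simp: gauss.prob_space[unfolded gauss.space_eq_univ])
  finally show ?thesis .
qed

lemma heat_ge:
  assumes "0 < s" "\<And>z. \<bar>z\<bar> \<le> r \<Longrightarrow> M \<le> the_step (x + sqrt s * z)" "\<And>x. 0 \<le> the_step x" "M \<le> 1"
  shows "M - gauss_tail r \<le> the_heat s x"
proof -
  have "M - gauss_tail r = (\<integral>z. M - indicat_real {z. r < \<bar>z\<bar>} z \<partial>gauss)"
    unfolding gauss_tail_def
    by (subst Bochner_Integration.integral_diff)
      (auto intro!: gauss.integrable_const_bound[where B=1] simp: gauss.prob_space[unfolded gauss.space_eq_univ])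
  also have "\<dots> \<le> the_heat s x"
    unfolding heat_eq_integral[OF assms(1)]
  proof (rule integral_mono)
    show "integrable gauss (\<lambda>z. M - indicat_real {z. r < \<bar>z\<bar>} z)"
      by (intro gauss.integrable_const_bound[where B="\<bar>M\<bar> + 1"]) (use assms in \<open>auto simp: indicator_def\<close>)
    fix z show "M - indicat_real {z. r < \<bar>z\<bar>} z \<le> the_step (x + sqrt s * z)"
      using assms(2)[of z] assms(3)[of "x + sqrt s * z"] assms(4) by (auto simp: indicator_def)
  qed (rule step_fun_integrable)
  finally show ?thesis .
qed

lemma heat_bounds:
  assumes "0 < s" "\<And>x. lo \<le> the_step x" "\<And>x. the_step x \<le> hi"
  shows "lo \<le> the_heat s x" "the_heat s x \<le> hi"
proof -
  have c: "(\<integral>z. b \<partial>gauss) = b" for b :: real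
    using gauss.prob_space[unfolded gauss.space_eq_univ] by simp
  show "lo \<le> the_heat s x"
    unfolding heat_eq_integral[OF assms(1)] using assms
    by (subst c[of lo, symmetric], intro integral_mono step_fun_integrable) auto
  show "the_heat s x \<le> hi"
    unfolding heat_eq_integral[OF assms(1)] using assms
    by (subst c[of hi, symmetric], intro integral_mono step_fun_integrable) auto
qed

definition heat_x :: "real \<Rightarrow> real \<Rightarrow> real" where
  "heat_x s x = - (\<Sum>k\<in>K. c k * std_normal_density ((a k - x) / sqrt s)) / sqrt s"

definition heat_xx :: "real \<Rightarrow> real \<Rightarrow> real" where
  "heat_xx s x = - (\<Sum>k\<in>K. c k * ((a k - x) / sqrt s * std_normal_density ((a k - x) / sqrt s))) / s"

lemma heat_has_derivative_x:
  assumes "0 < s" shows "(the_heat s has_real_derivative heat_x s x) (at x)"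
proof -
  have "((\<lambda>x. c k * Phi ((a k - x) / sqrt s)) has_real_derivative
      - (c k * std_normal_density ((a k - x) / sqrt s)) / sqrt s) (at x)" for k
  proof -
    have "((\<lambda>x. (a k - x) / sqrt s) has_real_derivative - 1 / sqrt s) (at x)"
      by (intro DERIV_cdivide) (auto intro!: derivative_eq_intros)
    from DERIV_cmult[OF DERIV_chain2[OF Phi_has_derivative this], of "c k"]
    show ?thesis by simp
  qed
  then have "((\<lambda>x. c0 + (\<Sum>k\<in>K. c k * Phi ((a k - x) / sqrt s))) has_real_derivative
      0 + (\<Sum>k\<in>K. - (c k * std_normal_density ((a k - x) / sqrt s)) / sqrt s)) (at x)"
    by (intro DERIV_add DERIV_const DERIV_sum) auto
  then show ?thesis
    by (simp add: heat_def[abs_def] heat_x_def sum_divide_distrib sum_negf)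
qed

lemma heat_x_has_derivative_x:
  assumes "0 < s" shows "(heat_x s has_real_derivative heat_xx s x) (at x)"
proof -
  have "((\<lambda>x. c k * std_normal_density ((a k - x) / sqrt s)) has_real_derivative
      c k * ((a k - x) / sqrt s * std_normal_density ((a k - x) / sqrt s)) / sqrt s) (at x)" for k
  proof -
    have "((\<lambda>x. (a k - x) / sqrt s) has_real_derivative - 1 / sqrt s) (at x)"
      by (intro DERIV_cdivide) (auto intro!: derivative_eq_intros)
    from DERIV_cmult[OF DERIV_chain2[OF std_normal_density_has_derivative this], of "c k"]
    show ?thesis by simp
  qed
  then have "((\<lambda>x. - (\<Sum>k\<in>K. c k * std_normal_density ((a k - x) / sqrt s)) / sqrt s) has_real_derivative
      - (\<Sum>k\<in>K. c k * ((a k - x) / sqrt s * std_normal_density ((a k - x) / sqrt s)) / sqrt s) / sqrt s) (at x)"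
    by (intro DERIV_cdivide DERIV_minus DERIV_sum) auto
  moreover have "- (\<Sum>k\<in>K. c k * ((a k - x) / sqrt s * std_normal_density ((a k - x) / sqrt s)) / sqrt s) / sqrt s = heat_xx s x"
    using assms by (simp only: heat_xx_def sum_divide_distrib[symmetric]) simp
  ultimately show ?thesis
    by (simp add: heat_x_def[abs_def])
qed

text \<open>
  The heat equation in the form that \<open>maximum_principle\<close> needs: half the second space derivative, plus the
  contribution of the moving point.
\<close>

lemma heat_has_derivative_curve:
  assumes "0 < s" and \<xi>: "(\<xi> has_real_derivative \<xi>') (at s)"
  shows "((\<lambda>s. the_heat s (\<xi> s)) has_real_derivative heat_xx s (\<xi> s) / 2 + heat_x s (\<xi> s) * \<xi>') (at s)"
proof -
  let ?z = "\<lambda>k. (a k - \<xi> s) / sqrt s"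
  have "((\<lambda>s. c k * Phi ((a k - \<xi> s) / sqrt s)) has_real_derivative
      - (c k * (?z k * std_normal_density (?z k))) / s / 2 + - (c k * std_normal_density (?z k)) / sqrt s * \<xi>') (at s)" for k
  proof -
    have "((\<lambda>s. (a k - \<xi> s) / sqrt s) has_real_derivative (- \<xi>' / sqrt s - ?z k / s / 2)) (at s)"
      using assms(1) by (auto intro!: derivative_eq_intros \<xi> simp: field_simps)
    from DERIV_cmult[OF DERIV_chain2[OF Phi_has_derivative this], of "c k"]
    show ?thesis by (simp add: algebra_simps)
  qed
  then have "((\<lambda>s. c0 + (\<Sum>k\<in>K. c k * Phi ((a k - \<xi> s) / sqrt s))) has_real_derivative
      0 + (\<Sum>k\<in>K. - (c k * (?z k * std_normal_density (?z k))) / s / 2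
             + - (c k * std_normal_density (?z k)) / sqrt s * \<xi>')) (at s)"
    by (intro DERIV_add DERIV_const DERIV_sum) auto
  then show ?thesis
    unfolding heat_def heat_x_def heat_xx_def
    by (simp add: sum.distrib sum_subtractf sum_negf sum_divide_distrib sum_distrib_right)
qed

lemma heat_continuous: "continuous_on ({0<..} \<times> UNIV) (\<lambda>(s, x). the_heat s x)"
proof -
  have "continuous_on UNIV Phi" by (simp add: continuous_on_eq_continuous_at isCont_Phi)
  then have "continuous_on ({0<..} \<times> UNIV) (\<lambda>w. Phi ((a k - snd w) / sqrt (fst w)))" for k
    by (rule continuous_on_compose2) (auto intro!: continuous_intros)
  then show ?thesis
    unfolding heat_def split_beta by (auto intro!: continuous_intros)
qed

context
  assumes P01: "\<And>s x. 0 < s \<Longrightarrow> 0 < the_heat s x \<and> the_heat s x < 1"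
begin

text \<open>
  The Gaussian quantile of the heat flow, followed by its two space derivatives; the quadratic term in
  the second one comes from \<open>\<phi>' x = - x * \<phi> x\<close> for the Gaussian density \<open>\<phi>\<close>.
\<close>

definition "heat_quantile s x = Phi_inv (the_heat s x)"
definition "heat_quantile_x s x = heat_x s x / std_normal_density (heat_quantile s x)"
definition "heat_quantile_xx s x = heat_xx s x / std_normal_density (heat_quantile s x) + heat_quantile s x * (heat_quantile_x s x)\<^sup>2"

lemma heat_quantile_has_derivative_x: "0 < s \<Longrightarrow> (heat_quantile s has_real_derivative heat_quantile_x s x) (at x)"
  using DERIV_chain2[OF Phi_inv_has_derivative heat_has_derivative_x, of s x] P01[of s x]
  by (simp add: heat_quantile_def[abs_def] heat_quantile_x_def)

lemma heat_quantile_x_has_derivative_x: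
  assumes "0 < s" shows "(heat_quantile_x s has_real_derivative heat_quantile_xx s x) (at x)"
proof -
  let ?D = "std_normal_density (heat_quantile s x)"
  have D: "?D \<noteq> 0" using std_normal_density_pos[of "heat_quantile s x"] by linarith
  have eq: "heat_quantile_x s = (\<lambda>x. heat_x s x / std_normal_density (heat_quantile s x))"
    by (simp add: fun_eq_iff heat_quantile_x_def)
  have "((\<lambda>x. heat_x s x / std_normal_density (heat_quantile s x)) has_real_derivative (heat_xx s x * ?D - heat_x s x * (- heat_quantile s x * ?D * heat_quantile_x s x)) / (?D * ?D)) (at x)"
    by (intro DERIV_divide heat_x_has_derivative_x DERIV_chain2[OF std_normal_density_has_derivative]
      heat_quantile_has_derivative_x D assms)
  also have "(heat_xx s x * ?D - heat_x s x * (- heat_quantile s x * ?D * heat_quantile_x s x)) / (?D * ?D) = heat_quantile_xx s x"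
    using D by (simp add: heat_quantile_xx_def heat_quantile_x_def field_simps power2_eq_square)
  finally show ?thesis by (simp only: eq)
qed

lemma heat_quantile_has_derivative_curve:
  assumes "0 < s" "(\<xi> has_real_derivative \<xi>') (at s)"
  shows "((\<lambda>s. heat_quantile s (\<xi> s)) has_real_derivative
     (heat_quantile_xx s (\<xi> s) - heat_quantile s (\<xi> s) * (heat_quantile_x s (\<xi> s))\<^sup>2) / 2 + heat_quantile_x s (\<xi> s) * \<xi>') (at s)"
proof -
  have "((\<lambda>s. heat_quantile s (\<xi> s)) has_real_derivative
    1 / std_normal_density (heat_quantile s (\<xi> s)) * (heat_xx s (\<xi> s) / 2 + heat_x s (\<xi> s) * \<xi>')) (at s)"
    using DERIV_chain2[OF Phi_inv_has_derivative heat_has_derivative_curve[OF assms]] P01[OF assms(1)]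
    by (simp add: heat_quantile_def[abs_def])
  then show ?thesis by (simp add: heat_quantile_xx_def heat_quantile_x_def algebra_simps)
qed

lemma heat_quantile_continuous: "continuous_on ({0<..} \<times> UNIV) (\<lambda>(s, x). heat_quantile s x)"
proof -
  have "continuous_on {0<..<1} Phi_inv"
    by (simp add: continuous_on_eq_continuous_at isCont_Phi_inv)
  from continuous_on_compose2[OF this heat_continuous]
  show ?thesis using P01 by (force simp: heat_quantile_def split_beta)
qed

end
end

section \<open>The functional isoperimetric inequality on the line\<close>

text \<open>
  Since \<open>rel\<close> still holds when both points are moved by \<open>\<delta>\<close>, \<open>heat_le\<close> and \<open>heat_ge\<close> give the
  initial relation of \<open>maximum_principle\<close> at a small time \<open>s0\<close> up to an error \<open>e\<close>. Far out, \<open>u\<close> is equal to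
  its lower bound \<open>\<epsilon>\<close> while \<open>v\<close> is at least \<open>Phi_shift t \<epsilon>\<close>, and this gives the relation there for all
  times. At a time \<open>s\<close> close to 1, the point \<open>y = 0\<close> and the angle 0 yield the claim up to \<open>e\<close>.
\<close>

lemma Phi_shift_integral_le_step_fun:
  fixes c0 c0' t \<epsilon> \<epsilon>' \<delta> N :: real and K :: "'k set" and K' :: "'l set"
  assumes fin: "finite K" "finite K'"
    and pos: "0 < \<epsilon>" "0 < \<epsilon>'" "0 < \<delta>" "0 \<le> t" "\<epsilon> < 1"
    and u: "\<And>x. \<epsilon> \<le> step_fun c0 K c a x" "\<And>x. step_fun c0 K c a x \<le> 1 - \<epsilon>"
    and u_out: "\<And>x. N < \<bar>x\<bar> \<Longrightarrow> step_fun c0 K c a x = \<epsilon>"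
    and v: "\<And>y. Phi_shift t \<epsilon> \<le> step_fun c0' K' c' a' y" "\<And>y. step_fun c0' K' c' a' y \<le> 1 - \<epsilon>'"
    and rel: "\<And>x y x' y'. \<bar>x' - x\<bar> \<le> \<delta> \<Longrightarrow> \<bar>y' - y\<bar> \<le> \<delta> \<Longrightarrow> \<bar>x - y\<bar> \<le> t \<Longrightarrow>
       Phi_shift (sqrt (t\<^sup>2 - (x - y)\<^sup>2)) (step_fun c0 K c a x') \<le> step_fun c0' K' c' a' y'"
  shows "Phi_shift t (\<integral>z. step_fun c0 K c a z \<partial>gauss) \<le> (\<integral>z. step_fun c0' K' c' a' z \<partial>gauss)"
proof -
  let ?u = "step_fun c0 K c a" and ?v = "step_fun c0' K' c' a'"
  let ?P = "heat c0 K c a" and ?Q = "heat c0' K' c' a'"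
  have sh\<epsilon>: "Phi_shift t \<epsilon> = Phi (Phi_inv \<epsilon> + t)" using pos by (simp add: Phi_shift_eq)
  have \<epsilon>sh: "\<epsilon> \<le> Phi_shift t \<epsilon>"
    using pos Phi_le_iff[of "Phi_inv \<epsilon>" "Phi_inv \<epsilon> + t"] by (simp add: sh\<epsilon> Phi_Phi_inv)
  have v_lo: "\<epsilon> \<le> ?v y" for y using v(1)[of y] \<epsilon>sh by linarith
  have Pb: "\<epsilon> \<le> ?P s x" "?P s x \<le> 1 - \<epsilon>" if "0 < s" for s x
    using heat_bounds[OF fin(1) that u] by auto
  have Qb: "Phi_shift t \<epsilon> \<le> ?Q s x" "?Q s x \<le> 1 - \<epsilon>'" if "0 < s" for s x
    using heat_bounds[OF fin(2) that v] by auto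
  have P01: "0 < ?P s x \<and> ?P s x < 1" if "0 < s" for s x
    using Pb[OF that, of x] pos by linarith
  have Q01: "0 < ?Q s x \<and> ?Q s x < 1" if "0 < s" for s x
    using Qb[OF that, of x] pos \<epsilon>sh by linarith
  let ?U = "heat_quantile c0 K c a" and ?V = "heat_quantile c0' K' c' a'"
  note UP = fin(1) P01 and VQ = fin(2) Q01
  have Ueq: "?U s x = Phi_inv (?P s x)" and Veq: "?V s x = Phi_inv (?Q s x)" for s x
    by (rule heat_quantile_def[OF UP], assumption) (rule heat_quantile_def[OF VQ], assumption)
  define I where "I = {min \<epsilon> \<epsilon>' / 2..1 - min \<epsilon> \<epsilon>' / 2}"
  have "continuous_on I Phi_inv"
    using pos by (auto simp: I_def continuous_on_eq_continuous_at intro!: continuous_at_imp_continuous_on isCont_Phi_inv)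
  then have unif: "uniformly_continuous_on I Phi_inv"
    by (intro compact_uniformly_continuous) (auto simp: I_def)
  \<comment> \<open>All values of the two flows lie in \<open>I\<close>, where \<open>Phi_inv\<close> is uniformly continuous.\<close>
  have main: "Phi (Phi_inv (?P 1 0) + t - e) \<le> ?Q 1 0" if e: "0 < e" for e
  proof -
    obtain d where d: "0 < d" "\<And>p q. p \<in> I \<Longrightarrow> q \<in> I \<Longrightarrow> \<bar>p - q\<bar> < d \<Longrightarrow> \<bar>Phi_inv p - Phi_inv q\<bar> < e / 2"
      using unif e unfolding uniformly_continuous_on_def dist_real_def by (meson half_gt_zero)
    \<comment> \<open>All values keep the distance \<open>min \<epsilon> \<epsilon>'\<close> from 0 and 1, so that shifts by \<open>\<omega>\<close> lead to points of \<open>I\<close>.\<close>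
    define \<omega> where "\<omega> = min d (min \<epsilon> \<epsilon>' / 2) / 2"
    have \<omega>: "0 < \<omega>" "\<omega> < d" "\<omega> < min \<epsilon> \<epsilon>' / 2" using d pos by (auto simp: \<omega>_def)
    have "\<forall>\<^sub>F r in at_top. gauss_tail r < \<omega>"
      using order_tendstoD(2)[OF gauss_tail_tendsto \<omega>(1)] .
    then obtain r1 where "\<And>r. r1 \<le> r \<Longrightarrow> gauss_tail r < \<omega>"
      by (auto simp: eventually_at_top_linorder)
    then obtain r where r: "0 < r" "gauss_tail r < \<omega>"
      using that by (metis max.cobounded1 max.strict_coboundedI2 zero_less_one)
    \<comment> \<open>At this time the bulk \<open>\<bar>z\<bar> \<le> r\<close> of the Gaussian moves points by at most \<open>\<delta>\<close>.\<close>
    define s0 where "s0 = min (1/2) ((\<delta> / r)\<^sup>2)"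
    have s0: "0 < s0" "s0 < 1" using r pos by (auto simp: s0_def)
    have "sqrt s0 \<le> sqrt ((\<delta> / r)\<^sup>2)" unfolding s0_def by (intro real_sqrt_le_mono) auto
    also have "\<dots> = \<delta> / r" using r pos by simp
    finally have s0r: "sqrt s0 * \<bar>z\<bar> \<le> \<delta>" if "\<bar>z\<bar> \<le> r" for z
      using mult_mono[of "sqrt s0" "\<delta> / r" "\<bar>z\<bar>" r] that r pos by auto
    have init: "?U s0 (y + t * sqrt (1 - s0) * sin \<theta>) + t * cos \<theta> - e \<le> ?V s0 y" for y \<theta>
    proof -
      define x where "x = y + t * sqrt (1 - s0) * sin \<theta>"
      have fr: "finite (?u ` {x'. \<bar>x' - x\<bar> \<le> \<delta>})" "finite (?v ` {y'. \<bar>y' - y\<bar> \<le> \<delta>})"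
        using step_fun_finite_range[OF fin(1), of c0 c a] step_fun_finite_range[OF fin(2), of c0' c' a']
        by (meson finite_subset image_mono subset_UNIV)+
      obtain x1 where x1: "\<bar>x1 - x\<bar> \<le> \<delta>" "\<And>x'. \<bar>x' - x\<bar> \<le> \<delta> \<Longrightarrow> ?u x' \<le> ?u x1"
      proof -
        have "Max (?u ` {x'. \<bar>x' - x\<bar> \<le> \<delta>}) \<in> ?u ` {x'. \<bar>x' - x\<bar> \<le> \<delta>}"
          using fr pos by (intro Max_in) (auto intro!: exI[of _ x])
        then show ?thesis using that Max_ge[OF fr(1)] by fastforce
      qed
      obtain y1 where y1: "\<bar>y1 - y\<bar> \<le> \<delta>" "\<And>y'. \<bar>y' - y\<bar> \<le> \<delta> \<Longrightarrow> ?v y1 \<le> ?v y'"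
      proof -
        have "Min (?v ` {y'. \<bar>y' - y\<bar> \<le> \<delta>}) \<in> ?v ` {y'. \<bar>y' - y\<bar> \<le> \<delta>}"
          using fr pos by (intro Min_in) (auto intro!: exI[of _ y])
        then show ?thesis using that Min_le[OF fr(2)] by fastforce
      qed
      define M where "M = ?u x1"
      define m where "m = ?v y1"
      have M: "\<epsilon> \<le> M" "M \<le> 1 - \<epsilon>" and m: "\<epsilon> \<le> m" "m \<le> 1 - \<epsilon>'"
        using u v v_lo by (auto simp: M_def m_def)
      have P: "?P s0 x \<le> M + \<omega>"
      proof -
        have "?P s0 x \<le> M + gauss_tail r"
        proof (rule heat_le[OF fin(1) s0(1)])
          show "?u (x + sqrt s0 * z) \<le> M" if "\<bar>z\<bar> \<le> r" for z
            unfolding M_def using s0r[OF that] s0 by (intro x1) (simp add: abs_mult)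
          show "?u x \<le> 1" for x using u(2)[of x] pos by linarith
        qed (use M pos in auto)
        then show ?thesis using r by simp
      qed
      have Q: "m - \<omega> \<le> ?Q s0 y"
      proof -
        have "m - gauss_tail r \<le> ?Q s0 y"
        proof (rule heat_ge[OF fin(2) s0(1)])
          show "m \<le> ?v (y + sqrt s0 * z)" if "\<bar>z\<bar> \<le> r" for z
            unfolding m_def using s0r[OF that] s0 by (intro y1) (simp add: abs_mult)
          show "0 \<le> ?v x" for x using v_lo[of x] pos by linarith
        qed (use m pos in auto)
        then show ?thesis using r by simp
      qed
      define \<rho> where "\<rho> = sqrt (t\<^sup>2 - (x - y)\<^sup>2)"
      have xy: "(x - y)\<^sup>2 \<le> t\<^sup>2 * (sin \<theta>)\<^sup>2"
        using s0 mult_left_le_one_le[of "(t * sin \<theta>)\<^sup>2" "1 - s0"]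
        by (simp add: x_def power_mult_distrib mult.commute mult.left_commute)
      have "t\<^sup>2 * (sin \<theta>)\<^sup>2 \<le> t\<^sup>2" using sin_cos_squared_add[of \<theta>] zero_le_power2[of "cos \<theta>"]
        by (intro mult_left_le) (linarith, simp)
      with xy have "(x - y)\<^sup>2 \<le> t\<^sup>2" by linarith
      then have xyt: "\<bar>x - y\<bar> \<le> t" using pos by (simp add: abs_le_square_iff[symmetric])
      have \<rho>: "t * cos \<theta> \<le> \<rho>"
        unfolding \<rho>_def using xy
        by (intro real_le_rsqrt) (simp add: power_mult_distrib cos_squared_eq algebra_simps)
      have "Phi_shift \<rho> M \<le> m"
        unfolding \<rho>_def M_def m_def by (rule rel[OF x1(1) y1(1) xyt])
      then have "Phi (Phi_inv M + \<rho>) \<le> Phi (Phi_inv m)"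
        using M m pos by (simp add: Phi_shift_eq Phi_Phi_inv)
      then have mid: "Phi_inv M + \<rho> \<le> Phi_inv m" by (simp add: Phi_le_iff)
      have "?U s0 x \<le> Phi_inv (M + \<omega>)"
        unfolding Ueq using P P01[OF s0(1), of x] M \<omega> by (intro Phi_inv_mono) auto
      moreover have "\<bar>Phi_inv (M + \<omega>) - Phi_inv M\<bar> < e / 2"
        using M \<omega> by (intro d(2)) (auto simp: I_def)
      moreover have "Phi_inv (m - \<omega>) \<le> ?V s0 y"
        unfolding Veq using Q Q01[OF s0(1), of y] m \<omega> by (intro Phi_inv_mono) auto
      moreover have "\<bar>Phi_inv (m - \<omega>) - Phi_inv m\<bar> < e / 2"
        using m \<omega> by (intro d(2)) (auto simp: I_def)
      ultimately have "?U s0 x + t * cos \<theta> - e \<le> ?V s0 y"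
        using mid \<rho> by linarith
      then show ?thesis by (simp add: x_def)
    qed
    have far: "?U s (y + t * sqrt (1 - s) * sin \<theta>) + t * cos \<theta> - e \<le> ?V s y"
      if s: "0 < s" "s < 1" and y: "\<bar>N\<bar> + t + r + 1 \<le> \<bar>y\<bar>" for s y \<theta>
    proof -
      define x where "x = y + t * sqrt (1 - s) * sin \<theta>"
      have "\<bar>sqrt (1 - s) * sin \<theta>\<bar> \<le> 1 * 1" using s unfolding abs_mult by (intro mult_mono) auto
      then have "\<bar>t * (sqrt (1 - s) * sin \<theta>)\<bar> \<le> t"
        using pos by (simp add: abs_mult mult_left_le)
      then have x: "\<bar>N\<bar> + r + 1 \<le> \<bar>x\<bar>" using y by (simp add: x_def mult.assoc)
      have "?P s x \<le> \<epsilon> + gauss_tail r"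
      proof (rule heat_le[OF fin(1) s(1)])
        show "?u (x + sqrt s * z) \<le> \<epsilon>" if "\<bar>z\<bar> \<le> r" for z
        proof -
          have "\<bar>sqrt s * z\<bar> \<le> 1 * r" using s that unfolding abs_mult by (intro mult_mono) auto
          then have "N < \<bar>x + sqrt s * z\<bar>" using x by linarith
          then show ?thesis using u_out by simp
        qed
        show "?u x \<le> 1" for x using u(2)[of x] pos by linarith
      qed (use pos in auto)
      then have P: "?P s x \<le> \<epsilon> + \<omega>" using r by simp
      have \<epsilon>1: "\<epsilon> \<le> 1 - \<epsilon>'" using v_lo[of 0] v(2)[of 0] by linarith
      have \<epsilon>2: "\<epsilon> \<le> 1 - \<epsilon>" using u(1)[of 0] u(2)[of 0] by linarith
      have "?U s x \<le> Phi_inv (\<epsilon> + \<omega>)"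
        unfolding Ueq using P P01[OF s(1), of x] \<omega> \<epsilon>1 by (intro Phi_inv_mono) auto
      moreover have "\<bar>Phi_inv (\<epsilon> + \<omega>) - Phi_inv \<epsilon>\<bar> < e / 2"
        using \<omega> \<epsilon>1 \<epsilon>2 pos by (intro d(2)) (auto simp: I_def)
      moreover have "Phi_inv \<epsilon> + t \<le> ?V s y"
        using Qb(1)[OF s(1), of y] Q01[OF s(1), of y] Phi_le_iff[of "Phi_inv \<epsilon> + t" "?V s y"]
        by (simp add: sh\<epsilon> Veq Phi_Phi_inv)
      moreover have "t * cos \<theta> \<le> t" using pos by (simp add: mult_left_le)
      ultimately have "?U s x + t * cos \<theta> - e \<le> ?V s y" using e by linarith
      then show ?thesis by (simp add: x_def)
    qed
    have near: "Phi (Phi_inv (?P s 0) + t - e) \<le> ?Q s 0" if "s0 \<le> s" "s < 1" for s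
    proof -
      have pos': "0 < r" if "r \<in> {s0..s}" for r using that s0 by auto
      have sub: "{s0..s} \<times> UNIV \<subseteq> {0<..} \<times> UNIV" using s0 by auto
      have "?U s (0 + t * sqrt (1 - s) * sin 0) + t * cos 0 - e \<le> ?V s 0"
        by (rule maximum_principle[of s0 s e ?U "heat_quantile_x c0 K c a" "heat_quantile_xx c0 K c a" ?V
                "heat_quantile_x c0' K' c' a'" "heat_quantile_xx c0' K' c' a'" t "\<bar>N\<bar> + t + r + 1"])
          (use that s0 e pos' init far in \<open>auto intro: heat_quantile_has_derivative_x[OF UP] heat_quantile_x_has_derivative_x[OF UP] heat_quantile_has_derivative_curve[OF UP]
            heat_quantile_has_derivative_x[OF VQ] heat_quantile_x_has_derivative_x[OF VQ] heat_quantile_has_derivative_curve[OF VQ]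
            continuous_on_subset[OF heat_quantile_continuous[OF UP] sub] continuous_on_subset[OF heat_quantile_continuous[OF VQ] sub]\<close>)
      then have "Phi (?U s 0 + t - e) \<le> Phi (?V s 0)" by (simp add: Phi_le_iff)
      also have "\<dots> = ?Q s 0" using Q01[of s 0] s0 that by (simp add: Veq Phi_Phi_inv)
      finally show ?thesis using that s0 by (simp add: Ueq)
    qed
    have Pc: "isCont (\<lambda>s. ?P s 0) 1" and Qc: "isCont (\<lambda>s. ?Q s 0) 1"
      using heat_has_derivative_curve[OF fin(1), of 1 "\<lambda>_. 0" 0 c0 c a]
        heat_has_derivative_curve[OF fin(2), of 1 "\<lambda>_. 0" 0 c0' c' a']
      by (auto intro: DERIV_isCont)
    have "isCont (\<lambda>s. Phi (Phi_inv (?P s 0) + t - e)) 1"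
      using P01[of 1 0]
      by (intro isCont_o2[OF _ isCont_Phi] continuous_intros isCont_o2[OF Pc] isCont_Phi_inv) auto
    then have "((\<lambda>s. Phi (Phi_inv (?P s 0) + t - e)) \<longlongrightarrow> Phi (Phi_inv (?P 1 0) + t - e)) (at_left 1)"
      using isCont_def filterlim_at_split by blast
    moreover have "((\<lambda>s. ?Q s 0) \<longlongrightarrow> ?Q 1 0) (at_left 1)"
      using Qc isCont_def filterlim_at_split by blast
    moreover have "\<forall>\<^sub>F s in at_left 1. Phi (Phi_inv (?P s 0) + t - e) \<le> ?Q s 0"
      using s0 near by (auto simp: eventually_at_left_field intro!: exI[of _ s0])
    ultimately show ?thesis by (intro tendsto_le[of "at_left 1"]) auto
  qed
  have "((\<lambda>e. Phi (Phi_inv (?P 1 0) + t - e)) \<longlongrightarrow> Phi (Phi_inv (?P 1 0) + t - 0)) (at_right 0)"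
    by (intro isCont_tendsto_compose[OF isCont_Phi] tendsto_intros)
  then have "Phi (Phi_inv (?P 1 0) + t - 0) \<le> ?Q 1 0"
    by (rule tendsto_upperbound) (auto simp: eventually_at_right_field main intro!: exI[of _ 1])
  then show ?thesis
    using P01[of 1 0] heat_eq_integral[OF fin(1), of 1 c0 c a 0] heat_eq_integral[OF fin(2), of 1 c0' c' a' 0]
    by (simp add: Phi_shift_eq)
qed

lemma lattice_step_fun:
  fixes \<delta> c0 :: real and g :: "int \<Rightarrow> real" and N :: int
  assumes "0 < \<delta>"
  obtains K :: "(int \<times> bool) set" and c a where "finite K"
    "\<And>x. step_fun c0 K c a x = (if \<lceil>x / \<delta>\<rceil> \<in> {-N..N} then g \<lceil>x / \<delta>\<rceil> else c0)"
proof
  let ?K = "{-N..N} \<times> (UNIV :: bool set)"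
  let ?c = "\<lambda>(j, b). (g j - c0) * (if b then 1 else - 1)"
  let ?a = "\<lambda>(j, b). (of_int j - (if b then 0 else 1)) * \<delta>"
  show "finite ?K" by simp
  fix x
  have "(\<Sum>k\<in>?K. ?c k * indicat_real {..?a k} x) = (\<Sum>j\<in>{-N..N}. if j = \<lceil>x / \<delta>\<rceil> then g j - c0 else 0)"
    unfolding sum.cartesian_product'
  proof (rule sum.cong[OF refl])
    fix j :: int
    have "x \<le> of_int j * \<delta> \<longleftrightarrow> \<lceil>x / \<delta>\<rceil> \<le> j"
      using assms by (simp add: ceiling_le_iff pos_divide_le_eq)
    moreover have "x \<le> (of_int j - 1) * \<delta> \<longleftrightarrow> \<lceil>x / \<delta>\<rceil> \<le> j - 1"
      using assms by (subst ceiling_le_iff) (simp add: pos_divide_le_eq)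
    ultimately show "(\<Sum>b\<in>UNIV. (case (j, b) of (j, b) \<Rightarrow> (g j - c0) * (if b then 1 else - 1)) *
        indicat_real {..case (j, b) of (j, b) \<Rightarrow> (of_int j - (if b then 0 else 1)) * \<delta>} x)
      = (if j = \<lceil>x / \<delta>\<rceil> then g j - c0 else 0)"
      by (auto simp: UNIV_bool indicator_def)
  qed
  then show "step_fun c0 ?K ?c ?a x = (if \<lceil>x / \<delta>\<rceil> \<in> {-N..N} then g \<lceil>x / \<delta>\<rceil> else c0)"
    by (simp add: step_fun_def)
qed

text \<open>
  The function \<open>u\<close> is replaced by its almost-suprema over lattice cells of width \<open>\<delta>\<close>, set to \<open>\<epsilon>\<close> outside a
  window, and \<open>v\<close> by its infima over cells; both are cut off so as to stay away from 0 and 1. Moving each of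
  the points twice by \<open>\<delta>\<close> costs \<open>4 * \<delta>\<close> of the radius \<open>t\<close>. A single parameter \<open>k\<close> drives
  \<open>\<epsilon> = Phi (- k)\<close> and \<open>\<delta> = t / (8 * (k + 1))\<close>, and everything lost is recovered as \<open>k\<close> tends to infinity.
\<close>

theorem Phi_shift_integral_le_1D:
  fixes u v :: "real \<Rightarrow> real"
  assumes [measurable]: "u \<in> borel_measurable borel" "v \<in> borel_measurable borel"
    and u: "\<And>x. 0 \<le> u x" "\<And>x. u x \<le> 1" and v: "\<And>x. 0 \<le> v x" "\<And>x. v x \<le> 1"
    and "0 \<le> t"
    and rel: "\<And>x y. \<bar>x - y\<bar> \<le> t \<Longrightarrow> Phi_shift (sqrt (t\<^sup>2 - (x - y)\<^sup>2)) (u x) \<le> v y"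
  shows "Phi_shift t (\<integral>x. u x \<partial>gauss) \<le> (\<integral>x. v x \<partial>gauss)"
proof -
  have iu: "integrable gauss u" and iv: "integrable gauss v"
    using u v by (auto intro!: gauss.integrable_const_bound[where B=1])
  have c1: "(\<integral>x. b \<partial>gauss) = b" for b :: real
    using gauss.prob_space[unfolded gauss.space_eq_univ] by simp
  define mu where "mu = (\<integral>x. u x \<partial>gauss)"
  define mv where "mv = (\<integral>x. v x \<partial>gauss)"
  have mu1: "mu \<le> 1" unfolding mu_def using integral_mono[OF iu, of "\<lambda>_. 1"] u c1[of 1] by auto
  have approx: "Phi (a + (t - t / (2 * (real k + 1)))) \<le> mv + Phi (t - k)"
    if a: "Phi a \<le> mu - 3 * Phi (- real k)" and "Phi (- real k) < 1/2" and "0 < t" for a k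
  proof -
    define \<epsilon> where "\<epsilon> = Phi (- real k)"
    define \<delta> where "\<delta> = t / (8 * (real k + 1))"
    define t' where "t' = t - 4 * \<delta>"
    have t'_eq: "t' = t - t / (2 * (real k + 1))" by (simp add: t'_def \<delta>_def field_simps)
    have \<epsilon>: "0 < \<epsilon>" "\<epsilon> < 1/2" using that Phi_bounds by (auto simp: \<epsilon>_def)
    have \<delta>: "0 < \<delta>" "8 * \<delta> \<le> t" "t / \<delta> = 8 * (real k + 1)" using that by (auto simp: \<delta>_def field_simps)
    have t': "0 < t'" "t' \<le> t" using \<delta> by (auto simp: t'_def)
    obtain r where r: "gauss_tail r < \<epsilon>" "0 < r"
    proof -
      have "\<forall>\<^sub>F r in at_top. gauss_tail r < \<epsilon> \<and> 0 < r"
        using order_tendstoD(2)[OF gauss_tail_tendsto \<epsilon>(1)] eventually_gt_at_top by (rule eventually_conj)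
      from eventually_happens'[OF trivial_limit_at_top_linorder this] show ?thesis using that by auto
    qed
    define N where "N = \<lceil>r / \<delta>\<rceil> + 1"
    \<comment> \<open>As \<open>t / \<delta> = 8 * (k + 1)\<close>, every point within reach of the window lies in a cell with index at most \<open>N'\<close>.\<close>
    define N' where "N' = N + (8 * (int k + 1) + 1)"
    define cell where "cell j = {x. \<lceil>x / \<delta>\<rceil> = j}" for j :: int
    have "\<exists>p. p \<in> cell j \<and> (\<forall>x\<in>cell j. u x \<le> u p + \<epsilon>)" for j
    proof -
      have ne: "of_int j * \<delta> \<in> cell j" using \<delta> by (simp add: cell_def)
      have bdd: "bdd_above (u ` cell j)" using u by (auto intro!: bdd_aboveI[of _ 1])
      have "Sup (u ` cell j) - \<epsilon> < Sup (u ` cell j)" using \<epsilon> by simp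
      then obtain p where p: "p \<in> cell j" "Sup (u ` cell j) - \<epsilon> < u p"
        using less_cSupD[of "u ` cell j" "Sup (u ` cell j) - \<epsilon>"] ne \<epsilon> by auto
      have "u x \<le> u p + \<epsilon>" if "x \<in> cell j" for x
        using cSup_upper[of "u x" "u ` cell j"] that bdd p by auto
      then show ?thesis using p by blast
    qed
    then obtain p where p: "\<And>j. p j \<in> cell j" "\<And>j x. x \<in> cell j \<Longrightarrow> u x \<le> u (p j) + \<epsilon>" by metis
    have cell_dist: "\<bar>x - x'\<bar> \<le> \<delta>" if "x \<in> cell j" "x' \<in> cell j" for x x' j
    proof -
      have "\<bar>x / \<delta> - x' / \<delta>\<bar> \<le> 1" using that unfolding cell_def by (simp add: ceiling_eq_iff) linarith
      then have "\<bar>(x - x') / \<delta>\<bar> \<le> 1" by (simp add: diff_divide_distrib)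
      then show ?thesis using \<delta> by (simp add: abs_divide pos_divide_le_eq)
    qed
    define g where "g j = min (1 - \<epsilon>) (max \<epsilon> (u (p j)))" for j
    define h where "h j = min (Phi_shift t' (1 - \<epsilon>)) (max (Phi_shift t' \<epsilon>) (Inf (v ` cell j)))" for j
    have bddv: "bdd_below (v ` S)" for S using v by (auto intro!: bdd_belowI[of _ 0])
    obtain K :: "(int \<times> bool) set" and c b where K: "finite K"
      and ut: "\<And>x. step_fun \<epsilon> K c b x = (if \<lceil>x / \<delta>\<rceil> \<in> {-N..N} then g \<lceil>x / \<delta>\<rceil> else \<epsilon>)"
      using lattice_step_fun[OF \<delta>(1), of \<epsilon> N g] by metis
    obtain K' :: "(int \<times> bool) set" and c' b' where K': "finite K'"
      and vt: "\<And>x. step_fun (Phi_shift t' \<epsilon>) K' c' b' x = (if \<lceil>x / \<delta>\<rceil> \<in> {-N'..N'} then h \<lceil>x / \<delta>\<rceil> else Phi_shift t' \<epsilon>)"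
      using lattice_step_fun[OF \<delta>(1), of "Phi_shift t' \<epsilon>" N' h] by metis
    let ?u = "step_fun \<epsilon> K c b" and ?v = "step_fun (Phi_shift t' \<epsilon>) K' c' b'"
    have sh_le: "Phi_shift t' \<epsilon> \<le> Phi_shift t' (1 - \<epsilon>)" using \<epsilon> by (intro Phi_shift_mono) auto
    have g: "\<epsilon> \<le> g j" "g j \<le> 1 - \<epsilon>" for j using \<epsilon> by (auto simp: g_def)
    have h: "Phi_shift t' \<epsilon> \<le> h j" "h j \<le> Phi_shift t' (1 - \<epsilon>)" for j using sh_le by (auto simp: h_def)
    have "Phi_shift t' (1 - \<epsilon>) < 1" using \<epsilon> Phi_bounds by (simp add: Phi_shift_eq)
    have "Phi_shift t' (\<integral>z. ?u z \<partial>gauss) \<le> (\<integral>z. ?v z \<partial>gauss)"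
    proof (rule Phi_shift_integral_le_step_fun[where \<epsilon>=\<epsilon> and \<epsilon>'="1 - Phi_shift t' (1 - \<epsilon>)" and \<delta>=\<delta> and N="(of_int N + 1) * \<delta>"])
      show "0 < 1 - Phi_shift t' (1 - \<epsilon>)" using \<open>Phi_shift t' (1 - \<epsilon>) < 1\<close> by simp
      show "?u x = \<epsilon>" if "(of_int N + 1) * \<delta> < \<bar>x\<bar>" for x
      proof -
        have "of_int N + 1 < \<bar>x / \<delta>\<bar>" using that \<delta> by (simp add: abs_divide pos_less_divide_eq)
        then have "\<lceil>x / \<delta>\<rceil> \<notin> {-N..N}" by (auto simp: abs_if split: if_splits) linarith+
        then show ?thesis unfolding ut by (rule if_not_P)
      qed
      fix x y x' y' assume xy: "\<bar>x' - x\<bar> \<le> \<delta>" "\<bar>y' - y\<bar> \<le> \<delta>" "\<bar>x - y\<bar> \<le> t'"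
      define \<rho> where "\<rho> = sqrt (t'\<^sup>2 - (x - y)\<^sup>2)"
      have "\<rho> \<le> sqrt (t'\<^sup>2)" unfolding \<rho>_def by (intro real_sqrt_le_mono) auto
      then have \<rho>t': "\<rho> \<le> t'" using t' by simp
      show "Phi_shift \<rho> (?u x') \<le> ?v y'"
      proof (cases "?u x' = \<epsilon>")
        case True
        have "Phi_shift \<rho> \<epsilon> \<le> Phi_shift t' \<epsilon>" using \<rho>t' by (intro Phi_shift_mono) auto
        also have "\<dots> \<le> ?v y'" using h by (simp add: vt)
        finally show ?thesis using True by simp
      next
        case False
        define j where "j = \<lceil>x' / \<delta>\<rceil>"
        define l where "l = \<lceil>y' / \<delta>\<rceil>"
        have j: "j \<in> {-N..N}" "?u x' = g j" using False by (auto simp: ut j_def split: if_splits)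
        have gj: "g j \<le> u (p j)" using False j \<epsilon> by (auto simp: g_def min_def max_def split: if_splits)
        have "\<bar>x' - y'\<bar> \<le> t" using xy \<delta> by (auto simp: t'_def)
        then have "\<bar>x' - y'\<bar> / \<delta> \<le> t / \<delta>" using \<delta> by (intro divide_right_mono) auto
        moreover have "\<bar>x' / \<delta> - y' / \<delta>\<bar> = \<bar>x' - y'\<bar> / \<delta>"
          using \<delta> by (simp add: diff_divide_distrib[symmetric])
        ultimately have "\<bar>x' / \<delta> - y' / \<delta>\<bar> \<le> t / \<delta>" by simp
        then have "\<bar>x' / \<delta> - y' / \<delta>\<bar> \<le> of_int (8 * (int k + 1))" using \<delta> by simp
        then have "l \<in> {-N'..N'}" using j(1) unfolding j_def l_def N'_def by (auto; linarith)
        then have vh: "?v y' = h l" by (simp add: vt l_def)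
        have "Phi_shift \<rho> (g j) \<le> Phi_shift t' (1 - \<epsilon>)" using \<rho>t' g by (intro Phi_shift_mono) auto
        moreover have "Phi_shift \<rho> (g j) \<le> Inf (v ` cell l)"
        proof (rule cINF_greatest)
          have "y' \<in> cell l" by (simp add: cell_def l_def)
          then show "cell l \<noteq> {}" by auto
          fix q assume q: "q \<in> cell l"
          have "\<bar>p j - x'\<bar> \<le> \<delta>" "\<bar>q - y'\<bar> \<le> \<delta>"
            using cell_dist[OF p(1)[of j], of x'] cell_dist[OF q, of y'] by (auto simp: cell_def j_def l_def)
          then have pq: "\<bar>p j - q\<bar> \<le> \<bar>x - y\<bar> + 4 * \<delta>" using xy by linarith
          then have pqt: "\<bar>p j - q\<bar> \<le> t" using xy by (auto simp: t'_def)
          \<comment> \<open>It suffices that \<open>(t - 4 * \<delta>)\<^sup>2 - r\<^sup>2 \<le> t\<^sup>2 - (r + 4 * \<delta>)\<^sup>2\<close> for \<open>r = \<bar>x - y\<bar> \<le> t - 4 * \<delta>\<close>.\<close>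
          have "\<bar>p j - q\<bar>\<^sup>2 \<le> (\<bar>x - y\<bar> + 4 * \<delta>)\<^sup>2" using pq by (intro power_mono) auto
          moreover have "t\<^sup>2 - (\<bar>x - y\<bar> + 4 * \<delta>)\<^sup>2 - (t'\<^sup>2 - \<bar>x - y\<bar>\<^sup>2) = 8 * \<delta> * (t' - \<bar>x - y\<bar>)"
            unfolding t'_def by (simp add: power2_eq_square algebra_simps)
          moreover have "0 \<le> 8 * \<delta> * (t' - \<bar>x - y\<bar>)" using xy \<delta> by simp
          ultimately have "t'\<^sup>2 - (x - y)\<^sup>2 \<le> t\<^sup>2 - (p j - q)\<^sup>2" by simp
          then have "\<rho> \<le> sqrt (t\<^sup>2 - (p j - q)\<^sup>2)" unfolding \<rho>_def by simp
          then have "Phi_shift \<rho> (g j) \<le> Phi_shift (sqrt (t\<^sup>2 - (p j - q)\<^sup>2)) (u (p j))"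
            using gj by (intro Phi_shift_mono)
          also have "\<dots> \<le> v q" by (rule rel[OF pqt])
          finally show "Phi_shift \<rho> (g j) \<le> v q" .
        qed
        ultimately show ?thesis unfolding j vh h_def by auto
      qed
    qed (use K K' \<epsilon> \<delta> t' g h sh_le in \<open>auto simp: ut vt\<close>)
    moreover have "Phi a \<le> (\<integral>z. ?u z \<partial>gauss)"
    proof -
      have "(\<integral>z. u z - 2 * \<epsilon> - indicat_real {z. r < \<bar>z\<bar>} z \<partial>gauss) \<le> (\<integral>z. ?u z \<partial>gauss)"
      proof (rule integral_mono)
        show "integrable gauss (\<lambda>z. u z - 2 * \<epsilon> - indicat_real {z. r < \<bar>z\<bar>} z)"
          by (intro Bochner_Integration.integrable_diff iu gauss.integrable_const_bound[where B=1]
              gauss.integrable_const_bound[where B="2 * \<epsilon>"]) (use \<epsilon> in auto)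
        show "integrable gauss ?u" using step_fun_integrable[OF K, of \<epsilon> c b 0 1] by simp
        fix z
        show "u z - 2 * \<epsilon> - indicat_real {z. r < \<bar>z\<bar>} z \<le> ?u z"
        proof (cases "r < \<bar>z\<bar>")
          case True then show ?thesis using u(2)[of z] \<epsilon> g(1)[of "\<lceil>z / \<delta>\<rceil>"] by (simp add: ut)
        next
          case False
          then have "\<bar>z\<bar> / \<delta> \<le> r / \<delta>" using \<delta> by (intro divide_right_mono) auto
          then have "\<bar>z / \<delta>\<bar> \<le> r / \<delta>" using \<delta> by simp
          then have "\<lceil>z / \<delta>\<rceil> \<in> {-N..N}" unfolding N_def by (auto; linarith)
          moreover have "u z \<le> u (p \<lceil>z / \<delta>\<rceil>) + \<epsilon>" by (rule p) (simp add: cell_def)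
          ultimately show ?thesis using False u(2)[of z] \<epsilon> by (auto simp: ut g_def)
        qed
      qed
      also have "(\<integral>z. u z - 2 * \<epsilon> - indicat_real {z. r < \<bar>z\<bar>} z \<partial>gauss) = mu - 2 * \<epsilon> - gauss_tail r"
      proof -
        have "integrable gauss (indicat_real {z. r < \<bar>z\<bar>})"
          by (intro gauss.integrable_const_bound[where B=1]) auto
        then show ?thesis
          using iu c1[of "2 * \<epsilon>"] by (simp add: mu_def gauss_tail_def)
      qed
      finally show ?thesis using a r by (simp add: \<epsilon>_def)
    qed
    moreover have "(\<integral>z. ?v z \<partial>gauss) \<le> mv + Phi_shift t' \<epsilon>"
    proof -
      have "(\<integral>z. ?v z \<partial>gauss) \<le> (\<integral>z. v z + Phi_shift t' \<epsilon> \<partial>gauss)"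
      proof (rule integral_mono)
        show "integrable gauss ?v" using step_fun_integrable[OF K', of "Phi_shift t' \<epsilon>" c' b' 0 1] by simp
        show "integrable gauss (\<lambda>z. v z + Phi_shift t' \<epsilon>)" using iv by simp
        fix z
        have "Inf (v ` cell \<lceil>z / \<delta>\<rceil>) \<le> v z" by (rule cInf_lower) (auto simp: cell_def bddv)
        then show "?v z \<le> v z + Phi_shift t' \<epsilon>" using v(1)[of z] Phi_shift_bounds(1)[of t' \<epsilon>] by (auto simp: vt h_def)
      qed
      also have "\<dots> = mv + Phi_shift t' \<epsilon>" using iv c1[of "Phi_shift t' \<epsilon>"] by (simp add: mv_def)
      finally show ?thesis .
    qed
    moreover have "Phi_shift t' \<epsilon> \<le> Phi (t - k)"
    proof -
      have "Phi_shift t' \<epsilon> \<le> Phi_shift t \<epsilon>" using t' by (intro Phi_shift_mono) auto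
      also have "\<dots> = Phi (t - k)" using Phi_bounds by (simp add: Phi_shift_eq \<epsilon>_def)
      finally show ?thesis .
    qed
    moreover have "Phi (a + t') \<le> Phi_shift t' (Phi a)" using Phi_bounds by (simp add: Phi_shift_eq)
    moreover have "Phi_shift t' (Phi a) \<le> Phi_shift t' (\<integral>z. ?u z \<partial>gauss)"
      using \<open>Phi a \<le> (\<integral>z. ?u z \<partial>gauss)\<close> by (intro Phi_shift_mono) auto
    ultimately show ?thesis unfolding t'_eq by linarith
  qed
  have lim: "Phi (a + t) \<le> mv" if a: "Phi a < mu" for a
  proof (cases "t = 0")
    case True
    have "mu \<le> mv" unfolding mu_def mv_def
    proof (rule integral_mono[OF iu iv])
      fix x
      have "u x \<le> Phi_shift 0 (u x)" using u[of x] by (auto simp: Phi_shift_def Phi_Phi_inv)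
      then show "u x \<le> v x" using rel[of x x] True by simp
    qed
    then show ?thesis using True a by simp
  next
    case False
    then have "0 < t" using \<open>0 \<le> t\<close> by simp
    have bot: "(\<lambda>k. Phi (- real k)) \<longlonglongrightarrow> 0"
      by (intro filterlim_compose[OF Phi_at_bot] filterlim_compose[OF filterlim_uminus_at_bot_at_top] filterlim_real_sequentially)
    have "(\<lambda>k. mu - 3 * Phi (- real k)) \<longlonglongrightarrow> mu - 3 * 0" by (intro tendsto_intros bot)
    then have "\<forall>\<^sub>F k in sequentially. Phi a < mu - 3 * Phi (- real k)"
      using a by (intro order_tendstoD(1)) auto
    moreover have "\<forall>\<^sub>F k in sequentially. Phi (- real k) < 1/2"
      using bot by (rule order_tendstoD(2)) simp
    ultimately have ev: "\<forall>\<^sub>F k in sequentially. Phi (a + (t - t / (2 * (real k + 1)))) \<le> mv + Phi (t - k)"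
      by eventually_elim (use approx \<open>0 < t\<close> in auto)
    have "(\<lambda>k. t / (2 * (real k + 1))) \<longlonglongrightarrow> 0" by real_asymp
    then have "(\<lambda>k. Phi (a + (t - t / (2 * (real k + 1))))) \<longlonglongrightarrow> Phi (a + (t - 0))"
      by (intro isCont_tendsto_compose[OF isCont_Phi] tendsto_intros)
    moreover have "(\<lambda>k. Phi (t - real k)) \<longlonglongrightarrow> 0"
      by (intro filterlim_compose[OF Phi_at_bot]) real_asymp
    then have "(\<lambda>k. mv + Phi (t - real k)) \<longlonglongrightarrow> mv + 0" by (intro tendsto_intros)
    ultimately show ?thesis
      using tendsto_le[OF _ _ _ ev] by (simp add: trivial_limit_sequentially)
  qed
  have "Phi_shift t mu \<le> mv"
  proof -
    have mv0: "0 \<le> mv" unfolding mv_def using v by simp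
    consider "mu \<le> 0" | "0 < mu" "mu < 1" | "mu = 1" using mu1 by linarith
    then show ?thesis
    proof cases
      case 1 then show ?thesis using mv0 by (simp add: Phi_shift_def)
    next
      case 2
      have "((\<lambda>d. Phi (Phi_inv mu - d + t)) \<longlongrightarrow> Phi (Phi_inv mu - 0 + t)) (at_right 0)"
        by (intro isCont_tendsto_compose[OF isCont_Phi] tendsto_intros)
      moreover have "Phi (Phi_inv mu - d + t) \<le> mv" if "0 < d" for d
        using 2 Phi_strict_mono[of "Phi_inv mu - d" "Phi_inv mu"] that by (intro lim) (simp add: Phi_Phi_inv)
      ultimately have "Phi (Phi_inv mu - 0 + t) \<le> mv"
        by (intro tendsto_upperbound) (auto simp: eventually_at_right_field intro!: exI[of _ 1])
      then show ?thesis using 2 by (simp add: Phi_shift_eq)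
    next
      case 3
      have "((\<lambda>a. Phi (a + t)) \<longlongrightarrow> 1) at_top"
        by (intro filterlim_compose[OF Phi_at_top]) real_asymp
      then have "1 \<le> mv"
        by (rule tendsto_upperbound) (use 3 lim Phi_bounds in auto)
      then show ?thesis using 3 by (simp add: Phi_shift_def)
    qed
  qed
  then show ?thesis by (simp add: mu_def mv_def)
qed

section \<open>Tensorization and the Gaussian isoperimetric inequality\<close>

definition gauss_n :: "nat \<Rightarrow> (nat \<Rightarrow> real) measure" where
  "gauss_n n = (\<Pi>\<^sub>M i\<in>{..<n}. gauss)"

interpretation gauss_prod: product_prob_space "\<lambda>_::nat. gauss" UNIV
  by unfold_locales

lemma gauss_n_prob_space: "prob_space (gauss_n n)"
  unfolding gauss_n_def by (rule prob_space_PiM) (rule gauss.prob_space_axioms)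

lemma space_gauss_n: "space (gauss_n n) = {..<n} \<rightarrow>\<^sub>E UNIV"
  by (simp add: gauss_n_def space_PiM)

text \<open>
  Induction on the dimension. For fixed first \<open>n\<close> coordinates \<open>x\<close> and \<open>y\<close>, the radius
  \<open>\<tau> = sqrt (t\<^sup>2 - \<bar>x - y\<bar>\<^sup>2)\<close> is left for the last coordinate; the inequality on the line with radius \<open>\<tau>\<close> is
  the hypothesis, in dimension \<open>n\<close>, for the functions with the last coordinate integrated out.
\<close>

theorem Phi_shift_integral_le:
  fixes u v :: "(nat \<Rightarrow> real) \<Rightarrow> real"
  assumes "u \<in> borel_measurable (gauss_n n)" "v \<in> borel_measurable (gauss_n n)"
    and "\<And>x. x \<in> space (gauss_n n) \<Longrightarrow> 0 \<le> u x \<and> u x \<le> 1"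
    and "\<And>x. x \<in> space (gauss_n n) \<Longrightarrow> 0 \<le> v x \<and> v x \<le> 1"
    and "0 \<le> t"
    and "\<And>x y. x \<in> space (gauss_n n) \<Longrightarrow> y \<in> space (gauss_n n) \<Longrightarrow> (\<Sum>i<n. (x i - y i)\<^sup>2) \<le> t\<^sup>2 \<Longrightarrow>
       Phi_shift (sqrt (t\<^sup>2 - (\<Sum>i<n. (x i - y i)\<^sup>2))) (u x) \<le> v y"
  shows "Phi_shift t (\<integral>x. u x \<partial>gauss_n n) \<le> (\<integral>x. v x \<partial>gauss_n n)"
  using assms
proof (induction n arbitrary: u v t)
  case 0
  have "Phi_shift t (u (\<lambda>_. undefined)) \<le> v (\<lambda>_. undefined)"
    using "0.prems"(6)[of "\<lambda>_. undefined" "\<lambda>_. undefined"] \<open>0 \<le> t\<close> by (simp add: space_gauss_n)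
  then show ?case
    by (simp add: gauss_n_def PiM_empty lebesgue_integral_count_space_finite)
next
  case (Suc n)
  define up where "up x = (\<integral>s. u (x(n := s)) \<partial>gauss)" for x
  define vp where "vp x = (\<integral>s. v (x(n := s)) \<partial>gauss)" for x
  have ins: "gauss_n (Suc n) = Pi\<^sub>M (insert n {..<n}) (\<lambda>_. gauss)"
    by (simp add: gauss_n_def lessThan_Suc)
  interpret P: prob_space "gauss_n (Suc n)" by (rule gauss_n_prob_space)
  have upd: "x(n := s) \<in> space (gauss_n (Suc n))" if "x \<in> space (gauss_n n)" for x s
    using that by (auto simp: space_gauss_n PiE_iff extensional_def)
  have slice: "(\<lambda>s. w (x(n := s))) \<in> borel_measurable borel"
    if "w \<in> borel_measurable (gauss_n (Suc n))" "x \<in> space (gauss_n n)" for w :: "(nat \<Rightarrow> real) \<Rightarrow> real" and x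
  proof -
    have "(\<lambda>s. x(n := s)) \<in> measurable gauss (gauss_n (Suc n))"
      unfolding ins using that by (intro measurable_component_update) (auto simp: gauss_n_def)
    from measurable_compose[OF this that(1)] show ?thesis by simp
  qed
  have integral_eq: "(\<integral>x. w x \<partial>gauss_n (Suc n)) = (\<integral>x. (\<integral>s. w (x(n := s)) \<partial>gauss) \<partial>gauss_n n)"
    and mes: "(\<lambda>x. \<integral>s. w (x(n := s)) \<partial>gauss) \<in> borel_measurable (gauss_n n)"
    and bnd: "x \<in> space (gauss_n n) \<Longrightarrow> 0 \<le> (\<integral>s. w (x(n := s)) \<partial>gauss) \<and> (\<integral>s. w (x(n := s)) \<partial>gauss) \<le> 1"
    if w: "w \<in> borel_measurable (gauss_n (Suc n))" "\<And>x. x \<in> space (gauss_n (Suc n)) \<Longrightarrow> 0 \<le> w x \<and> w x \<le> 1"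
    for w :: "(nat \<Rightarrow> real) \<Rightarrow> real" and x
  proof -
    have "integrable (gauss_n (Suc n)) w"
      using w by (intro P.integrable_const_bound[where B=1]) auto
    then show "(\<integral>x. w x \<partial>gauss_n (Suc n)) = (\<integral>x. (\<integral>s. w (x(n := s)) \<partial>gauss) \<partial>gauss_n n)"
      unfolding ins unfolding gauss_n_def by (intro gauss_prod.product_integral_insert) auto
    have "(\<lambda>(x, s). x(n := s)) \<in> measurable (gauss_n n \<Otimes>\<^sub>M gauss) (gauss_n (Suc n))"
      unfolding ins unfolding gauss_n_def by (rule measurable_add_dim)
    from measurable_compose[OF this w(1)]
    have "(\<lambda>(x, s). w (x(n := s))) \<in> borel_measurable (gauss_n n \<Otimes>\<^sub>M gauss)" by (simp add: split_beta)
    then show "(\<lambda>x. \<integral>s. w (x(n := s)) \<partial>gauss) \<in> borel_measurable (gauss_n n)"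
      by (rule gauss.borel_measurable_lebesgue_integral)
    assume x: "x \<in> space (gauss_n n)"
    have i: "integrable gauss (\<lambda>s. w (x(n := s)))"
      using slice[OF w(1) x] w(2)[OF upd[OF x]] by (intro gauss.integrable_const_bound[where B=1]) auto
    show "0 \<le> (\<integral>s. w (x(n := s)) \<partial>gauss) \<and> (\<integral>s. w (x(n := s)) \<partial>gauss) \<le> 1"
      using w(2)[OF upd[OF x]] integral_mono[OF i, of "\<lambda>_. 1"] gauss.prob_space[unfolded gauss.space_eq_univ]
      by auto
  qed
  have "Phi_shift t (\<integral>x. up x \<partial>gauss_n n) \<le> (\<integral>x. vp x \<partial>gauss_n n)"
  proof (rule Suc.IH)
    show "up \<in> borel_measurable (gauss_n n)" unfolding up_def by (rule mes[OF Suc.prems(1,3)])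
    show "vp \<in> borel_measurable (gauss_n n)" unfolding vp_def by (rule mes[OF Suc.prems(2,4)])
    show "0 \<le> up x \<and> up x \<le> 1" if "x \<in> space (gauss_n n)" for x
      unfolding up_def by (rule bnd[OF Suc.prems(1,3) that])
    show "0 \<le> vp x \<and> vp x \<le> 1" if "x \<in> space (gauss_n n)" for x
      unfolding vp_def by (rule bnd[OF Suc.prems(2,4) that])
    fix x y assume x: "x \<in> space (gauss_n n)" and y: "y \<in> space (gauss_n n)"
      and D: "(\<Sum>i<n. (x i - y i)\<^sup>2) \<le> t\<^sup>2"
    define \<tau> where "\<tau> = sqrt (t\<^sup>2 - (\<Sum>i<n. (x i - y i)\<^sup>2))"
    have \<tau>: "0 \<le> \<tau>" "\<tau>\<^sup>2 = t\<^sup>2 - (\<Sum>i<n. (x i - y i)\<^sup>2)" using D by (auto simp: \<tau>_def)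
    have "Phi_shift \<tau> (up x) \<le> vp y"
      unfolding up_def vp_def
    proof (rule Phi_shift_integral_le_1D)
      fix s s' assume "\<bar>s - s'\<bar> \<le> \<tau>"
      then have "\<bar>s - s'\<bar>\<^sup>2 \<le> \<tau>\<^sup>2" by (intro power_mono) auto
      then have "(s - s')\<^sup>2 \<le> \<tau>\<^sup>2" by simp
      moreover have "(\<Sum>i<Suc n. ((x(n := s)) i - (y(n := s')) i)\<^sup>2) = (\<Sum>i<n. (x i - y i)\<^sup>2) + (s - s')\<^sup>2"
        by simp
      ultimately have le: "(\<Sum>i<Suc n. ((x(n := s)) i - (y(n := s')) i)\<^sup>2) \<le> t\<^sup>2"
        and eq: "t\<^sup>2 - (\<Sum>i<Suc n. ((x(n := s)) i - (y(n := s')) i)\<^sup>2) = \<tau>\<^sup>2 - (s - s')\<^sup>2"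
        unfolding \<tau>(2) by simp_all
      show "Phi_shift (sqrt (\<tau>\<^sup>2 - (s - s')\<^sup>2)) (u (x(n := s))) \<le> v (y(n := s'))"
        using Suc.prems(6)[OF upd[OF x, of s] upd[OF y, of s'] le] unfolding eq .
    next
      show "(\<lambda>s. u (x(n := s))) \<in> borel_measurable borel" by (rule slice[OF Suc.prems(1) x])
      show "(\<lambda>s. v (y(n := s))) \<in> borel_measurable borel" by (rule slice[OF Suc.prems(2) y])
      show "0 \<le> u (x(n := s))" "u (x(n := s)) \<le> 1" for s using Suc.prems(3)[OF upd[OF x, of s]] by blast+
      show "0 \<le> v (y(n := s))" "v (y(n := s)) \<le> 1" for s using Suc.prems(4)[OF upd[OF y, of s]] by blast+
      show "0 \<le> \<tau>" by (rule \<tau>(1))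
    qed
    then show "Phi_shift (sqrt (t\<^sup>2 - (\<Sum>i<n. (x i - y i)\<^sup>2))) (up x) \<le> vp y" by (simp add: \<tau>_def)
  qed fact
  moreover have "(\<integral>x. u x \<partial>gauss_n (Suc n)) = (\<integral>x. up x \<partial>gauss_n n)"
    unfolding up_def by (rule integral_eq[OF Suc.prems(1,3)])
  moreover have "(\<integral>x. v x \<partial>gauss_n (Suc n)) = (\<integral>x. vp x \<partial>gauss_n n)"
    unfolding vp_def by (rule integral_eq[OF Suc.prems(2,4)])
  ultimately show ?case by simp
qed

text \<open>
  For the indicator functions of \<open>A\<close> and \<open>B\<close> the hypothesis of \<open>Phi_shift_integral_le\<close> says that \<open>B\<close> contains
  the closed \<open>t\<close>-enlargement of \<open>A\<close>, because \<open>Phi_shift\<close> fixes 0 and 1.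
\<close>

corollary gaussian_isoperimetry:
  assumes A: "A \<in> sets (gauss_n n)" and B: "B \<in> sets (gauss_n n)" and "0 \<le> t"
    and AB: "\<And>x y. x \<in> A \<Longrightarrow> y \<in> space (gauss_n n) \<Longrightarrow> (\<Sum>i<n. (x i - y i)\<^sup>2) \<le> t\<^sup>2 \<Longrightarrow> y \<in> B"
    and a: "measure (gauss_n n) A = Phi a"
  shows "Phi (a + t) \<le> measure (gauss_n n) B"
proof -
  have "Phi_shift t (\<integral>x. indicator A x \<partial>gauss_n n) \<le> (\<integral>x. indicator B x \<partial>gauss_n n)"
  proof (rule Phi_shift_integral_le)
    fix x y assume x: "x \<in> space (gauss_n n)" and y: "y \<in> space (gauss_n n)"
      and D: "(\<Sum>i<n. (x i - y i)\<^sup>2) \<le> t\<^sup>2"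
    show "Phi_shift (sqrt (t\<^sup>2 - (\<Sum>i<n. (x i - y i)\<^sup>2))) (indicator A x) \<le> indicat_real B y"
      using AB[OF _ y D] by (cases "x \<in> A") (auto simp: Phi_shift_def)
  qed (use A B \<open>0 \<le> t\<close> in auto)
  then show ?thesis
    using A B a Phi_bounds[of a] by (simp add: Phi_shift_eq)
qed

section \<open>Gaussian tails and the monotone map onto the density \<open>exp (- \<bar>x\<bar> powr p)\<close>\<close>

lemma antimono_tendsto_0_imp_nonneg:
  fixes D :: "real \<Rightarrow> real"
  assumes "\<And>y. a \<le> y \<Longrightarrow> (D has_real_derivative D' y) (at y)" "\<And>y. a \<le> y \<Longrightarrow> D' y \<le> 0"
    and "(D \<longlongrightarrow> 0) at_top"
  shows "0 \<le> D a"
proof (rule tendsto_upperbound[OF assms(3)])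
  have "D y \<le> D a" if "a \<le> y" for y
    using DERIV_nonpos_imp_nonincreasing[OF that, of D] assms(1,2) by blast
  then show "\<forall>\<^sub>F y in at_top. D y \<le> D a"
    using eventually_ge_at_top[of a] by (rule eventually_mono[rotated])
qed simp

lemma dist_fun_minus:
  assumes \<rho>: "positive_density \<rho>" and even: "\<And>x. \<rho> (- x) = \<rho> x"
  shows "dist_fun \<rho> (- x) = 1 - dist_fun \<rho> x"
proof -
  let ?G = "\<lambda>x. dist_fun \<rho> x + dist_fun \<rho> (- x)"
  have "(?G has_real_derivative 0) (at y)" for y
    by (rule derivative_eq_intros dist_fun_has_derivative[OF \<rho>]
        DERIV_chain2[OF dist_fun_has_derivative[OF \<rho>]] refl | simp add: even)+
  then have const: "?G y = ?G x" for y
    by (intro DERIV_isconst_all) auto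
  have "(?G \<longlongrightarrow> 1 + 0) at_top"
    by (intro tendsto_add dist_fun_at_top[OF \<rho>]
        filterlim_compose[OF dist_fun_at_bot[OF \<rho>] filterlim_uminus_at_bot_at_top])
  moreover have "(?G \<longlongrightarrow> ?G x) at_top"
    using tendsto_const[of "?G x" at_top] by (subst const)
  ultimately have "?G x = 1"
    using tendsto_unique[OF trivial_limit_at_top_linorder] by (metis add.right_neutral)
  then show ?thesis by simp
qed

lemma Phi_minus: "Phi (- x) = 1 - Phi x"
  unfolding Phi_eq_dist_fun
  by (rule dist_fun_minus[OF positive_density_std_normal]) (simp add: std_normal_density_def)

lemma std_normal_density_le: "std_normal_density x \<le> exp (- x\<^sup>2 / 2) * (2 / 5)"
proof -
  have "(5 / 2)\<^sup>2 \<le> 2 * pi" using pi_approx by (simp add: power2_eq_square)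
  then have "5 / 2 \<le> sqrt (2 * pi)" by (rule real_le_rsqrt)
  then have "1 / sqrt (2 * pi) \<le> 1 / (5 / 2)" by (intro divide_left_mono) auto
  then have "exp (- x\<^sup>2 / 2) * (1 / sqrt (2 * pi)) \<le> exp (- x\<^sup>2 / 2) * (2 / 5)"
    by (intro mult_left_mono) auto
  then show ?thesis by (simp add: std_normal_density_def mult.commute)
qed

lemma std_normal_density_antimono: "0 \<le> x \<Longrightarrow> x \<le> y \<Longrightarrow> std_normal_density y \<le> std_normal_density x"
  unfolding std_normal_density_def by (intro mult_left_mono) (auto simp: power_mono)

text \<open>
  Over the interval from \<open>g\<close> to \<open>g + 1 / (1 + g)\<close> the density decreases by a factor of at most \<open>exp 1\<close>.
\<close>

lemma Phi_tail_lower: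
  assumes "0 \<le> g"
  shows "std_normal_density g \<le> exp 1 * (1 + g) * (1 - Phi g)"
proof -
  define h where "h = 1 / (1 + g)"
  have h: "0 < h" "h * (1 + g) = 1" "h \<le> 1" using assms by (auto simp: h_def)
  have "g * h + h\<^sup>2 / 2 = 1 - h + h * h / 2" using h by (simp add: power2_eq_square algebra_simps)
  also have "\<dots> \<le> 1" using h mult_left_le[of h h] by simp
  finally have e: "g * h + h\<^sup>2 / 2 \<le> 1" .
  obtain \<xi> where \<xi>: "g < \<xi>" "\<xi> < g + h" "Phi (g + h) - Phi g = (g + h - g) * std_normal_density \<xi>"
    using MVT2[of g "g + h" Phi std_normal_density] h Phi_has_derivative by auto
  have "std_normal_density g = std_normal_density (g + h) * exp (g * h + h\<^sup>2 / 2)"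
    unfolding std_normal_density_def
    by (simp add: mult.assoc exp_add[symmetric] power2_eq_square field_simps)
  also have "\<dots> \<le> std_normal_density (g + h) * exp 1"
    using e by (intro mult_left_mono) auto
  also have "\<dots> \<le> std_normal_density \<xi> * exp 1"
    using \<xi> assms by (intro mult_right_mono std_normal_density_antimono) auto
  also have "\<dots> = exp 1 * (1 + g) * (h * std_normal_density \<xi>)"
    using h by (simp add: mult.left_commute mult.commute)
  also have "\<dots> \<le> exp 1 * (1 + g) * (1 - Phi g)"
    using \<xi> Phi_bounds[of "g + h"] assms by (intro mult_left_mono) auto
  finally show ?thesis .
qed

text \<open>
  From 1 on, the density minus the tail is decreasing with limit 0; before 1 the tail is at most 1/2.
\<close>

lemma Phi_tail_upper:
  assumes "0 \<le> g"
  shows "1 - Phi g \<le> exp (- g\<^sup>2 / 2)"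
proof (cases "g \<le> 1")
  case True
  have "Phi 0 = 1 / 2" using Phi_minus[of 0] by simp
  then have "1 / 2 \<le> Phi g" using assms Phi_le_iff[of 0 g] by simp
  moreover have "1 - 1 / 2 \<le> exp (- (1 / 2 :: real))" using exp_ge_add_one_self[of "- (1/2) :: real"] by simp
  moreover have "exp (- (1 / 2)) \<le> exp (- g\<^sup>2 / 2)" using True assms by (simp add: power_le_one)
  ultimately show ?thesis by linarith
next
  case False
  have "0 \<le> std_normal_density g - (1 - Phi g)"
  proof (rule antimono_tendsto_0_imp_nonneg[where D="\<lambda>y. std_normal_density y - (1 - Phi y)"])
    fix y assume y: "g \<le> y"
    show "((\<lambda>y. std_normal_density y - (1 - Phi y)) has_real_derivative
        - y * std_normal_density y - (0 - std_normal_density y)) (at y)"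
      by (intro DERIV_diff DERIV_const std_normal_density_has_derivative Phi_has_derivative)
    show "- y * std_normal_density y - (0 - std_normal_density y) \<le> 0"
    proof -
      have "0 \<le> (y - 1) * std_normal_density y" using False y by (intro mult_nonneg_nonneg) auto
      then show ?thesis by (simp add: algebra_simps)
    qed
  next
    have "(std_normal_density \<longlongrightarrow> 0) at_top"
      unfolding std_normal_density_def[abs_def] by real_asymp
    then have "((\<lambda>y. std_normal_density y - (1 - Phi y)) \<longlongrightarrow> 0 - (1 - 1)) at_top"
      by (intro tendsto_intros Phi_at_top)
    then show "((\<lambda>y. std_normal_density y - (1 - Phi y)) \<longlongrightarrow> 0) at_top" by simp
  qed
  moreover have "std_normal_density g \<le> exp (- g\<^sup>2 / 2) * 1"
    by (rule order_trans[OF std_normal_density_le]) (intro mult_left_mono, auto)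
  ultimately show ?thesis by simp
qed

definition exp_powr_mass :: "real \<Rightarrow> real" where
  "exp_powr_mass p = (\<integral>x. exp (- (\<bar>x\<bar> powr p)) \<partial>lborel)"

definition lp_density :: "real \<Rightarrow> real \<Rightarrow> real" where
  "lp_density p x = exp (- (\<bar>x\<bar> powr p)) / exp_powr_mass p"

text \<open>
  The increasing map that carries the Gaussian measure to the density \<open>lp_density p\<close>
  (\<open>distr_gauss_to_lp\<close>).
\<close>

definition gauss_to_lp :: "real \<Rightarrow> real \<Rightarrow> real" where
  "gauss_to_lp p g = quantile (lp_density p) (Phi g)"

context
  fixes p :: real
  assumes p: "2 \<le> p"
begin

lemma powr_le_square: "0 \<le> x \<Longrightarrow> x \<le> 1 \<Longrightarrow> x powr p \<le> x\<^sup>2"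
  using p powr_mono'[of 2 p x] by (cases "x = 0") (auto simp: powr_numeral)

lemma powr_ge_square: "1 \<le> x \<Longrightarrow> x\<^sup>2 \<le> x powr p"
  using p powr_mono[of 2 p x] by (auto simp: powr_numeral)

lemma exp_powr_le_normal_density: "exp (- (\<bar>x\<bar> powr p)) \<le> exp 1 * (sqrt pi * normal_density 0 (1 / sqrt 2) x)"
proof -
  have "x\<^sup>2 \<le> 1 + \<bar>x\<bar> powr p"
  proof (cases "\<bar>x\<bar> \<le> 1")
    case True
    then have "x\<^sup>2 \<le> 1" by (simp add: abs_square_le_1)
    then show ?thesis by (simp add: add_increasing2)
  next
    case False then show ?thesis using powr_ge_square[of "\<bar>x\<bar>"] by simp
  qed
  then have "exp (- (\<bar>x\<bar> powr p)) \<le> exp (1 + - x\<^sup>2)" by simp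
  also have "\<dots> = exp 1 * (sqrt pi * normal_density 0 (1 / sqrt 2) x)"
    unfolding exp_add by (simp add: normal_density_def power_divide)
  finally show ?thesis .
qed

lemma integrable_exp_powr: "integrable lborel (\<lambda>x. exp (- (\<bar>x\<bar> powr p)))"
  by (rule Bochner_Integration.integrable_bound[where f="\<lambda>x. exp 1 * (sqrt pi * normal_density 0 (1 / sqrt 2) x)"])
    (use exp_powr_le_normal_density in \<open>auto intro!: AE_I2 integrable_mult_right integrable_normal_density\<close>)

text \<open>
  Crude bounds that hold for all \<open>p\<close> at once; they enter the constants in \<open>gauss_to_lp_slope_bounds\<close>.
\<close>

lemma exp_powr_mass_bounds: "4 / 3 \<le> exp_powr_mass p" "exp_powr_mass p \<le> 6"
proof -
  have "exp_powr_mass p \<le> (\<integral>x. exp 1 * (sqrt pi * normal_density 0 (1 / sqrt 2) x) \<partial>lborel)"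
    unfolding exp_powr_mass_def
    by (intro integral_mono integrable_exp_powr integrable_mult_right integrable_normal_density exp_powr_le_normal_density) simp
  also have "\<dots> = exp 1 * sqrt pi" by simp
  also have "\<dots> \<le> 3 * 2"
    using exp_le pi_less_4 by (intro mult_mono real_le_lsqrt) auto
  finally show "exp_powr_mass p \<le> 6" by simp
  have "(\<integral>x. (1 - x\<^sup>2) * indicator {-1..1} x \<partial>lborel) \<le> exp_powr_mass p"
    unfolding exp_powr_mass_def
  proof (rule integral_mono)
    show "integrable lborel (\<lambda>x. (1 - x\<^sup>2) * indicat_real {-1..1} x)"
      by (rule borel_integrable_atLeastAtMost) (auto intro!: continuous_intros)
    fix x :: real
    show "(1 - x\<^sup>2) * indicat_real {-1..1} x \<le> exp (- (\<bar>x\<bar> powr p))"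
    proof (cases "x \<in> {-1..1}")
      case True
      then have "\<bar>x\<bar> powr p \<le> x\<^sup>2" using powr_le_square[of "\<bar>x\<bar>"] by auto
      then have "1 - x\<^sup>2 \<le> exp (- (\<bar>x\<bar> powr p))"
        using exp_ge_add_one_self[of "- (\<bar>x\<bar> powr p)"] by linarith
      then show ?thesis using True by simp
    qed simp
  qed (rule integrable_exp_powr)
  also have "(\<integral>x. (1 - x\<^sup>2) * indicator {-1..1} x \<partial>lborel) = (1 - 1 ^ 3 / 3) - (- 1 - (- 1) ^ 3 / 3 :: real)"
    by (rule integral_FTC_Icc_real[where F="\<lambda>x. x - x ^ 3 / 3"])
      (auto intro!: derivative_eq_intros continuous_intros simp: power2_eq_square power3_eq_cube)
  finally show "4 / 3 \<le> exp_powr_mass p" by simp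
qed

lemma positive_density_lp: "positive_density (lp_density p)"
proof -
  have "exp_powr_mass p > 0" using exp_powr_mass_bounds by linarith
  moreover have "continuous_on UNIV (\<lambda>x::real. \<bar>x\<bar> powr p)"
    using p by (intro continuous_on_powr' continuous_intros) auto
  ultimately show ?thesis
    unfolding positive_density_def lp_density_def
    using integrable_exp_powr by (auto intro!: continuous_intros simp: exp_powr_mass_def[symmetric])
qed

lemma lp_density_even: "lp_density p (- x) = lp_density p x"
  by (simp add: lp_density_def)

lemma dist_fun_gauss_to_lp: "dist_fun (lp_density p) (gauss_to_lp p g) = Phi g"
  unfolding gauss_to_lp_def using Phi_bounds by (intro dist_fun_quantile[OF positive_density_lp])

lemma gauss_to_lp_has_derivative:
  "(gauss_to_lp p has_real_derivative std_normal_density g / lp_density p (gauss_to_lp p g)) (at g)"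
  using DERIV_chain2[OF quantile_has_derivative[OF positive_density_lp] Phi_has_derivative, of g] Phi_bounds[of g]
  by (simp add: gauss_to_lp_def[abs_def])

lemma gauss_to_lp_minus: "gauss_to_lp p (- g) = - gauss_to_lp p g"
proof -
  have "dist_fun (lp_density p) (- gauss_to_lp p g) = Phi (- g)"
    by (simp add: dist_fun_minus[OF positive_density_lp lp_density_even] dist_fun_gauss_to_lp Phi_minus)
  then show ?thesis
    unfolding gauss_to_lp_def[of p "- g"] by (metis quantile_dist_fun[OF positive_density_lp])
qed

lemma gauss_to_lp_nonneg_iff: "0 \<le> gauss_to_lp p g \<longleftrightarrow> 0 \<le> g"
proof -
  have "dist_fun (lp_density p) 0 = Phi 0"
    using dist_fun_minus[OF positive_density_lp lp_density_even, of 0] Phi_minus[of 0] by simp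
  then show ?thesis
    using dist_fun_le_iff[OF positive_density_lp, of 0 "gauss_to_lp p g"] Phi_le_iff[of 0 g]
    by (simp add: dist_fun_gauss_to_lp)
qed

text \<open>
  The difference of the two sides is decreasing with limit 0, as for Mills' ratio.
\<close>

lemma lp_tail_upper:
  assumes "0 < x"
  shows "1 - dist_fun (lp_density p) x \<le> lp_density p x / (p * x powr (p - 1))"
proof -
  let ?Z = "exp_powr_mass p"
  have Z: "0 < ?Z" using exp_powr_mass_bounds by linarith
  let ?D = "\<lambda>x. exp (- (x powr p)) / ?Z / (p * x powr (p - 1)) - (1 - dist_fun (lp_density p) x)"
  have "0 \<le> ?D x"
  proof (rule antimono_tendsto_0_imp_nonneg[where D="?D" and
      D'="\<lambda>y. - (exp (- (y powr p)) / ?Z) * ((p - 1) / (p * y powr p))"])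
    fix y assume "x \<le> y"
    then have y: "0 < y" using assms by simp
    have ld: "lp_density p y = exp (- (y powr p)) / ?Z" using y by (simp add: lp_density_def)
    let ?D' = "- (exp (- (y powr p)) / ?Z) * ((p - 1) / (p * y powr p))"
    have pw: "y powr (p - 1) * y powr (p - 1) = y powr (p - 2) * y powr p" "y powr (p - 1 - 1) = y powr (p - 2)"
      by (simp_all add: powr_add[symmetric])
    have pos: "0 < y powr p" "0 < y powr (p - 1)" "0 < y powr (p - 2)" using y by auto
    have "(?D has_real_derivative
      (exp (- (y powr p)) / ?Z * (- (p * y powr (p - 1))) * (p * y powr (p - 1))
        - exp (- (y powr p)) / ?Z * (p * ((p - 1) * y powr (p - 1 - 1)))) / ((p * y powr (p - 1)) * (p * y powr (p - 1)))
       - (0 - lp_density p y)) (at y)"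
      using y p pos Z
      by (intro DERIV_diff DERIV_divide DERIV_const dist_fun_has_derivative[OF positive_density_lp]
          DERIV_cmult has_real_derivative_powr)
        (auto intro!: derivative_eq_intros has_real_derivative_powr)
    also have "(exp (- (y powr p)) / ?Z * (- (p * y powr (p - 1))) * (p * y powr (p - 1))
        - exp (- (y powr p)) / ?Z * (p * ((p - 1) * y powr (p - 1 - 1)))) / ((p * y powr (p - 1)) * (p * y powr (p - 1)))
       - (0 - lp_density p y) = ?D'"
      using pos p Z unfolding ld pw by (simp add: field_simps pw)
    finally show "(?D has_real_derivative ?D') (at y)" .
    show "?D' \<le> 0" using p Z y by (simp add: mult_nonneg_nonneg)
  next
    have "((\<lambda>x. exp (- (x powr p)) / ?Z / (p * x powr (p - 1))) \<longlongrightarrow> 0) at_top"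
      using p Z by real_asymp
    then have "(?D \<longlongrightarrow> 0 - (1 - 1)) at_top"
      by (intro tendsto_intros dist_fun_at_top[OF positive_density_lp])
    then show "(?D \<longlongrightarrow> 0) at_top" by simp
  qed
  then show ?thesis using assms by (simp add: lp_density_def)
qed

end

section \<open>Bounds on the slope of the monotone map\<close>

context
  fixes p :: real
  assumes p: "2 \<le> p"
begin

text \<open>
  The derivative of \<open>gauss_to_lp p\<close> without the factor \<open>exp_powr_mass p\<close>.
\<close>

definition lp_slope where "lp_slope g = std_normal_density g * exp (\<bar>gauss_to_lp p g\<bar> powr p)"

text \<open>
  The Gaussian tail beyond \<open>g\<close> equals the tail of \<open>lp_density p\<close> beyond \<open>x\<close>, which is at most \<open>M\<close>. If \<open>h\<close> is
  the point with Gaussian tail \<open>M\<close>, then \<open>h \<le> g\<close> and the Gaussian density at \<open>g\<close> is at most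
  \<open>exp 1 * (1 + h) * M\<close>, where \<open>h\<^sup>2 \<le> 2 * ln (1 / M)\<close> is at most of order \<open>p * x powr p\<close>. The factor \<open>p\<close> in
  the denominator of \<open>M\<close> against \<open>sqrt p\<close> in \<open>h\<close> leaves the gain \<open>1 / sqrt p\<close>.
\<close>

lemma lp_slope_bounds_ge_1:
  assumes g: "0 \<le> g" and x: "1 \<le> gauss_to_lp p g"
  shows "lp_slope g * gauss_to_lp p g powr (p - 1) \<le> 8 * sqrt (gauss_to_lp p g powr p / p)" "lp_slope g \<le> 6"
proof -
  define x where "x = gauss_to_lp p g"
  define z where "z = x powr p"
  define Z where "Z = exp_powr_mass p"
  define M where "M = lp_density p x / (p * x powr (p - 1))"
  have x1: "1 \<le> x" using x by (simp add: x_def)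
  have z1: "1 \<le> z" unfolding z_def using x1 p by (intro ge_one_powr_ge_zero) auto
  have xp: "1 \<le> x powr (p - 1)" "x powr (p - 1) \<le> z"
    unfolding z_def using x1 p by (auto intro!: ge_one_powr_ge_zero powr_mono)
  have Z: "4 / 3 \<le> Z" "Z \<le> 6" using exp_powr_mass_bounds[OF p] by (auto simp: Z_def)
  have M_eq: "M = exp (- z) / (Z * (p * x powr (p - 1)))"
    using x1 by (simp add: M_def lp_density_def Z_def z_def)
  have den: "2 \<le> Z * (p * x powr (p - 1))"
    using mult_mono[of 1 Z 2 "p * x powr (p - 1)"] mult_mono[of 2 p 1 "x powr (p - 1)"] Z p xp by auto
  have M0: "0 < M" unfolding M_eq using den by (intro divide_pos_pos) auto
  have "exp (- z) \<le> 1" using z1 by simp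
  then have "M \<le> 1 / 2" unfolding M_eq using den by (intro frac_le) auto
  have tail: "1 - Phi g \<le> M"
    using lp_tail_upper[OF p, of x] x1 by (simp add: M_def x_def dist_fun_gauss_to_lp[OF p])
  define h where "h = Phi_inv (1 - M)"
  have Ph: "Phi h = 1 - M" unfolding h_def using M0 \<open>M \<le> 1/2\<close> by (intro Phi_Phi_inv) auto
  have "Phi 0 = 1 / 2" using Phi_minus[of 0] by simp
  then have h0: "0 \<le> h" using Ph \<open>M \<le> 1/2\<close> Phi_le_iff[of 0 h] by simp
  have hg: "h \<le> g" using tail Ph Phi_le_iff[of h g] by simp
  have "h\<^sup>2 \<le> 8 * (p * z)"
  proof -
    have "M \<le> exp (- h\<^sup>2 / 2)" using Phi_tail_upper[OF h0] Ph by simp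
    then have "ln M \<le> - h\<^sup>2 / 2" using M0 by (metis ln_exp ln_mono exp_gt_zero)
    moreover have "ln M = - z - ln (Z * (p * x powr (p - 1)))"
      unfolding M_eq using den by (subst ln_div) auto
    moreover have "ln (Z * (p * x powr (p - 1))) \<le> Z * (p * x powr (p - 1)) / 2"
    proof -
      let ?y = "Z * (p * x powr (p - 1)) / 2"
      have "ln ?y \<le> ?y - 1" using den by (intro ln_le_minus_one) auto
      moreover have "ln (Z * (p * x powr (p - 1))) = ln ?y + ln 2"
        using ln_mult_pos[of ?y 2] den by simp
      ultimately show ?thesis using ln_2_less_1 by linarith
    qed
    moreover have "Z * (p * x powr (p - 1)) \<le> 6 * (p * z)"
      using Z p xp z1 by (intro mult_mono) auto
    moreover have "2 * z \<le> p * z" using p z1 by simp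
    moreover have "0 \<le> p * z" using p z1 by simp
    ultimately show ?thesis by linarith
  qed
  then have "h \<le> sqrt (8 * (p * z))" by (rule real_le_rsqrt)
  also have "\<dots> \<le> sqrt (9 * (p * z))" using p z1 by simp
  also have "\<dots> = 3 * sqrt (p * z)" by (simp add: real_sqrt_mult)
  finally have h3: "h \<le> 3 * sqrt (p * z)" .
  have pz: "2 \<le> p * z" using p z1 mult_mono[of 2 p 1 z] by simp
  have "1 \<le> 5/7 * sqrt (p * z)"
  proof -
    have "(7 / 5)\<^sup>2 \<le> p * z" using pz by (simp add: power2_eq_square)
    then have "7 / 5 \<le> sqrt (p * z)" by (rule real_le_rsqrt)
    then show ?thesis by simp
  qed
  with h3 have h4: "1 + h \<le> 26 / 7 * sqrt (p * z)" by simp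
  have e1: "exp 1 \<le> (272 / 100 :: real)" using e_approx_32 by (simp add: abs_if split: if_splits)
  have "std_normal_density g \<le> std_normal_density h"
    by (rule std_normal_density_antimono[OF h0 hg])
  also have "\<dots> \<le> exp 1 * (1 + h) * M" using Phi_tail_lower[OF h0] Ph by simp
  also have "\<dots> \<le> (272 / 100) * (26 / 7 * sqrt (p * z)) * M"
    using e1 h4 h0 M0 pz by (intro mult_mono) auto
  finally have "lp_slope g \<le> (272 / 100) * (26 / 7 * sqrt (p * z)) * M * exp z"
    unfolding lp_slope_def x_def[symmetric] using x1 by (simp add: z_def)
  also have "\<dots> = (272 / 100) * (26 / 7) * (sqrt (p * z) / (Z * (p * x powr (p - 1))))"
    unfolding M_eq by (simp add: exp_minus field_simps)
  also have "\<dots> \<le> (272 / 100) * (26 / 7) * (sqrt (p * z) / (4 / 3 * (p * x powr (p - 1))))"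
    using Z p xp z1 by (intro mult_left_mono divide_left_mono mult_right_mono mult_pos_pos) auto
  also have "\<dots> \<le> 8 * (sqrt (p * z) / (p * x powr (p - 1)))"
  proof -
    have "0 \<le> sqrt (p * z) / (p * x powr (p - 1))" using p z1 xp by auto
    then have "(272 / 100 * (26 / 7) * (3 / 4)) * (sqrt (p * z) / (p * x powr (p - 1))) \<le> 8 * (sqrt (p * z) / (p * x powr (p - 1)))"
      by (rule mult_right_mono[rotated]) simp
    then show ?thesis by simp
  qed
  finally have b: "lp_slope g \<le> 8 * (sqrt (p * z) / (p * x powr (p - 1)))" .
  have sq: "sqrt (p * z) / p = sqrt (z / p)"
    using p z1 by (simp add: real_sqrt_mult real_sqrt_divide field_simps)
  have "lp_slope g * x powr (p - 1) \<le> 8 * (sqrt (p * z) / (p * x powr (p - 1))) * x powr (p - 1)"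
    using b by (intro mult_right_mono) auto
  also have "\<dots> = 8 * (sqrt (p * z) / p)" using xp x1 by simp
  finally show b2: "lp_slope g * gauss_to_lp p g powr (p - 1) \<le> 8 * sqrt (gauss_to_lp p g powr p / p)"
    by (simp add: sq x_def[symmetric] z_def[symmetric])
  have "sqrt z \<le> x powr (p - 1)"
  proof (rule real_le_lsqrt)
    have "z \<le> x powr (2 * (p - 1))" unfolding z_def using x1 p by (intro powr_mono) auto
    also have "\<dots> = (x powr (p - 1))\<^sup>2"
      using x1 by (simp add: power2_eq_square powr_add[symmetric])
    finally show "z \<le> (x powr (p - 1))\<^sup>2" .
  qed (use z1 xp in auto)
  have "lp_slope g * 1 * sqrt p \<le> lp_slope g * (x powr (p - 1) / sqrt z) * sqrt p"
    using \<open>sqrt z \<le> x powr (p - 1)\<close> z1 p by (intro mult_right_mono mult_left_mono) (auto simp: lp_slope_def)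
  also have "\<dots> = (lp_slope g * x powr (p - 1)) * (sqrt p / sqrt z)" by simp
  also have "\<dots> \<le> (8 * sqrt (z / p)) * (sqrt p / sqrt z)"
    using b2 z1 p by (intro mult_right_mono) (auto simp: x_def z_def)
  also have "\<dots> = 8" using z1 p by (simp add: real_sqrt_divide)
  finally have b8: "lp_slope g * sqrt p \<le> 8" by simp
  have "4 / 3 \<le> sqrt p" using p by (intro real_le_rsqrt) (simp add: power2_eq_square)
  then have "lp_slope g * (4 / 3) \<le> lp_slope g * sqrt p" by (intro mult_left_mono) (auto simp: lp_slope_def)
  then show "lp_slope g \<le> 6" using b8 by simp
qed

text \<open>
  Here \<open>exp (x powr p)\<close> is bounded. For \<open>x \<le> 1 / 4\<close> the factor \<open>x powr (p - 2)\<close> alone is at most \<open>2 / p\<close>; for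
  larger \<open>x\<close> the square of the Gaussian density is at most \<open>exp 1\<close> times the tail, and the tail carries the
  factor \<open>1 / p\<close>.
\<close>

lemma lp_slope_bounds_le_1:
  assumes g: "0 \<le> g" and x: "gauss_to_lp p g \<le> 1"
  shows "p * (lp_slope g * gauss_to_lp p g powr (p - 1))\<^sup>2 \<le> 64 * gauss_to_lp p g powr p" "lp_slope g \<le> 6"
proof -
  define x where "x = gauss_to_lp p g"
  define z where "z = x powr p"
  have x01: "0 \<le> x" "x \<le> 1" using assms gauss_to_lp_nonneg_iff[OF p] by (auto simp: x_def)
  have z: "0 \<le> z" "z \<le> 1" unfolding z_def using x01 p by (auto intro!: powr_le1)
  have e1: "exp 1 \<le> (272 / 100 :: real)" using e_approx_32 by (simp add: abs_if split: if_splits)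
  have bz: "lp_slope g = std_normal_density g * exp z"
    using x01 by (simp add: lp_slope_def x_def[symmetric] z_def)
  have ez: "exp z \<le> 272 / 100" using z e1 by (meson exp_le_cancel_iff order_trans)
  have \<phi>: "std_normal_density g \<le> 2 / 5"
  proof -
    have "exp (- g\<^sup>2 / 2) \<le> 1" by simp
    then show ?thesis using std_normal_density_le[of g] by linarith
  qed
  have "lp_slope g \<le> 2 / 5 * (272 / 100)" unfolding bz using \<phi> ez by (intro mult_mono) auto
  then have bs: "lp_slope g \<le> 11 / 10" by simp
  then show "lp_slope g \<le> 6" by simp
  have b0: "0 \<le> lp_slope g" by (simp add: bz)
  show "p * (lp_slope g * gauss_to_lp p g powr (p - 1))\<^sup>2 \<le> 64 * gauss_to_lp p g powr p"
  proof (cases "x = 0")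
    case True then show ?thesis by (simp add: x_def[symmetric])
  next
    case False
    then have x0: "0 < x" using x01 by simp
    have pw: "(x powr (p - 1))\<^sup>2 = x powr (p - 2) * z"
      unfolding z_def by (simp add: power2_eq_square powr_add[symmetric])
    have key: "p * x powr (p - 2) * (lp_slope g)\<^sup>2 \<le> 64"
    proof (cases "x \<le> 1 / 4")
      case True
      have "x powr (p - 2) \<le> (1 / 4) powr (p - 2)" using True x0 p by (intro powr_mono2) auto
      also have "\<dots> = exp (- ((p - 2) * ln 4))" by (simp add: powr_def ln_div)
      also have "\<dots> \<le> exp (- (p - 2))"
      proof -
        have "1 \<le> ln (4 :: real)" using exp_le ln_ge_iff[of 4 1] by simp
        then show ?thesis using p mult_left_mono[of 1 "ln 4" "p - 2"] by simp
      qed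
      also have "\<dots> \<le> 1 / (p - 1)"
        using p exp_ge_add_one_self[of "p - 2"]
        unfolding exp_minus inverse_eq_divide by (intro frac_le) auto
      also have "\<dots> \<le> 2 / p" using p by (simp add: field_simps)
      finally have "p * x powr (p - 2) \<le> 2" using p by (simp add: field_simps)
      moreover have "(lp_slope g)\<^sup>2 \<le> (11 / 10)\<^sup>2" using bs b0 by (intro power_mono)
      ultimately have "p * x powr (p - 2) * (lp_slope g)\<^sup>2 \<le> 2 * (11 / 10)\<^sup>2"
        using p by (intro mult_mono) auto
      then show ?thesis by (simp add: power2_eq_square)
    next
      case False
      have "(1 + g) * std_normal_density g \<le> 1"
      proof -
        have "(1 + g) * std_normal_density g \<le> (1 + g) * (2 / 5 * (1 / (1 + g\<^sup>2 / 2)))"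
        proof (intro mult_left_mono)
          have "exp (- g\<^sup>2 / 2) \<le> 1 / (1 + g\<^sup>2 / 2)"
            unfolding minus_divide_left[symmetric] exp_minus inverse_eq_divide
            using exp_ge_add_one_self[of "g\<^sup>2 / 2"] by (intro frac_le) (auto simp: add_pos_nonneg)
          then show "std_normal_density g \<le> 2 / 5 * (1 / (1 + g\<^sup>2 / 2))"
            using std_normal_density_le[of g] by linarith
        qed (use g in auto)
        also have "\<dots> \<le> 1"
        proof -
          have "0 \<le> (g - 1)\<^sup>2" "0 \<le> g\<^sup>2" by simp_all
          moreover have "(g - 1)\<^sup>2 = g\<^sup>2 - 2 * g + 1" by (simp add: power2_eq_square algebra_simps)
          ultimately have "(1 + g) * (2 / 5) \<le> 1 + g\<^sup>2 / 2" by argo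
          moreover have "0 < 1 + g\<^sup>2 / 2" by (simp add: add_pos_nonneg)
          ultimately show ?thesis by (simp add: field_simps)
        qed
        finally show ?thesis .
      qed
      have m0: "0 \<le> 1 - Phi g" using Phi_bounds[of g] by simp
      have "(std_normal_density g)\<^sup>2 \<le> exp 1 * (1 + g) * (1 - Phi g) * std_normal_density g"
        unfolding power2_eq_square using Phi_tail_lower[OF g] by (intro mult_right_mono) auto
      also have "\<dots> = exp 1 * (1 - Phi g) * ((1 + g) * std_normal_density g)" by simp
      also have "\<dots> \<le> exp 1 * (1 - Phi g) * 1"
        using \<open>(1 + g) * std_normal_density g \<le> 1\<close> m0 by (intro mult_left_mono) auto
      also have "\<dots> \<le> exp 1 * (lp_density p x / (p * x powr (p - 1)))"
        using lp_tail_upper[OF p x0] unfolding x_def dist_fun_gauss_to_lp[OF p] mult_1_right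
        by (intro mult_left_mono) auto
      also have "lp_density p x = exp (- z) / exp_powr_mass p"
        using x01 by (simp add: lp_density_def z_def)
      finally have \<phi>2: "(std_normal_density g)\<^sup>2 \<le> exp 1 * (exp (- z) / exp_powr_mass p / (p * x powr (p - 1)))" .
      have "p * x powr (p - 2) * (lp_slope g)\<^sup>2 = p * x powr (p - 2) * (exp z)\<^sup>2 * (std_normal_density g)\<^sup>2"
        by (simp add: bz power_mult_distrib)
      also have "\<dots> \<le> p * x powr (p - 2) * (exp z)\<^sup>2 * (exp 1 * (exp (- z) / exp_powr_mass p / (p * x powr (p - 1))))"
        using \<phi>2 p by (intro mult_left_mono) auto
      also have "x powr (p - 1) = x powr (p - 2) * x"
        using x0 powr_add[of x "p - 2" 1] by simp
      also have "p * x powr (p - 2) * (exp z)\<^sup>2 * (exp 1 * (exp (- z) / exp_powr_mass p / (p * (x powr (p - 2) * x))))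
          = exp z * exp 1 / (exp_powr_mass p * x)"
        using p x0 by (simp add: exp_minus power2_eq_square field_simps)
      also have "\<dots> \<le> (272 / 100) * (272 / 100) / (4 / 3 * (1 / 4))"
        using ez e1 exp_powr_mass_bounds[OF p] False x0 by (intro frac_le mult_mono mult_pos_pos) auto
      also have "\<dots> \<le> 64" by simp
      finally show ?thesis .
    qed
    have "p * (lp_slope g * x powr (p - 1))\<^sup>2 = (p * x powr (p - 2) * (lp_slope g)\<^sup>2) * z"
      by (simp add: power_mult_distrib pw)
    also have "\<dots> \<le> 64 * z" using key z by (intro mult_right_mono)
    finally show ?thesis by (simp add: x_def[symmetric] z_def[symmetric])
  qed
qed

text \<open>
  The second bound says that \<open>\<bar>x\<bar> powr (p / 2)\<close> is a Lipschitz function of \<open>g\<close> with a constant of order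
  \<open>sqrt p\<close>. That both constants do not depend on \<open>p\<close> is what makes the final inequality uniform in \<open>p\<close>.
\<close>

lemma gauss_to_lp_slope_bounds:
  fixes g :: real
  defines "x \<equiv> gauss_to_lp p g"
  shows "std_normal_density g * exp (\<bar>x\<bar> powr p) \<le> 6"
    "p * (std_normal_density g * exp (\<bar>x\<bar> powr p) * \<bar>x\<bar> powr (p - 1))\<^sup>2 \<le> 64 * \<bar>x\<bar> powr p"
proof -
  have pos: "lp_slope g \<le> 6 \<and> p * (lp_slope g * \<bar>gauss_to_lp p g\<bar> powr (p - 1))\<^sup>2 \<le> 64 * \<bar>gauss_to_lp p g\<bar> powr p"
    if g: "0 \<le> g" for g
  proof (cases "gauss_to_lp p g \<le> 1")
    case True
    then show ?thesis using lp_slope_bounds_le_1[OF g True] gauss_to_lp_nonneg_iff[OF p] g by simp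
  next
    case False
    define x where "x = gauss_to_lp p g"
    have "lp_slope g * x powr (p - 1) \<le> 8 * sqrt (x powr p / p)" "lp_slope g \<le> 6"
      using lp_slope_bounds_ge_1[OF g] False by (auto simp: x_def)
    then have "(lp_slope g * x powr (p - 1))\<^sup>2 \<le> (8 * sqrt (x powr p / p))\<^sup>2"
      by (intro power_mono) (auto simp: lp_slope_def)
    also have "\<dots> = 64 * x powr p / p" using p by (simp add: power_mult_distrib)
    finally have "p * (lp_slope g * x powr (p - 1))\<^sup>2 \<le> 64 * x powr p" using p by (simp add: field_simps)
    then show ?thesis using \<open>lp_slope g \<le> 6\<close> gauss_to_lp_nonneg_iff[OF p] g by (simp add: x_def)
  qed
  have "lp_slope (- g) = lp_slope g" "\<bar>gauss_to_lp p (- g)\<bar> = \<bar>gauss_to_lp p g\<bar>" for g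
    by (simp_all add: lp_slope_def gauss_to_lp_minus[OF p] std_normal_density_def)
  then have "lp_slope g \<le> 6 \<and> p * (lp_slope g * \<bar>gauss_to_lp p g\<bar> powr (p - 1))\<^sup>2 \<le> 64 * \<bar>gauss_to_lp p g\<bar> powr p"
    using pos[of "\<bar>g\<bar>"] by (cases "0 \<le> g") (auto simp: abs_if)
  then show "std_normal_density g * exp (\<bar>x\<bar> powr p) \<le> 6"
    "p * (std_normal_density g * exp (\<bar>x\<bar> powr p) * \<bar>x\<bar> powr (p - 1))\<^sup>2 \<le> 64 * \<bar>x\<bar> powr p"
    by (simp_all add: lp_slope_def x_def)
qed

end

section \<open>The Lipschitz map from Gaussian space to the ball\<close>

lemma abs_powr_has_derivative:
  fixes x p :: real
  assumes p: "2 \<le> p"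
  shows "((\<lambda>x. \<bar>x\<bar> powr p) has_real_derivative p * \<bar>x\<bar> powr (p - 1) * sgn x) (at x)"
proof (cases x "0 :: real" rule: linorder_cases)
  case greater
  have "((\<lambda>x. x powr p) has_real_derivative p * x powr (p - 1)) (at x)"
    using greater by (rule has_real_derivative_powr)
  then have "((\<lambda>x. \<bar>x\<bar> powr p) has_real_derivative p * x powr (p - 1)) (at x)"
    by (rule has_field_derivative_transform_within_open[where S="{0<..}"]) (use greater in auto)
  then show ?thesis using greater by simp
next
  case less
  have "((\<lambda>x. (- x) powr p) has_real_derivative p * (- x) powr (p - 1) * (- 1)) (at x)"
    using less by (intro DERIV_chain2[of "\<lambda>y. y powr p"] has_real_derivative_powr) (auto intro!: derivative_eq_intros)
  then have "((\<lambda>x. \<bar>x\<bar> powr p) has_real_derivative p * (- x) powr (p - 1) * (- 1)) (at x)"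
    by (rule has_field_derivative_transform_within_open[where S="{..<0}"]) (use less in auto)
  then show ?thesis using less by simp
next
  case equal
  have "((\<lambda>h. (\<bar>0 + h\<bar> powr p - \<bar>0\<bar> powr p) / h) \<longlongrightarrow> 0) (at 0)"
  proof (rule Lim_null_comparison)
    have "norm ((\<bar>0 + h\<bar> powr p - \<bar>0\<bar> powr p) / h) \<le> \<bar>h\<bar>" if "h \<noteq> 0" "\<bar>h\<bar> < 1" for h :: real
    proof -
      have "\<bar>h\<bar> powr p \<le> \<bar>h\<bar>\<^sup>2" using that powr_le_square[OF p, of "\<bar>h\<bar>"] by simp
      then show ?thesis using that p by (simp add: abs_divide pos_divide_le_eq power2_eq_square)
    qed
    then show "\<forall>\<^sub>F h in at 0. norm ((\<bar>0 + h\<bar> powr p - \<bar>0\<bar> powr p) / h) \<le> \<bar>h\<bar>"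
      unfolding eventually_at by (intro exI[of _ 1]) auto
    show "((\<lambda>h::real. \<bar>h\<bar>) \<longlongrightarrow> 0) (at 0)" by (auto intro!: tendsto_eq_intros)
  qed
  then show ?thesis using equal unfolding DERIV_def by simp
qed

text \<open>
  For \<open>z = s powr p\<close> this is \<open>s ^ (- n)\<close> times the integral of \<open>n * y ^ (n - 1) * exp (- (y powr p))\<close> over
  \<open>0 \<le> y \<le> s\<close>, the radial mass of \<open>exp (- (\<Sum>i<n. \<bar>x i\<bar> powr p))\<close>. It is smooth in \<open>z\<close> at 0 as well.
\<close>

definition radial_mass :: "real \<Rightarrow> nat \<Rightarrow> real \<Rightarrow> real" where
  "radial_mass p n z = integral {0..1} (\<lambda>v. real n * v ^ (n - 1) * exp (- (z * v powr p)))"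

definition radial_mass_deriv :: "real \<Rightarrow> nat \<Rightarrow> real \<Rightarrow> real" where
  "radial_mass_deriv p n z = integral {0..1} (\<lambda>v. real n * v ^ (n - 1) * (exp (- (z * v powr p)) * v powr p))"

text \<open>
  The factor by which a point \<open>x\<close> with \<open>(\<Sum>i<n. \<bar>x i\<bar> powr p) = z\<close> has to be stretched along its ray: the
  \<open>n\<close>-th power of the new radius is the normalised radial mass up to the old one.
\<close>

definition radial_factor :: "real \<Rightarrow> nat \<Rightarrow> real \<Rightarrow> real" where
  "radial_factor p n z = radial_mass p n z powr (1 / real n) / exp_powr_mass p"

context
  fixes p :: real and n :: nat
  assumes p: "2 \<le> p" and n: "1 \<le> n"
begin

abbreviation "mass \<equiv> radial_mass p n"
abbreviation "mass_deriv \<equiv> radial_mass_deriv p n"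

lemma continuous_on_powr_01: "continuous_on {0..1} (\<lambda>v::real. v powr p)"
  using p by (intro continuous_on_powr' continuous_intros) auto

lemma radial_mass_has_derivative: "(mass has_real_derivative - mass_deriv z) (at z)"
proof -
  have "((\<lambda>z. integral (cbox 0 1) (\<lambda>v. real n * v ^ (n - 1) * exp (- (z * v powr p)))) has_real_derivative
     integral (cbox 0 1) (\<lambda>v. real n * v ^ (n - 1) * (exp (- (z * v powr p)) * (- (v powr p))))) (at z within UNIV)"
  proof (rule leibniz_rule_field_derivative)
    show "((\<lambda>z. real n * v ^ (n - 1) * exp (- (z * v powr p))) has_real_derivative
       real n * v ^ (n - 1) * (exp (- (z * v powr p)) * (- (v powr p)))) (at z within UNIV)" for z v :: real
      by (auto intro!: derivative_eq_intros)
    show "(\<lambda>v. real n * v ^ (n - 1) * exp (- (z * v powr p))) integrable_on cbox 0 1" for z :: real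
      by (intro integrable_continuous) (auto intro!: continuous_intros continuous_on_powr_01)
    have "continuous_on (UNIV \<times> {0..1}) (\<lambda>w::real \<times> real. snd w powr p)"
      by (rule continuous_on_compose2[OF continuous_on_powr_01]) (auto intro!: continuous_intros)
    then show "continuous_on (UNIV \<times> cbox 0 1)
        (\<lambda>(z, v). real n * v ^ (n - 1) * (exp (- (z * v powr p)) * (- (v powr p))))"
      by (auto simp: split_beta intro!: continuous_intros)
  qed auto
  then show ?thesis
    by (simp add: radial_mass_def[abs_def] radial_mass_deriv_def)
qed

lemma radial_integrable:
  "(\<lambda>v. real n * v ^ (n - 1) * exp (- (z * v powr p))) integrable_on {0..1}"
  "(\<lambda>v. real n * v ^ (n - 1) * (exp (- (z * v powr p)) * v powr p)) integrable_on {0..1}"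
  by (intro integrable_continuous_real continuous_intros continuous_on_powr_01)+

lemma radial_mass_deriv_bounds: "0 \<le> mass_deriv z" "mass_deriv z \<le> mass z"
proof -
  have v1: "v powr p \<le> 1" if "0 \<le> v" "v \<le> 1" for v :: real
    using that p by (intro powr_le1) auto
  show "0 \<le> mass_deriv z"
    unfolding radial_mass_deriv_def by (intro integral_nonneg radial_integrable) auto
  show "mass_deriv z \<le> mass z"
    unfolding radial_mass_deriv_def radial_mass_def
    by (intro integral_le radial_integrable mult_left_mono) (auto simp: v1 mult_left_le)
qed

lemma has_integral_power: "((\<lambda>v. real n * v ^ (n - 1)) has_integral 1) {0..1}"
proof -
  have "((\<lambda>v. real n * v ^ (n - 1)) has_integral (1 ^ n - 0 ^ n :: real)) {0..1}"
    by (rule fundamental_theorem_of_calculus)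
      (auto intro!: derivative_eq_intros simp: has_real_derivative_iff_has_vector_derivative[symmetric])
  then show ?thesis using n by (simp add: power_0_left)
qed

lemma radial_mass_bounds:
  assumes "0 \<le> z" shows "0 < mass z" "mass z \<le> 1"
proof -
  have v1: "z * v powr p \<le> z" if "0 \<le> v" "v \<le> 1" for v :: real
    using that p assms by (intro mult_left_le powr_le1) auto
  have 1: "integral {0..1} (\<lambda>v. real n * v ^ (n - 1)) = 1"
    using has_integral_power by (rule integral_unique)
  have "integral {0..1} (\<lambda>v. real n * v ^ (n - 1) * exp (- z)) \<le> mass z"
    unfolding radial_mass_def
    by (intro integral_le radial_integrable integrable_on_mult_left has_integral_integrable[OF has_integral_power] mult_left_mono)
      (auto simp: v1)
  moreover have "integral {0..1} (\<lambda>v. real n * v ^ (n - 1) * exp (- z)) = 1 * exp (- z)"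
    by (intro integral_unique has_integral_mult_left has_integral_power)
  ultimately have "exp (- z) \<le> mass z" by linarith
  then show "0 < mass z" using exp_gt_zero[of "- z"] by linarith
  have "mass z \<le> integral {0..1} (\<lambda>v. real n * v ^ (n - 1))"
    unfolding radial_mass_def
    by (intro integral_le radial_integrable has_integral_integrable[OF has_integral_power])
      (use assms in \<open>auto intro!: mult_left_le\<close>)
  then show "mass z \<le> 1" unfolding 1 .
qed

text \<open>
  The derivative of \<open>v ^ n * exp (- (z * v powr p))\<close> is integrated over \<open>0 \<le> v \<le> 1\<close>.
\<close>

lemma radial_mass_by_parts: "mass z = exp (- z) + p * z / real n * mass_deriv z"
proof -
  have "((\<lambda>v. real n * v ^ (n - 1) * exp (- (z * v powr p))
        - p * z / real n * (real n * v ^ (n - 1) * (exp (- (z * v powr p)) * v powr p))) has_integral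
      (1 ^ n * exp (- (z * 1 powr p)) - 0 ^ n * exp (- (z * 0 powr p)))) {0..1}"
  proof (rule fundamental_theorem_of_calculus_interior)
    show "continuous_on {0..1} (\<lambda>v. v ^ n * exp (- (z * v powr p)))"
      by (intro continuous_intros continuous_on_powr_01)
    fix v :: real assume v: "v \<in> {0<..<1}"
    have "((\<lambda>v. v ^ n * exp (- (z * v powr p))) has_real_derivative
        real n * v ^ (n - 1) * exp (- (z * v powr p)) + v ^ n * (exp (- (z * v powr p)) * (- (z * (p * v powr (p - 1)))))) (at v)"
      using v by (auto intro!: derivative_eq_intros has_real_derivative_powr)
    moreover have "v ^ n * v powr (p - 1) = v ^ (n - 1) * v powr p"
    proof -
      have "v powr p = v * v powr (p - 1)" using v powr_add[of v 1 "p - 1"] by simp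
      moreover have "v ^ n = v ^ (n - 1) * v" using n by (metis mult.commute power_eq_if not_one_le_zero)
      ultimately show ?thesis by simp
    qed
    then have "real n * v ^ (n - 1) * exp (- (z * v powr p)) + v ^ n * (exp (- (z * v powr p)) * (- (z * (p * v powr (p - 1)))))
      = real n * v ^ (n - 1) * exp (- (z * v powr p))
        - p * z / real n * (real n * v ^ (n - 1) * (exp (- (z * v powr p)) * v powr p))"
      using n by (simp add: algebra_simps)
    ultimately show "((\<lambda>v. v ^ n * exp (- (z * v powr p))) has_vector_derivative
        real n * v ^ (n - 1) * exp (- (z * v powr p))
        - p * z / real n * (real n * v ^ (n - 1) * (exp (- (z * v powr p)) * v powr p))) (at v)"
      by (simp add: has_real_derivative_iff_has_vector_derivative)
  qed simp
  moreover have "((\<lambda>v. real n * v ^ (n - 1) * exp (- (z * v powr p))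
        - p * z / real n * (real n * v ^ (n - 1) * (exp (- (z * v powr p)) * v powr p))) has_integral
      (mass z - p * z / real n * mass_deriv z)) {0..1}"
    unfolding radial_mass_def radial_mass_deriv_def
    by (intro has_integral_diff has_integral_mult_right integrable_integral radial_integrable)
  ultimately have "mass z - p * z / real n * mass_deriv z = 1 ^ n * exp (- (z * 1 powr p)) - 0 ^ n * exp (- (z * 0 powr p))"
    by (rule has_integral_unique[rotated])
  then show ?thesis using n by (simp add: power_0_left)
qed

text \<open>
  Minus the logarithmic derivative of \<open>radial_factor p n\<close>.
\<close>

definition log_slope :: "real \<Rightarrow> real" where
  "log_slope z = mass_deriv z / (real n * mass z)"

lemma log_slope_bounds:
  assumes "0 \<le> z"
  shows "0 \<le> log_slope z" "real n * log_slope z \<le> 1" "p * z * log_slope z \<le> 1"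
proof -
  note mass = radial_mass_bounds[OF assms]
  show "0 \<le> log_slope z" "real n * log_slope z \<le> 1"
    using mass n radial_mass_deriv_bounds[of z] by (auto simp: log_slope_def)
  have "p * z / real n * mass_deriv z \<le> mass z" using radial_mass_by_parts[of z] exp_gt_zero[of "- z"] by linarith
  then show "p * z * log_slope z \<le> 1" using mass n by (simp add: log_slope_def field_simps)
qed

lemma radial_factor_has_derivative:
  assumes "0 \<le> z"
  shows "(radial_factor p n has_real_derivative - (radial_factor p n z * log_slope z)) (at z)"
proof -
  note mass = radial_mass_bounds[OF assms]
  have "((\<lambda>z. mass z powr (1 / real n) / exp_powr_mass p) has_real_derivative
      (1 / real n) * mass z powr (1 / real n - 1) * - mass_deriv z / exp_powr_mass p) (at z)"
    using mass by (intro DERIV_cdivide DERIV_chain2[of "\<lambda>y. y powr (1 / real n)"] has_real_derivative_powr radial_mass_has_derivative) auto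
  also have "(1 / real n) * mass z powr (1 / real n - 1) * - mass_deriv z / exp_powr_mass p = - (radial_factor p n z * log_slope z)"
    using mass by (simp add: radial_factor_def log_slope_def powr_diff)
  finally show ?thesis by (simp add: radial_factor_def[abs_def])
qed

lemma radial_factor_bounds:
  assumes "0 \<le> z" shows "0 < radial_factor p n z" "radial_factor p n z * exp_powr_mass p \<le> 1"
  using radial_mass_bounds[OF assms] exp_powr_mass_bounds[OF p]
  by (auto simp: radial_factor_def intro!: divide_pos_pos powr_le1)

definition gauss_to_ball :: "(nat \<Rightarrow> real) \<Rightarrow> nat \<Rightarrow> real" where
  "gauss_to_ball g = (\<lambda>i\<in>{..<n}. radial_factor p n (\<Sum>j<n. \<bar>gauss_to_lp p (g j)\<bar> powr p) * gauss_to_lp p (g i))"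

text \<open>
  Along a segment the derivative of the map is the sum of a diagonal part and a part of rank one. In the
  diagonal part the radial factor is at most \<open>1 / exp_powr_mass p\<close>, which cancels the same factor in the
  slope of \<open>gauss_to_lp p\<close> and leaves at most 6.

  In the part of rank one, let \<open>z = (\<Sum>i<n. \<bar>x i\<bar> powr p)\<close> and let \<open>\<kappa>\<close> be minus the logarithmic derivative of the
  radial factor. By the second slope bound and the Cauchy--Schwarz inequality, the derivative of \<open>z\<close> times the
  radial factor is at most \<open>8 * sqrt (p * z)\<close> times the length of the segment, and \<open>\<Sum>i<n. (x i)\<^sup>2 \<le> n + z\<close> because
  \<open>(x i)\<^sup>2 \<le> 1 + \<bar>x i\<bar> powr p\<close>. Now \<open>n * \<kappa> \<le> 1\<close> and \<open>p * z * \<kappa> \<le> 1\<close> imply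
  \<open>\<kappa>\<^sup>2 * (p * z) * (n + z) \<le> 1 + 1 / p\<close>, so that this part contributes at most 12.
\<close>

theorem gauss_to_ball_lipschitz:
  "L2_set (\<lambda>i. gauss_to_ball g i - gauss_to_ball h i) {..<n} \<le> 18 * L2_set (\<lambda>i. g i - h i) {..<n}"
proof -
  let ?S = "{..<n}"
  define e where "e i = gauss_to_ball g i - gauss_to_ball h i" for i
  define \<delta> where "\<delta> i = g i - h i" for i
  define \<gamma> where "\<gamma> i \<tau> = h i + \<tau> * \<delta> i" for i \<tau>
  define X where "X i \<tau> = gauss_to_lp p (\<gamma> i \<tau>)" for i \<tau>
  define z where "z \<tau> = (\<Sum>j<n. \<bar>X j \<tau>\<bar> powr p)" for \<tau>
  define b where "b i \<tau> = std_normal_density (\<gamma> i \<tau>) * exp (\<bar>X i \<tau>\<bar> powr p)" for i \<tau>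
  let ?Z = "exp_powr_mass p" and ?a = "radial_factor p n"
  have Z: "0 < ?Z" using exp_powr_mass_bounds[OF p] by linarith
  define X' where "X' i \<tau> = ?Z * b i \<tau> * \<delta> i" for i \<tau>
  define z' where "z' \<tau> = (\<Sum>j<n. p * \<bar>X j \<tau>\<bar> powr (p - 1) * sgn (X j \<tau>) * X' j \<tau>)" for \<tau>
  \<comment> \<open>The image of the segment is tested against the increment \<open>e\<close>, so that the mean value theorem for a real function applies.\<close>
  define H where "H \<tau> = (\<Sum>i<n. e i * (?a (z \<tau>) * X i \<tau>))" for \<tau>
  define H' where "H' \<tau> = (\<Sum>i<n. e i * (?a (z \<tau>) * X' i \<tau> + - (?a (z \<tau>) * log_slope (z \<tau>)) * z' \<tau> * X i \<tau>))" for \<tau>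
  have z0: "0 \<le> z \<tau>" for \<tau> by (auto simp: z_def intro!: sum_nonneg)
  have b0: "0 \<le> b i \<tau>" for i \<tau> by (simp add: b_def)
  have Xd: "((\<lambda>\<tau>. X i \<tau>) has_real_derivative X' i \<tau>) (at \<tau>)" for i \<tau>
  proof -
    have "((\<lambda>\<tau>. h i + \<tau> * \<delta> i) has_real_derivative \<delta> i) (at \<tau>)" by (auto intro!: derivative_eq_intros)
    from DERIV_chain2[OF gauss_to_lp_has_derivative[OF p] this]
    show ?thesis
      by (simp add: X_def \<gamma>_def X'_def b_def lp_density_def exp_minus field_simps)
  qed
  have zd: "(z has_real_derivative z' \<tau>) (at \<tau>)" for \<tau>
    unfolding z_def[abs_def] z'_def by (intro DERIV_sum DERIV_chain2[OF abs_powr_has_derivative[OF p] Xd])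
  have Hd: "(H has_real_derivative H' \<tau>) (at \<tau>)" for \<tau>
  proof -
    have "((\<lambda>\<tau>. ?a (z \<tau>)) has_real_derivative - (?a (z \<tau>) * log_slope (z \<tau>)) * z' \<tau>) (at \<tau>)"
      by (rule DERIV_chain2[OF radial_factor_has_derivative[OF z0] zd])
    from DERIV_mult[OF this Xd]
    have "((\<lambda>\<tau>. ?a (z \<tau>) * X i \<tau>) has_real_derivative
        ?a (z \<tau>) * X' i \<tau> + - (?a (z \<tau>) * log_slope (z \<tau>)) * z' \<tau> * X i \<tau>) (at \<tau>)" for i
      by (simp add: algebra_simps)
    then show ?thesis unfolding H_def[abs_def] H'_def by (intro DERIV_sum DERIV_cmult)
  qed
  have H01: "H 1 - H 0 = (\<Sum>i<n. (e i)\<^sup>2)"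
  proof -
    have "e i = ?a (z 1) * X i 1 - ?a (z 0) * X i 0" if "i < n" for i
      using that by (simp add: e_def gauss_to_ball_def z_def X_def \<gamma>_def \<delta>_def)
    then have "(\<Sum>i<n. (e i)\<^sup>2) = (\<Sum>i<n. e i * (?a (z 1) * X i 1) - e i * (?a (z 0) * X i 0))"
      by (intro sum.cong) (auto simp: power2_eq_square right_diff_distrib[symmetric])
    then show ?thesis by (simp add: H_def sum_subtractf)
  qed
  let ?E = "L2_set e ?S" and ?D = "L2_set \<delta> ?S"
  have Hb: "H' \<tau> \<le> 18 * ?E * ?D" for \<tau>
  proof -
    define \<kappa> where "\<kappa> = log_slope (z \<tau>)"
    note \<kappa> = log_slope_bounds[OF z0[of \<tau>], folded \<kappa>_def]
    note a = radial_factor_bounds[OF z0[of \<tau>]]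
    have aX': "\<bar>?a (z \<tau>) * X' i \<tau>\<bar> \<le> b i \<tau> * \<bar>\<delta> i\<bar>" for i
    proof -
      have "\<bar>?a (z \<tau>) * X' i \<tau>\<bar> = (?a (z \<tau>) * ?Z) * (b i \<tau> * \<bar>\<delta> i\<bar>)"
        using a Z b0 by (simp add: X'_def abs_mult)
      also have "\<dots> \<le> 1 * (b i \<tau> * \<bar>\<delta> i\<bar>)"
        using a b0 by (intro mult_right_mono) auto
      finally show ?thesis by simp
    qed
    have b6: "b i \<tau> \<le> 6" for i
      unfolding b_def X_def by (rule gauss_to_lp_slope_bounds[OF p])
    have first: "(\<Sum>i<n. e i * (?a (z \<tau>) * X' i \<tau>)) \<le> 6 * ?E * ?D"
    proof -
      have "(\<Sum>i<n. e i * (?a (z \<tau>) * X' i \<tau>)) \<le> (\<Sum>i<n. 6 * (\<bar>e i\<bar> * \<bar>\<delta> i\<bar>))"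
      proof (rule sum_mono)
        fix i
        have "e i * (?a (z \<tau>) * X' i \<tau>) \<le> \<bar>e i\<bar> * \<bar>?a (z \<tau>) * X' i \<tau>\<bar>"
          by (metis abs_ge_self abs_mult)
        also have "\<dots> \<le> \<bar>e i\<bar> * (6 * \<bar>\<delta> i\<bar>)"
          using aX'[of i] b6[of i] mult_right_mono[of "b i \<tau>" 6 "\<bar>\<delta> i\<bar>"] by (intro mult_left_mono) auto
        finally show "e i * (?a (z \<tau>) * X' i \<tau>) \<le> 6 * (\<bar>e i\<bar> * \<bar>\<delta> i\<bar>)" by simp
      qed
      also have "\<dots> \<le> 6 * (?E * ?D)"
        unfolding sum_distrib_left[symmetric] by (intro mult_left_mono L2_set_mult_ineq) auto
      finally show ?thesis by simp
    qed
    have az': "\<bar>?a (z \<tau>) * z' \<tau>\<bar> \<le> 8 * sqrt (p * z \<tau>) * ?D"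
    proof -
      define q where "q i = b i \<tau> * \<bar>X i \<tau>\<bar> powr (p - 1)" for i
      have "\<bar>?a (z \<tau>) * z' \<tau>\<bar> = \<bar>\<Sum>j<n. p * \<bar>X j \<tau>\<bar> powr (p - 1) * sgn (X j \<tau>) * (?a (z \<tau>) * X' j \<tau>)\<bar>"
        by (simp add: z'_def sum_distrib_left algebra_simps)
      also have "\<dots> \<le> (\<Sum>j<n. \<bar>p * \<bar>X j \<tau>\<bar> powr (p - 1) * sgn (X j \<tau>) * (?a (z \<tau>) * X' j \<tau>)\<bar>)"
        by (rule sum_abs)
      also have "\<dots> \<le> (\<Sum>j<n. p * (\<bar>q j\<bar> * \<bar>\<delta> j\<bar>))"
      proof (rule sum_mono)
        fix j
        have "\<bar>p * \<bar>X j \<tau>\<bar> powr (p - 1) * sgn (X j \<tau>) * (?a (z \<tau>) * X' j \<tau>)\<bar>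
            = (p * \<bar>X j \<tau>\<bar> powr (p - 1)) * \<bar>sgn (X j \<tau>)\<bar> * \<bar>?a (z \<tau>) * X' j \<tau>\<bar>"
          using p by (simp add: abs_mult)
        also have "\<dots> \<le> (p * \<bar>X j \<tau>\<bar> powr (p - 1)) * 1 * (b j \<tau> * \<bar>\<delta> j\<bar>)"
          using p aX'[of j] by (intro mult_mono) (auto simp: abs_sgn_eq)
        finally show "\<bar>p * \<bar>X j \<tau>\<bar> powr (p - 1) * sgn (X j \<tau>) * (?a (z \<tau>) * X' j \<tau>)\<bar> \<le> p * (\<bar>q j\<bar> * \<bar>\<delta> j\<bar>)"
          using b0[of j \<tau>] by (simp add: q_def algebra_simps)
      qed
      also have "\<dots> \<le> p * (L2_set q ?S * ?D)"
        unfolding sum_distrib_left[symmetric] using p by (intro mult_left_mono L2_set_mult_ineq) auto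
      also have "\<dots> \<le> (8 * sqrt (p * z \<tau>)) * ?D"
      proof -
        have "(p * L2_set q ?S)\<^sup>2 = p * (\<Sum>i<n. p * (q i)\<^sup>2)"
          by (simp add: L2_set_def power_mult_distrib sum_nonneg sum_distrib_left[symmetric] power2_eq_square)
        also have "\<dots> \<le> p * (\<Sum>i<n. 64 * \<bar>X i \<tau>\<bar> powr p)"
          using p gauss_to_lp_slope_bounds(2)[OF p]
          by (intro mult_left_mono sum_mono) (auto simp: q_def b_def X_def)
        also have "\<dots> = 64 * (p * z \<tau>)" by (simp add: z_def sum_distrib_left[symmetric])
        finally have "p * L2_set q ?S \<le> sqrt (64 * (p * z \<tau>))" by (rule real_le_rsqrt)
        then have "p * L2_set q ?S \<le> 8 * sqrt (p * z \<tau>)" by (simp add: real_sqrt_mult)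
        then have "p * L2_set q ?S * ?D \<le> 8 * sqrt (p * z \<tau>) * ?D"
          by (intro mult_right_mono) auto
        then show ?thesis by (simp add: mult.assoc)
      qed
      finally show ?thesis .
    qed
    have XL: "L2_set (\<lambda>i. X i \<tau>) ?S \<le> sqrt (real n + z \<tau>)"
    proof -
      have "(X i \<tau>)\<^sup>2 \<le> 1 + \<bar>X i \<tau>\<bar> powr p" for i
      proof (cases "\<bar>X i \<tau>\<bar> \<le> 1")
        case True
        then have "(X i \<tau>)\<^sup>2 \<le> 1" by (simp add: abs_square_le_1)
        then show ?thesis by (simp add: add_increasing2)
      next
        case False then show ?thesis using powr_ge_square[OF p, of "\<bar>X i \<tau>\<bar>"] by simp
      qed
      then have "(\<Sum>i<n. (X i \<tau>)\<^sup>2) \<le> (\<Sum>i<n. 1 + \<bar>X i \<tau>\<bar> powr p)" by (intro sum_mono)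
      then show ?thesis by (simp add: L2_set_def z_def sum.distrib)
    qed
    have "\<kappa> * sqrt (p * z \<tau>) * sqrt (real n + z \<tau>) \<le> 3 / 2"
    proof (rule power2_le_imp_le)
      have "(\<kappa> * sqrt (p * z \<tau>) * sqrt (real n + z \<tau>))\<^sup>2 = (p * z \<tau> * \<kappa>) * (real n * \<kappa>) + (p * z \<tau> * \<kappa>) * (z \<tau> * \<kappa>)"
        using p z0[of \<tau>] by (simp add: power_mult_distrib algebra_simps power2_eq_square)
      also have "\<dots> \<le> 1 * 1 + 1 * (1 / 2)"
      proof (intro add_mono mult_mono)
        have "2 * (z \<tau> * \<kappa>) \<le> p * (z \<tau> * \<kappa>)" using p z0 \<kappa> by (intro mult_right_mono) auto
        then show "z \<tau> * \<kappa> \<le> 1 / 2" using \<kappa>(3) by (simp add: mult.assoc)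
      qed (use \<kappa> z0 p in auto)
      also have "\<dots> \<le> (3 / 2)\<^sup>2" by (simp add: power2_eq_square)
      finally show "(\<kappa> * sqrt (p * z \<tau>) * sqrt (real n + z \<tau>))\<^sup>2 \<le> (3 / 2)\<^sup>2" .
    qed simp
    note \<kappa>32 = this
    have gen: "- A * B \<le> \<bar>A\<bar> * \<bar>B\<bar>" for A B :: real
      using abs_ge_self[of "- A * B"] by (simp add: abs_mult)
    have second: "(\<Sum>i<n. e i * (- (?a (z \<tau>) * \<kappa>) * z' \<tau> * X i \<tau>)) \<le> 12 * ?E * ?D"
    proof -
      have "(\<Sum>i<n. e i * (- (?a (z \<tau>) * \<kappa>) * z' \<tau> * X i \<tau>))
          = - (\<kappa> * (?a (z \<tau>) * z' \<tau>)) * (\<Sum>i<n. e i * X i \<tau>)"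
        unfolding sum_distrib_left by (rule sum.cong[OF refl]) algebra
      also have "\<dots> \<le> \<bar>\<kappa> * (?a (z \<tau>) * z' \<tau>)\<bar> * \<bar>\<Sum>i<n. e i * X i \<tau>\<bar>"
        by (rule gen)
      also have "\<dots> \<le> (\<kappa> * (8 * sqrt (p * z \<tau>) * ?D)) * (?E * sqrt (real n + z \<tau>))"
      proof (rule mult_mono)
        show "\<bar>\<kappa> * (?a (z \<tau>) * z' \<tau>)\<bar> \<le> \<kappa> * (8 * sqrt (p * z \<tau>) * ?D)"
          using \<kappa> az' by (simp only: abs_mult[of \<kappa>] abs_of_nonneg) (intro mult_left_mono)
        have "\<bar>\<Sum>i<n. e i * X i \<tau>\<bar> \<le> (\<Sum>i<n. \<bar>e i\<bar> * \<bar>X i \<tau>\<bar>)"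
          by (rule order_trans[OF sum_abs]) (simp add: abs_mult)
        also have "\<dots> \<le> ?E * L2_set (\<lambda>i. X i \<tau>) ?S" by (rule L2_set_mult_ineq)
        also have "\<dots> \<le> ?E * sqrt (real n + z \<tau>)" using XL by (intro mult_left_mono) auto
        finally show "\<bar>\<Sum>i<n. e i * X i \<tau>\<bar> \<le> ?E * sqrt (real n + z \<tau>)" .
      qed (use \<kappa> p z0 in auto)
      also have "\<dots> = 8 * (\<kappa> * sqrt (p * z \<tau>) * sqrt (real n + z \<tau>)) * (?E * ?D)" by simp
      also have "\<dots> \<le> 8 * (3 / 2) * (?E * ?D)"
        using \<kappa>32 by (intro mult_right_mono mult_left_mono) auto
      finally show ?thesis by simp
    qed
    have "H' \<tau> = (\<Sum>i<n. e i * (?a (z \<tau>) * X' i \<tau>)) + (\<Sum>i<n. e i * (- (?a (z \<tau>) * \<kappa>) * z' \<tau> * X i \<tau>))"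
      unfolding H'_def \<kappa>_def[symmetric] distrib_left sum.distrib ..
    then show ?thesis using first second by simp
  qed
  obtain \<xi> where "H 1 - H 0 = (1 - 0) * H' \<xi>"
    using MVT2[of 0 1 H H'] Hd by auto
  moreover have "?E\<^sup>2 = (\<Sum>i<n. (e i)\<^sup>2)" by (simp add: L2_set_def sum_nonneg)
  ultimately have "?E\<^sup>2 \<le> (18 * ?D) * ?E"
    using H01 Hb[of \<xi>] by (simp add: mult.commute mult.left_commute)
  then have "?E \<le> 18 * ?D"
    by (cases "?E = 0") (auto simp: power2_eq_square L2_set_nonneg less_le)
  then show ?thesis unfolding e_def[abs_def] \<delta>_def[abs_def] .
qed

end

section \<open>Dilations and polar integration in \<open>n\<close>-space\<close>

interpretation lborel_prod: product_sigma_finite "\<lambda>_::nat. lborel :: real measure"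
  by unfold_locales

lemma space_lborel_n: "space (lborel_n n) = {..<n} \<rightarrow>\<^sub>E UNIV"
  by (simp add: lborel_n_def space_PiM)

lemma sigma_finite_lborel_n: "sigma_finite_measure (lborel_n n)"
  unfolding lborel_n_def by (rule lborel_prod.sigma_finite) simp

lemma measurable_component_lborel_n: "i < n \<Longrightarrow> (\<lambda>x. x i) \<in> borel_measurable (lborel_n n)"
  unfolding lborel_n_def using measurable_component_singleton[of i "{..<n}" "\<lambda>_. lborel :: real measure"] by simp

lemma measurable_restrict_lborel_n:
  assumes "\<And>i. i < n \<Longrightarrow> (\<lambda>w. f w i) \<in> borel_measurable M"
  shows "(\<lambda>w. \<lambda>i\<in>{..<n}. f w i) \<in> measurable M (lborel_n n)"
  unfolding lborel_n_def using assms by (intro measurable_restrict) auto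

definition dilate :: "nat \<Rightarrow> real \<Rightarrow> (nat \<Rightarrow> real) \<Rightarrow> nat \<Rightarrow> real" where
  "dilate n c x = (\<lambda>i\<in>{..<n}. c * x i)"

lemma dilate_measurable [measurable]:
  assumes f: "f \<in> borel_measurable M" and g: "g \<in> measurable M (lborel_n n)"
  shows "(\<lambda>w. dilate n (f w) (g w)) \<in> measurable M (lborel_n n)"
  unfolding dilate_def
proof (rule measurable_restrict_lborel_n)
  fix i assume "i < n"
  from measurable_compose[OF g measurable_component_lborel_n[OF this]] f
  show "(\<lambda>w. f w * g w i) \<in> borel_measurable M" by (rule borel_measurable_times[rotated])
qed

lemma dilate_in_space: "dilate n c x \<in> space (lborel_n n)"
  by (simp add: dilate_def space_lborel_n)

lemma dilate_dilate: "dilate n c (dilate n d x) = dilate n (c * d) x"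
  by (auto simp: dilate_def fun_eq_iff)

lemma dilate_1: "x \<in> space (lborel_n n) \<Longrightarrow> dilate n 1 x = x"
  by (auto simp: dilate_def space_lborel_n PiE_iff extensional_def fun_eq_iff)

lemma lborel_n_dilate:
  assumes c: "0 < c"
  shows "lborel_n n = density (distr (lborel_n n) (lborel_n n) (dilate n c)) (\<lambda>_. ennreal (c ^ n))"
proof -
  have "density (distr (lborel_n n) (lborel_n n) (dilate n c)) (\<lambda>_. ennreal (c ^ n)) = Pi\<^sub>M {..<n} (\<lambda>_. lborel)"
  proof (rule lborel_prod.PiM_eqI)
    show "sets (density (distr (lborel_n n) (lborel_n n) (dilate n c)) (\<lambda>_. ennreal (c ^ n))) = sets (Pi\<^sub>M {..<n} (\<lambda>_. lborel))"
      by (simp add: lborel_n_def)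
    fix A :: "nat \<Rightarrow> real set" assume A: "\<And>i. i \<in> {..<n} \<Longrightarrow> A i \<in> sets lborel"
    have cA: "(\<lambda>x. c * x) -` A i \<in> sets borel" if "i < n" for i
      using A[of i] that measurable_sets_borel[of "\<lambda>x. c * x" borel "A i"] by simp
    have PA: "Pi\<^sub>E {..<n} A \<in> sets (lborel_n n)"
      unfolding lborel_n_def using A by (intro sets_PiM_I_finite) auto
    have [measurable]: "dilate n c \<in> measurable (lborel_n n) (lborel_n n)"
      using dilate_measurable[of "\<lambda>_. c" "lborel_n n" "\<lambda>x. x" n] by simp
    have pre: "dilate n c -` Pi\<^sub>E {..<n} A \<inter> space (lborel_n n) = Pi\<^sub>E {..<n} (\<lambda>i. (\<lambda>x. c * x) -` A i)"
      by (auto simp: dilate_def space_lborel_n PiE_iff)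
    have "emeasure (density (distr (lborel_n n) (lborel_n n) (dilate n c)) (\<lambda>_. ennreal (c ^ n))) (Pi\<^sub>E {..<n} A)
        = ennreal (c ^ n) * emeasure (lborel_n n) (Pi\<^sub>E {..<n} (\<lambda>i. (\<lambda>x. c * x) -` A i))"
      using PA by (subst emeasure_density_const) (auto simp: emeasure_distr pre)
    also have "emeasure (lborel_n n) (Pi\<^sub>E {..<n} (\<lambda>i. (\<lambda>x. c * x) -` A i)) = (\<Prod>i<n. emeasure lborel ((\<lambda>x. c * x) -` A i))"
      unfolding lborel_n_def using cA by (intro lborel_prod.emeasure_PiM) auto
    also have "ennreal (c ^ n) * \<dots> = (\<Prod>i<n. ennreal c * emeasure lborel ((\<lambda>x. c * x) -` A i))"
      using c by (simp add: prod.distrib ennreal_power)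
    also have "\<dots> = (\<Prod>i<n. emeasure lborel (A i))"
    proof (rule prod.cong[OF refl])
      fix i assume "i \<in> {..<n}"
      then have Ai: "A i \<in> sets borel" using A by simp
      have "emeasure lborel (A i) = emeasure (density (distr lborel borel (\<lambda>x. 0 + c * x)) (\<lambda>_. ennreal \<bar>c\<bar>)) (A i)"
        using lborel_real_affine[of c 0] c by simp
      also have "\<dots> = ennreal c * emeasure lborel ((\<lambda>x. c * x) -` A i)"
        using Ai c by (subst emeasure_density_const) (auto simp: emeasure_distr)
      finally show "ennreal c * emeasure lborel ((\<lambda>x. c * x) -` A i) = emeasure lborel (A i)" by simp
    qed
    finally show "emeasure (density (distr (lborel_n n) (lborel_n n) (dilate n c)) (\<lambda>_. ennreal (c ^ n))) (Pi\<^sub>E {..<n} A)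
        = (\<Prod>i\<in>{..<n}. emeasure lborel (A i))" .
  qed simp
  then show ?thesis by (simp add: lborel_n_def)
qed

lemma nn_integral_dilate:
  assumes [measurable]: "f \<in> borel_measurable (lborel_n n)" and c: "0 < c"
  shows "(\<integral>\<^sup>+x. f x \<partial>lborel_n n) = ennreal (c ^ n) * (\<integral>\<^sup>+x. f (dilate n c x) \<partial>lborel_n n)"
proof -
  have [measurable]: "dilate n c \<in> measurable (lborel_n n) (lborel_n n)"
    using dilate_measurable[of "\<lambda>_. c" "lborel_n n" "\<lambda>x. x" n] by simp
  show ?thesis
    by (subst lborel_n_dilate[OF c]) (simp add: nn_integral_density nn_integral_distr nn_integral_cmult)
qed

definition powr_sum :: "real \<Rightarrow> nat \<Rightarrow> (nat \<Rightarrow> real) \<Rightarrow> real" where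
  "powr_sum p n x = (\<Sum>i<n. \<bar>x i\<bar> powr p)"

lemma lp_norm_eq: "lp_norm p n x = powr_sum p n x powr (1 / p)"
  by (simp add: lp_norm_def powr_sum_def)

lemma powr_sum_nonneg: "0 \<le> powr_sum p n x"
  by (auto simp: powr_sum_def intro!: sum_nonneg)

lemma powr_sum_measurable [measurable]: "powr_sum p n \<in> borel_measurable (lborel_n n)"
  unfolding powr_sum_def[abs_def]
proof (rule borel_measurable_sum)
  fix i assume "i \<in> {..<n}"
  then have "(\<lambda>x. x i) \<in> borel_measurable (lborel_n n)" by (intro measurable_component_lborel_n) simp
  then show "(\<lambda>x. \<bar>x i\<bar> powr p) \<in> borel_measurable (lborel_n n)" by measurable
qed

lemma lp_norm_measurable [measurable]: "lp_norm p n \<in> borel_measurable (lborel_n n)"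
  unfolding lp_norm_eq[abs_def] by measurable

lemma lp_norm_nonneg: "0 \<le> lp_norm p n x"
  by (simp add: lp_norm_def)

lemma powr_sum_dilate: "0 \<le> c \<Longrightarrow> powr_sum p n (dilate n c x) = c powr p * powr_sum p n x"
  by (simp add: powr_sum_def dilate_def abs_mult powr_mult sum_distrib_left)

lemma lp_norm_dilate: "0 < p \<Longrightarrow> 0 \<le> c \<Longrightarrow> lp_norm p n (dilate n c x) = c * lp_norm p n x"
  by (simp add: lp_norm_eq powr_sum_dilate powr_mult powr_powr powr_sum_nonneg)

lemma powr_sum_eq_lp_norm: "0 < p \<Longrightarrow> powr_sum p n x = lp_norm p n x powr p"
  by (simp add: lp_norm_eq powr_powr powr_sum_nonneg)

lemma AE_lborel_n_component_nonzero:
  assumes "1 \<le> n" shows "AE x in lborel_n n. x 0 \<noteq> 0"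
proof -
  have "emeasure (lborel_n n) (Pi\<^sub>E {..<n} (\<lambda>i. if i = 0 then {0} else UNIV)) = (\<Prod>i<n. emeasure lborel (if i = 0 then {0::real} else UNIV))"
    unfolding lborel_n_def by (intro lborel_prod.emeasure_PiM) auto
  also have "\<dots> = 0" using assms by (intro prod_zero) (auto intro!: bexI[of _ 0])
  finally have "Pi\<^sub>E {..<n} (\<lambda>i. if i = 0 then {0} else UNIV) \<in> null_sets (lborel_n n)"
    unfolding null_sets_def lborel_n_def by (auto intro!: sets_PiM_I_finite)
  then show ?thesis
    by (rule AE_I') (use assms in \<open>auto simp: space_lborel_n PiE_iff extensional_def\<close>)
qed

lemma lp_norm_pos: "i < n \<Longrightarrow> x i \<noteq> 0 \<Longrightarrow> 0 < lp_norm p n x"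
proof -
  assume i: "i < n" "x i \<noteq> 0"
  have "\<bar>x i\<bar> powr p \<le> powr_sum p n x"
    unfolding powr_sum_def using i by (intro member_le_sum) auto
  moreover have "0 < \<bar>x i\<bar> powr p" using i by simp
  ultimately have "0 < powr_sum p n x" by linarith
  then show "0 < lp_norm p n x" by (simp add: lp_norm_eq)
qed

text \<open>
  Polar coordinates without surface measure: the measure of \<open>{0<..N}\<close> is \<open>N\<close> for the norm \<open>N\<close> of \<open>x\<close>,
  which allows to insert an integral over \<open>0 < r \<le> N\<close>; after exchanging the integrals \<open>x\<close> is rescaled by
  \<open>r\<close>. The outer integral only serves to average over the rays.
\<close>

lemma lborel_n_polar:
  assumes f[measurable]: "f \<in> borel_measurable (lborel_n n)" and n: "1 \<le> n" and p: "0 < p"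
  shows "(\<integral>\<^sup>+x. f x \<partial>lborel_n n) =
    (\<integral>\<^sup>+x. indicator {x. 1 \<le> lp_norm p n x} x * ennreal (1 / lp_norm p n x) *
       (\<integral>\<^sup>+r. indicator {0<..} r * ennreal (r ^ (n - 1)) * f (dilate n r x) \<partial>lborel) \<partial>lborel_n n)"
proof -
  interpret L: sigma_finite_measure "lborel_n n" by (rule sigma_finite_lborel_n)
  interpret P: pair_sigma_finite "lborel :: real measure" "lborel_n n" ..
  let ?N = "lp_norm p n"
  let ?w = "\<lambda>r x. indicator {0<..} r * indicator {..?N x} r * (ennreal (1 / ?N x) * f x)"
    and ?w' = "\<lambda>r x. indicator {0<..} r * (indicator {x. 1 \<le> ?N x} x * ennreal (1 / ?N x) *
      (ennreal (r ^ (n - 1)) * f (dilate n r x)))"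
  have "(\<integral>\<^sup>+x. f x \<partial>lborel_n n) =
      (\<integral>\<^sup>+x. (\<integral>\<^sup>+r. ?w r x \<partial>lborel) \<partial>lborel_n n)"
  proof (rule nn_integral_cong_AE)
    show "AE x in lborel_n n. f x =
        (\<integral>\<^sup>+r. ?w r x \<partial>lborel)"
      using AE_lborel_n_component_nonzero[OF n]
    proof eventually_elim
      case (elim x)
      then have N: "0 < ?N x" using n by (intro lp_norm_pos[of 0]) auto
      have "(\<integral>\<^sup>+r. ?w r x \<partial>lborel)
         = (\<integral>\<^sup>+r. (ennreal (1 / ?N x) * f x) * indicator {0<..?N x} r \<partial>lborel)"
        by (intro nn_integral_cong) (auto simp: indicator_def)
      also have "\<dots> = (ennreal (1 / ?N x) * f x) * ennreal (?N x)"
        using N by (subst nn_integral_cmult_indicator) auto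
      also have "\<dots> = ennreal (1 / ?N x * ?N x) * f x"
        using N by (subst ennreal_mult) (auto simp: mult_ac)
      finally show ?case using N by simp
    qed
  qed
  also have "\<dots> = (\<integral>\<^sup>+r. (\<integral>\<^sup>+x. ?w r x \<partial>lborel_n n) \<partial>lborel)"
  proof (rule P.Fubini')
    show "(\<lambda>(r, x). ?w r x) \<in> borel_measurable (lborel \<Otimes>\<^sub>M lborel_n n)"
      unfolding indicator_def atMost_iff by measurable
  qed
  also have "\<dots> = (\<integral>\<^sup>+r. (\<integral>\<^sup>+x. ?w' r x \<partial>lborel_n n) \<partial>lborel)"
  proof (rule nn_integral_cong)
    fix r :: real
    show "(\<integral>\<^sup>+x. ?w r x \<partial>lborel_n n)
      = (\<integral>\<^sup>+x. ?w' r x \<partial>lborel_n n)"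
    proof (cases "0 < r")
      case True
      have m: "(\<lambda>x. ?w r x) \<in> borel_measurable (lborel_n n)"
        unfolding indicator_def atMost_iff by measurable
      have m2: "(\<lambda>x. ?w r (dilate n r x)) \<in> borel_measurable (lborel_n n)"
        unfolding indicator_def atMost_iff by measurable
      have "(\<integral>\<^sup>+x. ?w r x \<partial>lborel_n n)
        = (\<integral>\<^sup>+x. ennreal (r ^ n) * (?w r (dilate n r x)) \<partial>lborel_n n)"
        by (subst nn_integral_dilate[OF m True], subst nn_integral_cmult[OF m2]) simp
      also have "\<dots> = (\<integral>\<^sup>+x. ?w' r x \<partial>lborel_n n)"
      proof (intro nn_integral_cong)
        fix x
        have N0: "0 \<le> ?N x" by (rule lp_norm_nonneg)
        have ind: "indicator {..?N (dilate n r x)} r = (indicator {x. 1 \<le> ?N x} x :: ennreal)"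
          using True p by (simp add: lp_norm_dilate indicator_def)
        have rn: "r ^ n = r ^ (n - 1) * r" using n by (metis mult.commute power_eq_if not_one_le_zero)
        have "ennreal (r ^ n) * ennreal (1 / ?N (dilate n r x)) = ennreal (r ^ n * (1 / ?N (dilate n r x)))"
          using True N0 p by (subst ennreal_mult) (auto simp: lp_norm_dilate)
        also have "r ^ n * (1 / ?N (dilate n r x)) = 1 / ?N x * r ^ (n - 1)"
          using True p by (simp add: lp_norm_dilate rn)
        also have "ennreal (1 / ?N x * r ^ (n - 1)) = ennreal (1 / ?N x) * ennreal (r ^ (n - 1))"
          using True N0 by (subst ennreal_mult) auto
        finally have e: "ennreal (r ^ n) * ennreal (1 / ?N (dilate n r x)) = ennreal (1 / ?N x) * ennreal (r ^ (n - 1))" .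
        have "ennreal (r ^ n) * (?w r (dilate n r x))
          = indicator {0<..} r * (indicator {x. 1 \<le> ?N x} x * (ennreal (r ^ n) * ennreal (1 / ?N (dilate n r x))) * f (dilate n r x))"
          unfolding ind by (simp add: mult_ac)
        then show "ennreal (r ^ n) * (?w r (dilate n r x))
          = ?w' r x"
          unfolding e by (simp add: mult_ac)
      qed
      finally show ?thesis .
    qed (simp add: indicator_def)
  qed
  also have "\<dots> = (\<integral>\<^sup>+x. (\<integral>\<^sup>+r. ?w' r x \<partial>lborel) \<partial>lborel_n n)"
  proof (rule P.Fubini'[symmetric])
    show "(\<lambda>(r, x). ?w' r x) \<in> borel_measurable (lborel \<Otimes>\<^sub>M lborel_n n)"
      unfolding indicator_def mem_Collect_eq by measurable
  qed
  also have "\<dots> = (\<integral>\<^sup>+x. indicator {x. 1 \<le> ?N x} x * ennreal (1 / ?N x) *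
       (\<integral>\<^sup>+r. indicator {0<..} r * ennreal (r ^ (n - 1)) * f (dilate n r x) \<partial>lborel) \<partial>lborel_n n)"
  proof (rule nn_integral_cong)
    fix x assume [measurable]: "x \<in> space (lborel_n n)"
    have m: "(\<lambda>r. indicator {0<..} r * ennreal (r ^ (n - 1)) * f (dilate n r x)) \<in> borel_measurable lborel"
    proof -
      have "(\<lambda>r. dilate n r x) \<in> measurable lborel (lborel_n n)"
        unfolding dilate_def by (intro measurable_restrict_lborel_n) simp
      from measurable_compose[OF this f] show ?thesis by simp
    qed
    show "(\<integral>\<^sup>+r. ?w' r x \<partial>lborel) = indicator {x. 1 \<le> ?N x} x * ennreal (1 / ?N x) *
       (\<integral>\<^sup>+r. indicator {0<..} r * ennreal (r ^ (n - 1)) * f (dilate n r x) \<partial>lborel)"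
      by (subst nn_integral_cmult[OF m, symmetric]) (simp add: mult_ac)
  qed
  finally show ?thesis .
qed

section \<open>The image of the Gaussian measure\<close>

lemma borel_measurable_gauss_to_lp: "2 \<le> p \<Longrightarrow> gauss_to_lp p \<in> borel_measurable borel"
  by (intro borel_measurable_continuous_onI continuous_at_imp_continuous_on ballI
      DERIV_isCont[OF gauss_to_lp_has_derivative])

lemma distr_gauss_to_lp:
  assumes p: "2 \<le> p"
  shows "distr gauss borel (gauss_to_lp p) = density lborel (lp_density p)"
proof (rule cdf_unique)
  note [measurable] = borel_measurable_gauss_to_lp[OF p]
  note \<rho> = positive_density_lp[OF p]
  show "real_distribution (distr gauss borel (gauss_to_lp p))"
    by (rule gauss.real_distribution_distr) simp
  show "real_distribution (density lborel (lp_density p))" by (rule real_distribution_density[OF \<rho>])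
  show "cdf (distr gauss borel (gauss_to_lp p)) = cdf (density lborel (lp_density p))"
  proof
    fix x
    let ?F = "dist_fun (lp_density p)"
    have "gauss_to_lp p g \<le> x \<longleftrightarrow> g \<le> Phi_inv (?F x)" for g
    proof -
      have "gauss_to_lp p g \<le> x \<longleftrightarrow> Phi g \<le> ?F x"
        using dist_fun_le_iff[OF \<rho>, of "gauss_to_lp p g" x] by (simp add: dist_fun_gauss_to_lp[OF p])
      also have "\<dots> \<longleftrightarrow> g \<le> Phi_inv (?F x)"
        using Phi_le_iff[of g "Phi_inv (?F x)"] dist_fun_bounds[OF \<rho>] by (simp add: Phi_Phi_inv)
      finally show ?thesis .
    qed
    then have "gauss_to_lp p -` {..x} \<inter> space gauss = {..Phi_inv (?F x)}" by auto
    then have "cdf (distr gauss borel (gauss_to_lp p)) x = Phi (Phi_inv (?F x))"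
      by (simp add: cdf_def2 measure_distr measure_gauss_atMost)
    then show "cdf (distr gauss borel (gauss_to_lp p)) x = cdf (density lborel (lp_density p)) x"
      using dist_fun_bounds[OF \<rho>] by (simp add: Phi_Phi_inv cdf_density[OF \<rho>])
  qed
qed

abbreviation lp_weight :: "real \<Rightarrow> nat \<Rightarrow> (nat \<Rightarrow> real) \<Rightarrow> ennreal" where
  "lp_weight p n x \<equiv> ennreal (exp (- powr_sum p n x) / exp_powr_mass p ^ n)"

lemma density_powr_sum_eq_PiM:
  assumes p: "2 \<le> p"
  shows "density (lborel_n n) (lp_weight p n)
    = Pi\<^sub>M {..<n} (\<lambda>_. density lborel (lp_density p))"
proof -
  note \<rho> = positive_density_lp[OF p]
  interpret \<nu>: real_distribution "density lborel (lp_density p)" by (rule real_distribution_density[OF \<rho>])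
  interpret \<nu>P: product_prob_space "\<lambda>_::nat. density lborel (lp_density p)" UNIV by unfold_locales
  have ld: "lp_density p \<in> borel_measurable borel" by (rule positive_density_measurable[OF \<rho>])
  have ld0: "0 \<le> lp_density p t" for t using \<rho> by (auto simp: positive_density_def less_imp_le)
  show ?thesis
  proof (rule \<nu>P.PiM_eqI)
    show "sets (density (lborel_n n) (lp_weight p n))
        = sets (Pi\<^sub>M {..<n} (\<lambda>_. density lborel (lp_density p)))"
      by (simp add: lborel_n_def cong: sets_PiM_cong)
    fix A :: "nat \<Rightarrow> real set" assume A: "\<And>i. i \<in> {..<n} \<Longrightarrow> A i \<in> sets (density lborel (lp_density p))"
    have PA: "Pi\<^sub>E {..<n} A \<in> sets (lborel_n n)"
      unfolding lborel_n_def using A by (intro sets_PiM_I_finite) auto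
    have "emeasure (density (lborel_n n) (lp_weight p n)) (Pi\<^sub>E {..<n} A)
      = (\<integral>\<^sup>+x. lp_weight p n x * indicator (Pi\<^sub>E {..<n} A) x \<partial>lborel_n n)"
      by (rule emeasure_density) (use PA in measurable)
    also have "\<dots> = (\<integral>\<^sup>+x. (\<Prod>i<n. ennreal (lp_density p (x i)) * indicator (A i) (x i)) \<partial>lborel_n n)"
    proof (rule nn_integral_cong)
      fix x assume x: "x \<in> space (lborel_n n)"
      have "exp (- powr_sum p n x) / exp_powr_mass p ^ n = (\<Prod>i<n. lp_density p (x i))"
        by (simp add: powr_sum_def lp_density_def sum_negf[symmetric] exp_sum prod_dividef)
      then have 1: "lp_weight p n x = (\<Prod>i<n. ennreal (lp_density p (x i)))"
        using ld0 by (simp add: prod_ennreal)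
      have 2: "indicator (Pi\<^sub>E {..<n} A) x = (\<Prod>i<n. indicator (A i) (x i) :: ennreal)"
      proof (cases "x \<in> Pi\<^sub>E {..<n} A")
        case True then show ?thesis by (auto simp: PiE_iff)
      next
        case False
        then obtain i where "i < n" "x i \<notin> A i" using x by (auto simp: space_lborel_n PiE_iff)
        then have "(\<Prod>i<n. indicator (A i) (x i) :: ennreal) = 0"
          by (intro prod_zero bexI[of _ i]) auto
        then show ?thesis using False by simp
      qed
      show "lp_weight p n x * indicator (Pi\<^sub>E {..<n} A) x
        = (\<Prod>i<n. ennreal (lp_density p (x i)) * indicator (A i) (x i))"
        unfolding 1 2 prod.distrib ..
    qed
    also have "\<dots> = (\<Prod>i<n. \<integral>\<^sup>+t. ennreal (lp_density p t) * indicator (A i) t \<partial>lborel)"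
      unfolding lborel_n_def
      by (rule lborel_prod.product_nn_integral_prod) (use A ld in auto)
    also have "\<dots> = (\<Prod>i<n. emeasure (density lborel (lp_density p)) (A i))"
      using A ld by (intro prod.cong refl emeasure_density[symmetric]) auto
    finally show "emeasure (density (lborel_n n) (lp_weight p n)) (Pi\<^sub>E {..<n} A)
      = (\<Prod>i\<in>{..<n}. emeasure (density lborel (lp_density p)) (A i))" .
  qed simp
qed

lemma sets_PiM_borel_eq_lborel_n: "sets (Pi\<^sub>M {..<n} (\<lambda>_. borel :: real measure)) = sets (lborel_n n)"
  unfolding lborel_n_def by (rule sets_PiM_cong) auto

lemma compose_gauss_to_lp_measurable:
  assumes p: "2 \<le> p"
  shows "compose {..<n} (gauss_to_lp p) \<in> measurable (gauss_n n) (lborel_n n)"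
  unfolding compose_def
proof (rule measurable_restrict_lborel_n)
  fix i assume "i < n"
  then have "(\<lambda>g. g i) \<in> measurable (Pi\<^sub>M {..<n} (\<lambda>_. gauss)) gauss" by (intro measurable_component_singleton) simp
  moreover have "gauss_to_lp p \<in> measurable gauss borel" using borel_measurable_gauss_to_lp[OF p] by simp
  ultimately show "(\<lambda>g. gauss_to_lp p (g i)) \<in> borel_measurable (gauss_n n)"
    unfolding gauss_n_def by (rule measurable_compose)
qed

lemma nn_integral_gauss_n_compose:
  assumes p: "2 \<le> p" and h[measurable]: "h \<in> borel_measurable (lborel_n n)"
  shows "(\<integral>\<^sup>+g. h (compose {..<n} (gauss_to_lp p) g) \<partial>gauss_n n)
    = (\<integral>\<^sup>+x. lp_weight p n x * h x \<partial>lborel_n n)"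
proof -
  let ?W = "compose {..<n} (gauss_to_lp p)"
  note \<rho> = positive_density_lp[OF p]
  interpret \<nu>: real_distribution "density lborel (lp_density p)" by (rule real_distribution_density[OF \<rho>])
  have "distr (gauss_n n) (Pi\<^sub>M {..<n} (\<lambda>_. borel)) ?W = Pi\<^sub>M {..<n} (\<lambda>_. distr gauss borel (gauss_to_lp p))"
  proof -
    have "distr (Pi\<^sub>M {..<n} (\<lambda>_. gauss)) (Pi\<^sub>M {..<n} (\<lambda>_. gauss)) ?W = Pi\<^sub>M {..<n} (\<lambda>_. distr gauss gauss (gauss_to_lp p))"
      using borel_measurable_gauss_to_lp[OF p]
      by (intro distr_PiM_finite_prob_space') (auto intro: gauss.prob_space_axioms)
    moreover have "distr gauss gauss (gauss_to_lp p) = distr gauss borel (gauss_to_lp p)"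
      by (rule distr_cong) auto
    moreover have "distr (gauss_n n) (Pi\<^sub>M {..<n} (\<lambda>_. borel)) ?W = distr (Pi\<^sub>M {..<n} (\<lambda>_. gauss)) (Pi\<^sub>M {..<n} (\<lambda>_. gauss)) ?W"
      unfolding gauss_n_def by (rule distr_cong) (auto cong: sets_PiM_cong)
    ultimately show ?thesis by simp
  qed
  also have "\<dots> = density (lborel_n n) (lp_weight p n)"
    by (simp add: distr_gauss_to_lp[OF p] density_powr_sum_eq_PiM[OF p])
  finally have d: "distr (gauss_n n) (Pi\<^sub>M {..<n} (\<lambda>_. borel)) ?W
      = density (lborel_n n) (lp_weight p n)" .
  note s = sets_PiM_borel_eq_lborel_n[of n]
  have W: "?W \<in> measurable (gauss_n n) (Pi\<^sub>M {..<n} (\<lambda>_. borel))"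
    using compose_gauss_to_lp_measurable[OF p, of n] measurable_cong_sets[OF refl s] by blast
  have h': "h \<in> borel_measurable (Pi\<^sub>M {..<n} (\<lambda>_. borel))"
    using h measurable_cong_sets[OF s refl] by blast
  have "(\<integral>\<^sup>+g. h (?W g) \<partial>gauss_n n) = (\<integral>\<^sup>+x. h x \<partial>distr (gauss_n n) (Pi\<^sub>M {..<n} (\<lambda>_. borel)) ?W)"
    using W h' by (simp add: nn_integral_distr)
  also have "\<dots> = (\<integral>\<^sup>+x. lp_weight p n x * h x \<partial>lborel_n n)"
    unfolding d by (rule nn_integral_density) measurable
  finally show ?thesis .
qed

context
  fixes p :: real and n :: nat
  assumes p: "2 \<le> p" and n: "1 \<le> n"
begin

abbreviation "radius_fun s \<equiv> radial_factor p n (s powr p) * s"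

text \<open>
  The points with norm below the supremum of the new radii. Once its volume is known to be 1, this is
  the normalised ball up to a null set (\<open>lp_radius_range_ball\<close>).
\<close>

definition range_ball :: "(nat \<Rightarrow> real) set" where
  "range_ball = {x \<in> space (lborel_n n). \<exists>s\<ge>0. lp_norm p n x \<le> radius_fun s}"

text \<open>
  On a ray whose unit point has norm \<open>\<omega>\<close>, the new parameter \<open>k u\<close> satisfies
  \<open>k u ^ (n - 1) * k' u = u ^ (n - 1) * exp (- ((\<omega> * u) powr p)) / exp_powr_mass p ^ n\<close>, which expresses conservation
  of mass; by \<open>radial_mass_by_parts\<close> the formula is this equation solved for \<open>k'\<close>. The absolute value
  makes \<open>k\<close> differentiable on both sides of 0.
\<close>

lemma radial_map_has_derivative:
  assumes \<omega>: "0 < \<omega>" and u: "0 \<le> u"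
  shows "((\<lambda>u. radial_factor p n ((\<omega> * \<bar>u\<bar>) powr p) * u) has_real_derivative
    exp (- ((\<omega> * u) powr p)) / (exp_powr_mass p ^ n * radial_factor p n ((\<omega> * u) powr p) ^ (n - 1))) (at u)"
proof -
  let ?Z = "exp_powr_mass p"
  define z where "z = (\<omega> * u) powr p"
  define a where "a = radial_factor p n z"
  define \<kappa> where "\<kappa> = log_slope p n z"
  have z0: "0 \<le> z" by (simp add: z_def)
  have zu: "(\<omega> * \<bar>u\<bar>) powr p = z" using u by (simp add: z_def)
  have J: "0 < radial_mass p n z" using radial_mass_bounds[OF p n z0] by simp
  have Z: "0 < ?Z" using exp_powr_mass_bounds[OF p] by linarith
  have a0: "0 < a" using radial_factor_bounds[OF p n z0] by (simp add: a_def)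
  have aZ: "(a * ?Z) ^ n = radial_mass p n z"
    using Z J n by (simp add: a_def radial_factor_def powr_realpow[symmetric] powr_powr)
  have "((\<lambda>u. (\<omega> * \<bar>u\<bar>) powr p) has_real_derivative \<omega> powr p * (p * \<bar>u\<bar> powr (p - 1) * sgn u)) (at u)"
  proof -
    have eq: "(\<lambda>u. (\<omega> * \<bar>u\<bar>) powr p) = (\<lambda>u. \<omega> powr p * \<bar>u\<bar> powr p)"
      using \<omega> by (simp add: powr_mult)
    show ?thesis unfolding eq by (intro DERIV_cmult abs_powr_has_derivative p)
  qed
  from DERIV_chain2[OF radial_factor_has_derivative[OF p n z0, folded zu] this]
  have "((\<lambda>u. radial_factor p n ((\<omega> * \<bar>u\<bar>) powr p)) has_real_derivative
      - (a * \<kappa>) * (\<omega> powr p * (p * \<bar>u\<bar> powr (p - 1) * sgn u))) (at u)"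
    by (simp add: zu a_def \<kappa>_def)
  from DERIV_mult[OF this DERIV_ident]
  have "((\<lambda>u. radial_factor p n ((\<omega> * \<bar>u\<bar>) powr p) * u) has_real_derivative
      - (a * \<kappa>) * (\<omega> powr p * (p * \<bar>u\<bar> powr (p - 1) * sgn u)) * u + a) (at u)"
    by (simp add: zu a_def)
  moreover have "- (a * \<kappa>) * (\<omega> powr p * (p * \<bar>u\<bar> powr (p - 1) * sgn u)) * u + a
      = exp (- z) / (?Z ^ n * a ^ (n - 1))"
  proof -
    have "\<omega> powr p * (\<bar>u\<bar> powr (p - 1) * sgn u * u) = z"
    proof (cases "u = 0")
      case True then show ?thesis by (simp add: z_def)
    next
      case False
      then have "u powr (p - 1) * u = u powr p" using u powr_add[of u "p - 1" 1] by simp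
      then show ?thesis using False u \<omega> by (simp add: z_def powr_mult)
    qed
    then have "- (a * \<kappa>) * (\<omega> powr p * (p * \<bar>u\<bar> powr (p - 1) * sgn u)) * u + a = a * (1 - p * z * \<kappa>)"
      by (simp add: algebra_simps)
    also have "1 - p * z * \<kappa> = exp (- z) / radial_mass p n z"
    proof -
      have "1 - p * z * \<kappa> = (radial_mass p n z - p * z / real n * radial_mass_deriv p n z) / radial_mass p n z"
        using J n by (simp add: \<kappa>_def log_slope_def[OF p n] diff_divide_distrib)
      then show ?thesis using radial_mass_by_parts[OF p n, of z] by simp
    qed
    also have "a * (exp (- z) / radial_mass p n z) = exp (- z) / (?Z ^ n * a ^ (n - 1))"
    proof -
      have "a ^ n = a ^ (n - 1) * a" using n by (metis mult.commute power_eq_if not_one_le_zero)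
      then have "radial_mass p n z = a * (?Z ^ n * a ^ (n - 1))"
        using aZ by (simp add: power_mult_distrib mult_ac)
      then show ?thesis using a0 by simp
    qed
    finally show ?thesis .
  qed
  ultimately show ?thesis by (simp add: z_def[symmetric] a_def[symmetric])
qed

lemma radial_map_deriv_pos:
  "0 < exp (- ((\<omega> * u) powr p)) / (exp_powr_mass p ^ n * radial_factor p n ((\<omega> * u) powr p) ^ (n - 1))"
  using radial_factor_bounds[OF p n, of "(\<omega> * u) powr p"] exp_powr_mass_bounds[OF p]
  by (intro divide_pos_pos mult_pos_pos zero_less_power) auto

lemma radial_map_strict_mono:
  assumes "0 < \<omega>" "0 \<le> u" "u < v"
  shows "radial_factor p n ((\<omega> * u) powr p) * u < radial_factor p n ((\<omega> * v) powr p) * v"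
proof -
  have "radial_factor p n ((\<omega> * \<bar>u\<bar>) powr p) * u < radial_factor p n ((\<omega> * \<bar>v\<bar>) powr p) * v"
  proof (rule DERIV_pos_imp_increasing[OF assms(3)])
    fix x assume "u \<le> x" "x \<le> v"
    then have "0 \<le> x" using assms by simp
    from radial_map_has_derivative[OF assms(1) this] radial_map_deriv_pos
    show "\<exists>y. ((\<lambda>u. radial_factor p n ((\<omega> * \<bar>u\<bar>) powr p) * u) has_real_derivative y) (at x) \<and> 0 < y"
      by blast
  qed
  then show ?thesis using assms by simp
qed

lemma radius_fun_strict_mono: "0 \<le> s \<Longrightarrow> s < t \<Longrightarrow> radius_fun s < radius_fun t"
  using radial_map_strict_mono[of 1 s t] by simp

lemma radius_fun_mono: "0 \<le> s \<Longrightarrow> s \<le> t \<Longrightarrow> radius_fun s \<le> radius_fun t"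
  using radius_fun_strict_mono[of s t] by (cases "s = t") auto

lemma range_ball_measurable [measurable]: "range_ball \<in> sets (lborel_n n)"
proof -
  have "range_ball = (\<Union>M::nat. {x \<in> space (lborel_n n). lp_norm p n x \<le> radius_fun (real M)})"
  proof (intro set_eqI iffI)
    fix x assume "x \<in> range_ball"
    then obtain s where s: "x \<in> space (lborel_n n)" "0 \<le> s" "lp_norm p n x \<le> radius_fun s"
      by (auto simp: range_ball_def)
    obtain M :: nat where "s \<le> real M" using real_arch_simple by blast
    then have "lp_norm p n x \<le> radius_fun (real M)" using s radius_fun_mono[of s "real M"] by simp
    then show "x \<in> (\<Union>M::nat. {x \<in> space (lborel_n n). lp_norm p n x \<le> radius_fun (real M)})" using s by blast
  next
    fix x assume "x \<in> (\<Union>M::nat. {x \<in> space (lborel_n n). lp_norm p n x \<le> radius_fun (real M)})"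
    then obtain M :: nat where "x \<in> space (lborel_n n)" "lp_norm p n x \<le> radius_fun (real M)" by blast
    then show "x \<in> range_ball" unfolding range_ball_def by (auto intro!: exI[of _ "real M"])
  qed
  also have "\<dots> \<in> sets (lborel_n n)" by measurable
  finally show ?thesis .
qed

text \<open>
  The substitution \<open>v = k u\<close> on the ray through \<open>x\<close> turns the density into 1. It is carried out on
  \<open>0 \<le> u \<le> M\<close> for each natural number \<open>M\<close>, and both sides are exhausted by monotone convergence.
\<close>

lemma radial_substitution:
  assumes A: "A \<in> sets (lborel_n n)" and \<omega>: "0 < lp_norm p n x"
  shows "(\<integral>\<^sup>+r. indicator {0<..} r * ennreal (r ^ (n - 1)) *
      (lp_weight p n (dilate n r x) *
        indicator A (dilate n (radial_factor p n (powr_sum p n (dilate n r x))) (dilate n r x))) \<partial>lborel)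
    = (\<integral>\<^sup>+r. indicator {0<..} r * ennreal (r ^ (n - 1)) * indicator (A \<inter> range_ball) (dilate n r x) \<partial>lborel)"
    (is "?L = ?R")
proof -
  define \<omega> where "\<omega> = lp_norm p n x"
  have \<omega>0: "0 < \<omega>" using assms by (simp add: \<omega>_def)
  let ?Z = "exp_powr_mass p"
  define a where "a u = radial_factor p n ((\<omega> * u) powr p)" for u
  define k where "k u = radial_factor p n ((\<omega> * \<bar>u\<bar>) powr p) * u" for u
  define k' where "k' u = exp (- ((\<omega> * u) powr p)) / (?Z ^ n * a u ^ (n - 1))" for u
  define f where "f r = r ^ (n - 1) * indicat_real A (dilate n r x)" for r
  let ?G = "\<lambda>M u. ennreal (f (k u) * k' u * indicator {0..real M} u)"
    and ?H = "\<lambda>M v. ennreal (f v * indicator {k 0..k (real M)} v)"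
  have ka: "k u = a u * u" if "0 \<le> u" for u using that by (simp add: k_def a_def)
  have a0: "0 < a u" for u using radial_factor_bounds[OF p n, of "(\<omega> * u) powr p"] by (simp add: a_def)
  have Z: "0 < ?Z" using exp_powr_mass_bounds[OF p] by linarith
  have k'0: "0 < k' u" for u unfolding k'_def a_def by (rule radial_map_deriv_pos)
  have "(\<lambda>r. dilate n r x) \<in> measurable borel (lborel_n n)"
    unfolding dilate_def by (intro measurable_restrict_lborel_n) simp
  from measurable_compose[OF this borel_measurable_indicator[OF A]]
  have [measurable]: "(\<lambda>r. indicat_real A (dilate n r x)) \<in> borel_measurable borel" .
  have [measurable]: "f \<in> borel_measurable borel" unfolding f_def[abs_def] by measurable
  have ksm: "k u < k v" if "0 \<le> u" "u < v" for u v
    using radial_map_strict_mono[OF \<omega>0 that] that by (simp add: k_def)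
  have km: "k u \<le> k v" if "0 \<le> u" "u \<le> v" for u v
    using ksm[of u v] that by (cases "u = v") auto
  have k00: "k 0 = 0" by (simp add: k_def)
  have ac: "continuous_on {0..} a"
  proof -
    have "continuous_on {0..} (radial_factor p n)"
      using radial_factor_has_derivative[OF p n] DERIV_isCont
      by (intro continuous_at_imp_continuous_on) auto
    moreover have "continuous_on {0..} (\<lambda>u. (\<omega> * u) powr p)"
      using p \<omega>0 by (intro continuous_on_powr' continuous_on_mult continuous_on_const continuous_on_id) auto
    ultimately show ?thesis unfolding a_def
      by (rule continuous_on_compose2) auto
  qed
  have k'c: "continuous_on {0..} k'"
  proof -
    have "continuous_on {0..} (\<lambda>u. (\<omega> * u) powr p)"
      using p \<omega>0 by (intro continuous_on_powr' continuous_on_mult continuous_on_const continuous_on_id) auto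
    moreover have "?Z ^ n * a u ^ (n - 1) \<noteq> 0" for u using Z a0[of u] by simp
    ultimately show ?thesis
      unfolding k'_def using ac
      by (intro continuous_on_divide continuous_on_exp continuous_on_minus continuous_on_mult continuous_on_power
          continuous_on_const) auto
  qed
  have [measurable]: "(\<lambda>u. k' u * indicator {0..real M} u) \<in> borel_measurable borel" for M
    using borel_measurable_continuous_on_indicator[of "{0..real M}" k'] continuous_on_subset[OF k'c, of "{0..real M}"]
    by (simp add: mult.commute)
  have sub: "(\<integral>\<^sup>+v. ?H M v \<partial>lborel)
      = (\<integral>\<^sup>+u. ?G M u \<partial>lborel)" for M :: nat
  proof (rule nn_integral_substitution)
    show "set_borel_measurable borel {k 0..k (real M)} f" unfolding set_borel_measurable_def by measurable
    show "(k has_real_derivative k' u) (at u)" if "u \<in> {0..real M}" for u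
      using radial_map_has_derivative[OF \<omega>0, of u] that by (simp add: k_def[abs_def] k'_def a_def)
    show "continuous_on {0..real M} k'" using k'c by (rule continuous_on_subset) auto
  qed (use k'0 in \<open>auto intro: less_imp_le\<close>)
  have fk: "f (k u) * k' u = u ^ (n - 1) * (exp (- ((\<omega> * u) powr p)) / ?Z ^ n) * indicator A (dilate n (k u) x)"
    if "0 \<le> u" for u
    using that a0[of u] by (simp add: f_def ka k'_def power_mult_distrib)
  have S: "powr_sum p n (dilate n u x) = (\<omega> * u) powr p" if "0 \<le> u" for u
    using that p \<omega>0 lp_norm_dilate[of p u n x] powr_sum_eq_lp_norm[of p n "dilate n u x"]
    by (simp add: \<omega>_def mult.commute)
  have in_ball: "dilate n v x \<in> range_ball \<longleftrightarrow> (\<exists>M::nat. v \<le> k (real M))" if "0 \<le> v" for v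
  proof -
    have "dilate n v x \<in> range_ball \<longleftrightarrow> (\<exists>s\<ge>0. \<omega> * v \<le> radius_fun s)"
      using that p by (simp add: range_ball_def dilate_in_space lp_norm_dilate \<omega>_def mult.commute)
    also have "\<dots> \<longleftrightarrow> (\<exists>M::nat. \<omega> * v \<le> radius_fun (\<omega> * real M))"
    proof safe
      fix s assume s: "0 \<le> s" "\<omega> * v \<le> radius_fun s"
      obtain M :: nat where "s / \<omega> \<le> real M" using real_arch_simple by blast
      then have "s \<le> \<omega> * real M" using \<omega>0 by (simp add: field_simps)
      from radius_fun_mono[OF s(1) this] s show "\<exists>M::nat. \<omega> * v \<le> radius_fun (\<omega> * real M)"
        by (intro exI[of _ M]) simp
    next
      fix M :: nat assume "\<omega> * v \<le> radius_fun (\<omega> * real M)"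
      then show "\<exists>s\<ge>0. \<omega> * v \<le> radius_fun s" using \<omega>0 by (intro exI[of _ "\<omega> * real M"]) simp
    qed
    also have "\<dots> \<longleftrightarrow> (\<exists>M::nat. \<omega> * v \<le> \<omega> * k (real M))" by (simp add: k_def mult_ac)
    finally show ?thesis using \<omega>0 by simp
  qed
  have "?L = (\<integral>\<^sup>+u. (SUP M::nat. ?G M u) \<partial>lborel)"
  proof (rule nn_integral_cong_AE)
    show "AE u in lborel. indicator {0<..} u * ennreal (u ^ (n - 1)) *
      (lp_weight p n (dilate n u x) *
        indicator A (dilate n (radial_factor p n (powr_sum p n (dilate n u x))) (dilate n u x)))
      = (SUP M::nat. ?G M u)"
      using AE_lborel_singleton[of "0 :: real"]
    proof eventually_elim
      case (elim u)
      show ?case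
      proof (cases "0 < u")
        case True
        have "(SUP M::nat. ?G M u) = ennreal (f (k u) * k' u)"
        proof (rule antisym)
          have fk0: "0 \<le> f (k u) * k' u" using True k'0[of u] km[of 0 u] k00 by (simp add: f_def)
          then show "(SUP M::nat. ?G M u) \<le> ennreal (f (k u) * k' u)"
            by (intro SUP_least ennreal_leI) (auto simp: indicator_def)
          obtain M :: nat where "u \<le> real M" using real_arch_simple by blast
          then show "ennreal (f (k u) * k' u) \<le> (SUP M::nat. ?G M u)"
            using True by (intro SUP_upper2[of M]) auto
        qed
        also have "ennreal (f (k u) * k' u)
            = ennreal (u ^ (n - 1)) * (ennreal (exp (- ((\<omega> * u) powr p)) / ?Z ^ n) * indicator A (dilate n (k u) x))"
          unfolding fk[OF less_imp_le[OF True]] using True Z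
          by (simp add: ennreal_mult'[symmetric] ennreal_indicator[symmetric] mult.assoc del: ennreal_indicator)
        also have "\<dots> = indicator {0<..} u * ennreal (u ^ (n - 1)) *
          (lp_weight p n (dilate n u x) *
            indicator A (dilate n (radial_factor p n (powr_sum p n (dilate n u x))) (dilate n u x)))"
          using True by (simp add: S dilate_dilate ka a_def)
        finally show ?thesis by (rule sym)
      next
        case False
        then have "u < 0" using elim by simp
        then show ?thesis by (simp add: indicator_def)
      qed
    qed
  qed
  also have "\<dots> = (SUP M::nat. \<integral>\<^sup>+u. ?G M u \<partial>lborel)"
  proof (rule nn_integral_monotone_convergence_SUP)
    show "incseq (\<lambda>M u. ?G M u)"
    proof (intro incseq_SucI le_funI)
      fix M u
      have "0 \<le> f (k u) * k' u" if "0 \<le> u" using that k'0[of u] km[of 0 u] k00 by (simp add: f_def)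
      then show "?G M u \<le> ?G (Suc M) u"
        by (intro ennreal_leI) (auto simp: indicator_def)
    qed
    fix M :: nat
    have "(\<lambda>u. indicator {0..real M} u * k u) \<in> borel_measurable borel"
      using borel_measurable_continuous_on_indicator[of "{0..real M}" k] radial_map_has_derivative[OF \<omega>0] DERIV_isCont
      by (fastforce simp: k_def[abs_def] intro!: continuous_at_imp_continuous_on)
    then have "(\<lambda>u. f (indicator {0..real M} u * k u) * (k' u * indicator {0..real M} u)) \<in> borel_measurable borel"
      by measurable
    moreover have "(\<lambda>u. f (indicator {0..real M} u * k u) * (k' u * indicator {0..real M} u))
        = (\<lambda>u. f (k u) * k' u * indicator {0..real M} u)"
      by (auto simp: fun_eq_iff indicator_def)
    ultimately show "(\<lambda>u. ?G M u) \<in> borel_measurable lborel"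
      by simp
  qed
  also have "\<dots> = (SUP M::nat. \<integral>\<^sup>+v. ?H M v \<partial>lborel)"
    by (simp only: sub)
  also have "\<dots> = (\<integral>\<^sup>+v. (SUP M::nat. ?H M v) \<partial>lborel)"
  proof (rule nn_integral_monotone_convergence_SUP[symmetric])
    show "incseq (\<lambda>M v. ?H M v)"
    proof (intro incseq_SucI le_funI)
      fix M v
      have "k (real M) \<le> k (real (Suc M))" by (intro km) auto
      moreover have "0 \<le> f v" if "0 \<le> v" using that by (simp add: f_def)
      ultimately show "?H M v \<le> ?H (Suc M) v"
        using k00 by (intro ennreal_leI) (auto simp: indicator_def)
    qed
  qed measurable
  also have "\<dots> = ?R"
  proof (rule nn_integral_cong_AE)
    show "AE v in lborel. (SUP M::nat. ?H M v)
      = indicator {0<..} v * ennreal (v ^ (n - 1)) * indicator (A \<inter> range_ball) (dilate n v x)"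
      using AE_lborel_singleton[of "0 :: real"]
    proof eventually_elim
      case (elim v)
      show ?case
      proof (cases "0 < v \<and> (\<exists>M::nat. v \<le> k (real M))")
        case True
        then obtain M :: nat where M: "v \<le> k (real M)" by blast
        have f0: "0 \<le> f v" using True by (simp add: f_def)
        have "(SUP M::nat. ?H M v) = ennreal (f v)"
        proof (rule antisym)
          show "(SUP M::nat. ?H M v) \<le> ennreal (f v)"
            using f0 by (intro SUP_least ennreal_leI) (auto simp: indicator_def)
          show "ennreal (f v) \<le> (SUP M::nat. ?H M v)"
            using True M k00 by (intro SUP_upper2[of M]) auto
        qed
        also have "ennreal (f v) = ennreal (v ^ (n - 1)) * indicator A (dilate n v x)"
          using True by (simp add: f_def indicator_def)
        finally show ?thesis using True in_ball[of v] by (simp add: indicator_def)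
      next
        case False
        then have "?H M v = 0" for M :: nat
          using elim k00 by (auto simp: indicator_def)
        then show ?thesis using False elim in_ball[of v] by (auto simp: indicator_def)
      qed
    qed
  qed
  finally show ?thesis .
qed

end

lemma gauss_to_ball_eq_dilate:
  assumes "2 \<le> p" "1 \<le> n"
  shows "gauss_to_ball p n g = (let x = compose {..<n} (gauss_to_lp p) g in dilate n (radial_factor p n (powr_sum p n x)) x)"
  by (auto simp: gauss_to_ball_def[OF assms] dilate_def powr_sum_def compose_def Let_def fun_eq_iff)

lemma dilate_radial_factor_measurable:
  assumes p: "2 \<le> p" and n: "1 \<le> n"
  shows "(\<lambda>x. dilate n (radial_factor p n (powr_sum p n x)) x) \<in> measurable (lborel_n n) (lborel_n n)"
proof (rule dilate_measurable)
  have "continuous_on {0..} (radial_factor p n)"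
    using radial_factor_has_derivative[OF p n] DERIV_isCont
    by (intro continuous_at_imp_continuous_on) auto
  then have "(\<lambda>z. indicator {0..} z * radial_factor p n z) \<in> borel_measurable borel"
    using borel_measurable_continuous_on_indicator[of "{0..}" "radial_factor p n"] by simp
  from measurable_compose[OF powr_sum_measurable this, of p n]
  show "(\<lambda>x. radial_factor p n (powr_sum p n x)) \<in> borel_measurable (lborel_n n)"
    by (simp add: powr_sum_nonneg)
qed simp

lemma gauss_to_ball_measurable:
  assumes "2 \<le> p" "1 \<le> n"
  shows "gauss_to_ball p n \<in> measurable (gauss_n n) (lborel_n n)"
  using measurable_compose[OF compose_gauss_to_lp_measurable[OF assms(1)] dilate_radial_factor_measurable[OF assms]]
  by (simp add: gauss_to_ball_eq_dilate[OF assms] Let_def cong: measurable_cong)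

text \<open>
  Both sides are written in polar form, where they agree on every ray by \<open>radial_substitution\<close>.
\<close>

theorem emeasure_gauss_to_ball_range_ball:
  assumes p: "2 \<le> p" and n: "1 \<le> n" and A[measurable]: "A \<in> sets (lborel_n n)"
  shows "emeasure (gauss_n n) (gauss_to_ball p n -` A \<inter> space (gauss_n n)) = emeasure (lborel_n n) (A \<inter> range_ball p n)"
proof -
  let ?T = "\<lambda>x. dilate n (radial_factor p n (powr_sum p n x)) x"
  note [measurable] = dilate_radial_factor_measurable[OF p n] range_ball_measurable[OF p n]
  have pre: "gauss_to_ball p n -` A \<inter> space (gauss_n n) \<in> sets (gauss_n n)"
    using gauss_to_ball_measurable[OF p n] A by (rule measurable_sets)
  have TA: "(\<lambda>x. indicator A (?T x) :: ennreal) \<in> borel_measurable (lborel_n n)" by measurable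
  have "emeasure (gauss_n n) (gauss_to_ball p n -` A \<inter> space (gauss_n n))
      = (\<integral>\<^sup>+g. indicator (gauss_to_ball p n -` A \<inter> space (gauss_n n)) g \<partial>gauss_n n)"
    using pre by simp
  also have "\<dots> = (\<integral>\<^sup>+g. indicator A (?T (compose {..<n} (gauss_to_lp p) g)) \<partial>gauss_n n)"
    by (rule nn_integral_cong) (auto simp: gauss_to_ball_eq_dilate[OF p n] Let_def indicator_def)
  also have "\<dots> = (\<integral>\<^sup>+x. lp_weight p n x * indicator A (?T x) \<partial>lborel_n n)"
    by (rule nn_integral_gauss_n_compose[OF p TA])
  also have "\<dots> = (\<integral>\<^sup>+x. indicator {x. 1 \<le> lp_norm p n x} x * ennreal (1 / lp_norm p n x) *
       (\<integral>\<^sup>+r. indicator {0<..} r * ennreal (r ^ (n - 1)) * (lp_weight p n (dilate n r x) * indicator A (?T (dilate n r x))) \<partial>lborel) \<partial>lborel_n n)"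
    by (rule lborel_n_polar) (use n p TA in auto)
  also have "\<dots> = (\<integral>\<^sup>+x. indicator {x. 1 \<le> lp_norm p n x} x * ennreal (1 / lp_norm p n x) *
       (\<integral>\<^sup>+r. indicator {0<..} r * ennreal (r ^ (n - 1)) * indicator (A \<inter> range_ball p n) (dilate n r x) \<partial>lborel) \<partial>lborel_n n)"
  proof (rule nn_integral_cong)
    fix x
    show "indicator {x. 1 \<le> lp_norm p n x} x * ennreal (1 / lp_norm p n x) *
       (\<integral>\<^sup>+r. indicator {0<..} r * ennreal (r ^ (n - 1)) * (lp_weight p n (dilate n r x) * indicator A (?T (dilate n r x))) \<partial>lborel)
      = indicator {x. 1 \<le> lp_norm p n x} x * ennreal (1 / lp_norm p n x) *
       (\<integral>\<^sup>+r. indicator {0<..} r * ennreal (r ^ (n - 1)) * indicator (A \<inter> range_ball p n) (dilate n r x) \<partial>lborel)"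
    proof (cases "1 \<le> lp_norm p n x")
      case True
      then have "0 < lp_norm p n x" by simp
      from radial_substitution[OF p n A this] show ?thesis by simp
    qed simp
  qed
  also have "\<dots> = (\<integral>\<^sup>+x. indicator (A \<inter> range_ball p n) x \<partial>lborel_n n)"
    by (rule lborel_n_polar[symmetric]) (use n p in auto)
  also have "\<dots> = emeasure (lborel_n n) (A \<inter> range_ball p n)" by simp
  finally show ?thesis .
qed

lemma scale_lp_ball:
  assumes "0 < p" "0 < r"
  shows "scale_n n r (lp_ball p n) = {x \<in> space (lborel_n n). lp_norm p n x \<le> r}"
proof (intro set_eqI iffI)
  fix x assume "x \<in> scale_n n r (lp_ball p n)"
  then obtain a where "x = dilate n r a" "lp_norm p n a \<le> 1" by (auto simp: scale_n_def lp_ball_def dilate_def)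
  then show "x \<in> {x \<in> space (lborel_n n). lp_norm p n x \<le> r}"
    using assms by (simp add: dilate_in_space lp_norm_dilate)
next
  fix x assume x: "x \<in> {x \<in> space (lborel_n n). lp_norm p n x \<le> r}"
  have "x = dilate n r (dilate n (1 / r) x)" using x assms by (simp add: dilate_dilate dilate_1)
  moreover have "dilate n (1 / r) x \<in> lp_ball p n"
    using x assms dilate_in_space[of n "1 / r" x] lp_norm_dilate[of p "1 / r" n x]
    by (simp add: lp_ball_def space_lborel_n)
  ultimately show "x \<in> scale_n n r (lp_ball p n)" unfolding scale_n_def dilate_def by blast
qed

lemma lp_ball_measurable [measurable]: "0 < p \<Longrightarrow> 0 < r \<Longrightarrow> scale_n n r (lp_ball p n) \<in> sets (lborel_n n)"
  by (simp add: scale_lp_ball)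

lemma emeasure_scale_lp_ball:
  assumes "0 < p" "0 < r"
  shows "emeasure (lborel_n n) (scale_n n r (lp_ball p n)) = ennreal (r ^ n) * emeasure (lborel_n n) (scale_n n 1 (lp_ball p n))"
proof -
  have "emeasure (lborel_n n) (scale_n n r (lp_ball p n)) = (\<integral>\<^sup>+x. indicator (scale_n n r (lp_ball p n)) x \<partial>lborel_n n)"
    using assms by simp
  also have "\<dots> = ennreal (r ^ n) * (\<integral>\<^sup>+x. indicator (scale_n n r (lp_ball p n)) (dilate n r x) \<partial>lborel_n n)"
    using assms by (intro nn_integral_dilate) auto
  also have "(\<integral>\<^sup>+x. indicator (scale_n n r (lp_ball p n)) (dilate n r x) \<partial>lborel_n n)
      = (\<integral>\<^sup>+x. indicator (scale_n n 1 (lp_ball p n)) x \<partial>lborel_n n)"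
    using assms by (intro nn_integral_cong) (simp add: scale_lp_ball dilate_in_space lp_norm_dilate indicator_def)
  also have "\<dots> = emeasure (lborel_n n) (scale_n n 1 (lp_ball p n))" using assms by simp
  finally show ?thesis .
qed

text \<open>
  The set \<open>range_ball\<close> has volume 1 because the Gaussian measure has mass 1. It contains the balls with radii
  \<open>radius_fun p n s\<close>, so the unit ball has finite volume and these radii do not exceed the radius of
  the ball \<open>K\<close> of volume 1. Hence \<open>range_ball\<close> is contained in \<open>K\<close>, with the same volume.
\<close>

theorem lp_radius_range_ball:
  assumes p: "2 \<le> p" and n: "1 \<le> n"
  defines "K \<equiv> scale_n n (lp_radius p n) (lp_ball p n)"
  shows "0 < lp_radius p n" "emeasure (lborel_n n) K = 1"
    "\<And>A. A \<in> sets (lborel_n n) \<Longrightarrow> emeasure (lborel_n n) (A \<inter> K) = emeasure (lborel_n n) (A \<inter> range_ball p n)"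
proof -
  let ?B = "\<lambda>r. scale_n n r (lp_ball p n)" and ?m = "emeasure (lborel_n n)"
  have p0: "0 < p" using p by simp
  note [measurable] = range_ball_measurable[OF p n]
  define V where "V = ?m (?B 1)"
  interpret G: prob_space "gauss_n n" by (rule gauss_n_prob_space)
  have R1: "?m (range_ball p n) = 1"
  proof -
    have "gauss_to_ball p n -` space (lborel_n n) \<inter> space (gauss_n n) = space (gauss_n n)"
      using measurable_space[OF gauss_to_ball_measurable[OF p n]] by auto
    moreover have "space (lborel_n n) \<inter> range_ball p n = range_ball p n"
      by (auto simp: range_ball_def[OF p n])
    ultimately show ?thesis
      using emeasure_gauss_to_ball_range_ball[OF p n, of "space (lborel_n n)"] G.emeasure_space_1 by simp
  qed
  have rpos: "0 < radius_fun p n s" if "0 < s" for s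
    using radius_fun_strict_mono[OF p n, of 0 s] that by simp
  have B_sub: "?B (radius_fun p n s) \<subseteq> range_ball p n" if "0 < s" for s
    using that rpos[OF that] p by (auto simp: scale_lp_ball range_ball_def[OF p n] intro!: exI[of _ s])
  have le1: "ennreal (radius_fun p n s ^ n) * V \<le> 1" if "0 < s" for s
    using emeasure_mono[OF B_sub[OF that], of "lborel_n n"] R1
    unfolding emeasure_scale_lp_ball[OF p0 rpos[OF that]] V_def by simp
  have "V \<noteq> \<infinity>"
  proof
    assume "V = \<infinity>"
    then show False using le1[of 1] rpos[of 1] by (simp add: ennreal_mult_top top_unique)
  qed
  have "V \<noteq> 0"
  proof
    assume V0: "V = 0"
    have "range_ball p n \<subseteq> (\<Union>M::nat. ?B (radius_fun p n (real (Suc M))))"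
    proof
      fix x assume "x \<in> range_ball p n"
      then obtain s where s: "x \<in> space (lborel_n n)" "0 \<le> s" "lp_norm p n x \<le> radius_fun p n s"
        by (auto simp: range_ball_def[OF p n])
      obtain M :: nat where "s \<le> real M" using real_arch_simple by blast
      then have "lp_norm p n x \<le> radius_fun p n (real (Suc M))"
        using s radius_fun_mono[OF p n, of s "real (Suc M)"] by simp
      then show "x \<in> (\<Union>M::nat. ?B (radius_fun p n (real (Suc M))))"
        using s p0 rpos[of "real (Suc M)" for M] by (auto simp: scale_lp_ball intro!: exI[of _ M])
    qed
    moreover have "(\<Union>M::nat. ?B (radius_fun p n (real (Suc M)))) \<in> null_sets (lborel_n n)"
    proof (rule null_sets_UN)
      fix M :: nat
      have "0 < radius_fun p n (real (Suc M))" by (rule rpos) simp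
      then show "?B (radius_fun p n (real (Suc M))) \<in> null_sets (lborel_n n)"
        using V0 p0 emeasure_scale_lp_ball[OF p0, of "radius_fun p n (real (Suc M))" n]
        by (intro null_setsI) (auto simp: V_def)
    qed
    ultimately have "range_ball p n \<in> null_sets (lborel_n n)"
      by (rule null_sets_subset[rotated 2]) simp
    then show False using R1 by auto
  qed
  define v where "v = enn2real V"
  have v: "V = ennreal v" "0 < v"
    using \<open>V \<noteq> \<infinity>\<close> \<open>V \<noteq> 0\<close> by (auto simp: v_def less_top enn2real_positive_iff zero_less_iff_neq_zero)
  have mB: "?m (?B r) = ennreal (r ^ n * v)" if "0 < r" for r
    using emeasure_scale_lp_ball[OF p0 that, of n] that v by (simp add: V_def[symmetric] ennreal_mult)
  define r0 where "r0 = root n (1 / v)"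
  have r0: "0 < r0" "r0 ^ n * v = 1" using v n by (auto simp: r0_def)
  have leb: "emeasure (lebesgue_n n) (?B r) = ?m (?B r)" if "0 < r" for r
    unfolding lebesgue_n_def using that p0 by simp
  have "lp_radius p n = r0"
    unfolding lp_radius_def
  proof (rule the_equality)
    show "0 < r0 \<and> emeasure (lebesgue_n n) (?B r0) = 1" using r0 by (simp add: leb mB)
    fix r assume r: "0 < r \<and> emeasure (lebesgue_n n) (?B r) = 1"
    then have "r ^ n * v = 1" using leb[of r] mB[of r] by auto
    then have "r ^ n = r0 ^ n" using r0 v by (metis mult_right_cancel less_irrefl)
    then show "r = r0" using r r0 n by (metis less_imp_le less_le_trans power_eq_imp_eq_base zero_less_one)
  qed
  then have K: "K = ?B r0" and "0 < lp_radius p n" using r0 by (auto simp: K_def)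
  then show "0 < lp_radius p n" by simp
  show K1: "?m K = 1" using r0 by (simp add: K mB)
  have Ksets[measurable]: "K \<in> sets (lborel_n n)" unfolding K using p0 r0 by simp
  have sub: "range_ball p n \<subseteq> K"
  proof
    fix x assume "x \<in> range_ball p n"
    then obtain s where s: "x \<in> space (lborel_n n)" "0 \<le> s" "lp_norm p n x \<le> radius_fun p n s"
      by (auto simp: range_ball_def[OF p n])
    have "radius_fun p n (s + 1) \<le> r0"
    proof -
      have "ennreal (radius_fun p n (s + 1) ^ n * v) \<le> 1"
        using le1[of "s + 1"] s rpos[of "s + 1"] v by (simp add: ennreal_mult)
      then have "radius_fun p n (s + 1) ^ n * v \<le> r0 ^ n * v" using r0 by simp
      then have "radius_fun p n (s + 1) ^ n \<le> r0 ^ n" using v by simp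
      then show ?thesis using r0 n by (meson less_imp_le power_le_imp_le_base power_mono_iff zero_less_one less_le_trans linorder_not_le power_strict_mono)
    qed
    moreover have "radius_fun p n s \<le> radius_fun p n (s + 1)" using s by (intro radius_fun_mono[OF p n]) auto
    ultimately show "x \<in> K" using s p0 r0 by (simp add: K scale_lp_ball)
  qed
  have diff: "K - range_ball p n \<in> null_sets (lborel_n n)"
    using sub R1 K1 by (intro null_setsI) (auto simp: emeasure_Diff)
  fix A assume A[measurable]: "A \<in> sets (lborel_n n)"
  have "A \<inter> K = (A \<inter> range_ball p n) \<union> (A \<inter> (K - range_ball p n))" using sub by auto
  moreover have "A \<inter> (K - range_ball p n) \<in> null_sets (lborel_n n)"
    using diff by (rule null_sets_subset) auto
  ultimately show "?m (A \<inter> K) = ?m (A \<inter> range_ball p n)"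
    by (simp add: emeasure_Un_null_set)
qed

theorem measure_mu_eq_gauss:
  assumes p: "2 \<le> p" and n: "1 \<le> n" and A: "A \<in> sets (lborel_n n)"
  shows "measure (mu p n) A = measure (gauss_n n) (gauss_to_ball p n -` A \<inter> space (gauss_n n))"
proof -
  define K where "K = scale_n n (lp_radius p n) (lp_ball p n)"
  note K = lp_radius_range_ball[OF p n, folded K_def]
  have Ks: "K \<in> sets (lborel_n n)" unfolding K_def using p K(1) by (intro lp_ball_measurable) auto
  have "emeasure (mu p n) A = emeasure (lborel_n n) (K \<inter> A)"
    unfolding mu_def K_def[symmetric] using Ks A K(2)
    by (subst emeasure_uniform_measure) (auto simp: lebesgue_n_def divide_ennreal_def)
  also have "\<dots> = emeasure (gauss_n n) (gauss_to_ball p n -` A \<inter> space (gauss_n n))"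
    using K(3)[OF A] emeasure_gauss_to_ball_range_ball[OF p n A] by (simp add: Int_commute)
  finally show ?thesis by (simp add: measure_def)
qed

section \<open>Lebesgue measurability of closed enlargements\<close>

definition eucl_dist :: "nat \<Rightarrow> (nat \<Rightarrow> real) \<Rightarrow> (nat \<Rightarrow> real) \<Rightarrow> real" where
  "eucl_dist n x y = L2_set (\<lambda>i. x i - y i) {..<n}"

lemma eucl_dist_triangle: "eucl_dist n x z \<le> eucl_dist n x y + eucl_dist n y z"
  using L2_set_triangle_ineq[of "\<lambda>i. x i - y i" "\<lambda>i. y i - z i" "{..<n}"] by (simp add: eucl_dist_def)

lemma eucl_dist_nonneg: "0 \<le> eucl_dist n x y"
  by (simp add: eucl_dist_def)

lemma eucl_dist_square: "(eucl_dist n x y)\<^sup>2 = (\<Sum>i<n. (x i - y i)\<^sup>2)"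
  by (simp add: eucl_dist_def L2_set_def sum_nonneg)

definition open_nbhd :: "nat \<Rightarrow> (nat \<Rightarrow> real) set \<Rightarrow> real \<Rightarrow> (nat \<Rightarrow> real) set" where
  "open_nbhd n A r = {y \<in> space (lborel_n n). \<exists>a\<in>A. eucl_dist n y a < r}"

lemma sum_scaled_ball:
  assumes A: "A \<subseteq> space (lborel_n n)" and r: "0 < r"
  shows "sum_n n A (scale_n n r (lp_ball 2 n)) = {y \<in> space (lborel_n n). \<exists>a\<in>A. eucl_dist n y a \<le> r}"
proof -
  have norm2: "lp_norm 2 n b = L2_set b {..<n}" for b
    by (simp add: lp_norm_def L2_set_def powr_half_sqrt sum_nonneg)
  show ?thesis
  proof (intro set_eqI iffI)
    fix y assume "y \<in> sum_n n A (scale_n n r (lp_ball 2 n))"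
    then obtain a b where ab: "a \<in> A" "lp_norm 2 n b \<le> r" "y = (\<lambda>i\<in>{..<n}. a i + b i)"
      unfolding sum_n_def scale_lp_ball[OF zero_less_numeral r] by blast
    have "eucl_dist n y a = L2_set b {..<n}"
      unfolding eucl_dist_def by (rule L2_set_cong) (auto simp: ab)
    then show "y \<in> {y \<in> space (lborel_n n). \<exists>a\<in>A. eucl_dist n y a \<le> r}"
      using ab by (auto simp: norm2 space_lborel_n intro!: bexI[of _ a])
  next
    fix y assume "y \<in> {y \<in> space (lborel_n n). \<exists>a\<in>A. eucl_dist n y a \<le> r}"
    then obtain a where a: "a \<in> A" "eucl_dist n y a \<le> r" "y \<in> space (lborel_n n)" by blast
    define b where "b = (\<lambda>i\<in>{..<n}. y i - a i)"
    have "L2_set b {..<n} = eucl_dist n y a"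
      unfolding eucl_dist_def by (rule L2_set_cong) (auto simp: b_def)
    then have "b \<in> scale_n n r (lp_ball 2 n)"
      unfolding scale_lp_ball[OF zero_less_numeral r] using a by (simp add: norm2 space_lborel_n b_def)
    moreover have "y = (\<lambda>i\<in>{..<n}. a i + b i)"
      using a by (auto simp: b_def space_lborel_n PiE_iff extensional_def fun_eq_iff)
    ultimately show "y \<in> sum_n n A (scale_n n r (lp_ball 2 n))"
      unfolding sum_n_def using a by blast
  qed
qed

lemma countable_dense_subset:
  obtains D where "D \<subseteq> A" "countable D" "\<And>a \<epsilon>. a \<in> A \<Longrightarrow> 0 < \<epsilon> \<Longrightarrow> \<exists>d\<in>D. eucl_dist n a d < \<epsilon>"
proof -
  define Q where "Q = {..<n} \<rightarrow>\<^sub>E (\<rat> :: real set)"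
  have "countable Q" unfolding Q_def by (intro countable_PiE countable_rat) auto
  define near where "near q k a \<longleftrightarrow> a \<in> A \<and> (\<forall>i<n. \<bar>a i - q i\<bar> < 1 / real (Suc k))" for q :: "nat \<Rightarrow> real" and k a
  define D where "D = (\<lambda>(q, k). SOME a. near q k a) ` {(q, k). q \<in> Q \<and> (\<exists>a. near q k a)}"
  show ?thesis
  proof
    show "D \<subseteq> A"
      unfolding D_def using someI_ex[of "near q k" for q k] by (auto simp: near_def[abs_def])
    have "{(q, k). q \<in> Q \<and> (\<exists>a. near q k a)} \<subseteq> Q \<times> UNIV" by auto
    then have "countable {(q, k). q \<in> Q \<and> (\<exists>a. near q k a)}"
      using \<open>countable Q\<close> by (meson countable_SIGMA countable_subset uncountable_def countableI_type)
    then show "countable D" unfolding D_def by (rule countable_image)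
    fix a \<epsilon> assume a: "a \<in> A" and \<epsilon>: "(0::real) < \<epsilon>"
    obtain k where k: "2 * real n / \<epsilon> < real (Suc k)"
      using reals_Archimedean2[of "2 * real n / \<epsilon>"] by (metis less_trans lessI of_nat_less_iff)
    have "\<exists>q\<in>\<rat>. \<bar>a i - q\<bar> < 1 / real (Suc k)" for i
    proof -
      have "a i - 1 / real (Suc k) < a i" by simp
      from Rats_dense_in_real[OF this] obtain q where "q \<in> \<rat>" "a i - 1 / real (Suc k) < q" "q < a i" by blast
      then show ?thesis by (intro bexI[of _ q]) auto
    qed
    then obtain q0 where q0: "\<And>i. q0 i \<in> \<rat>" "\<And>i. \<bar>a i - q0 i\<bar> < 1 / real (Suc k)" by metis
    define q where "q = restrict q0 {..<n}"
    have qQ: "q \<in> Q" and qn: "near q k a" using q0 a by (auto simp: q_def Q_def near_def)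
    define d where "d = (SOME a. near q k a)"
    have d: "near q k d" unfolding d_def using qn by (rule someI[of "near q k"])
    have dD: "d \<in> D" unfolding D_def d_def using qQ qn by (auto intro!: image_eqI[of _ _ "(q, k)"])
    have "eucl_dist n a d \<le> (\<Sum>i<n. \<bar>a i - d i\<bar>)"
      unfolding eucl_dist_def by (rule L2_set_le_sum_abs)
    also have "\<dots> \<le> (\<Sum>i<n. 2 / real (Suc k))"
    proof (rule sum_mono)
      fix i assume "i \<in> {..<n}"
      then have "\<bar>a i - q i\<bar> < 1 / real (Suc k)" "\<bar>d i - q i\<bar> < 1 / real (Suc k)"
        using qn d by (auto simp: near_def)
      then show "\<bar>a i - d i\<bar> \<le> 2 / real (Suc k)" 
        by (simp only: add_divide_distrib[of 1 1, simplified one_add_one])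
    qed
    also have "\<dots> < \<epsilon>" using k \<epsilon> by (simp add: field_simps)
    finally show "\<exists>d\<in>D. eucl_dist n a d < \<epsilon>" using dD by blast
  qed
qed

lemma eucl_dist_measurable: "(\<lambda>y. eucl_dist n y a) \<in> borel_measurable (lborel_n n)"
proof -
  have "(\<lambda>y. \<Sum>i<n. (y i - a i)\<^sup>2) \<in> borel_measurable (lborel_n n)"
  proof (rule borel_measurable_sum)
    fix i assume "i \<in> {..<n}"
    then have "(\<lambda>x. x i) \<in> borel_measurable (lborel_n n)" by (intro measurable_component_lborel_n) simp
    then show "(\<lambda>y. (y i - a i)\<^sup>2) \<in> borel_measurable (lborel_n n)" by measurable
  qed
  then show ?thesis unfolding eucl_dist_def L2_set_def by measurable
qed

lemma open_nbhd_measurable: "open_nbhd n A r \<in> sets (lborel_n n)"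
proof -
  obtain D where D: "D \<subseteq> A" "countable D" "\<And>a \<epsilon>. a \<in> A \<Longrightarrow> 0 < \<epsilon> \<Longrightarrow> \<exists>d\<in>D. eucl_dist n a d < \<epsilon>"
    using countable_dense_subset[of A n] by metis
  have "open_nbhd n A r = (\<Union>d\<in>D. {y \<in> space (lborel_n n). eucl_dist n y d < r})"
  proof (intro set_eqI iffI)
    fix y assume "y \<in> open_nbhd n A r"
    then obtain a where a: "y \<in> space (lborel_n n)" "a \<in> A" "eucl_dist n y a < r" by (auto simp: open_nbhd_def)
    obtain d where d: "d \<in> D" "eucl_dist n a d < r - eucl_dist n y a" using D(3)[OF a(2), of "r - eucl_dist n y a"] a by auto
    then have "eucl_dist n y d < r" using eucl_dist_triangle[of n y d a] by linarith
    then show "y \<in> (\<Union>d\<in>D. {y \<in> space (lborel_n n). eucl_dist n y d < r})" using a d by blast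
  qed (use D in \<open>auto simp: open_nbhd_def\<close>)
  also have "\<dots> \<in> sets (lborel_n n)"
    using D(2) eucl_dist_measurable by (intro sets.countable_UN') (auto intro: borel_measurable_less)
  finally show ?thesis .
qed

text \<open>
  Points outside the open enlargement of \<open>A\<close> that enter it when moved by any small rational \<open>\<tau>\<close> in the direction
  \<open>- \<sigma>\<close> of the \<open>i\<close>-th axis. Rational \<open>\<tau>\<close> make the set measurable, and the radius that decreases
  with \<open>\<tau>\<close> allows to pass from rational to real \<open>\<tau>\<close>.
\<close>

definition line_gap_set :: "nat \<Rightarrow> (nat \<Rightarrow> real) set \<Rightarrow> real \<Rightarrow> nat \<Rightarrow> real \<Rightarrow> nat \<Rightarrow> (nat \<Rightarrow> real) set" where
  "line_gap_set n A r i \<sigma> k = {y \<in> space (lborel_n n). y \<notin> open_nbhd n A r \<and>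
     (\<forall>\<tau>\<in>\<rat> \<inter> {0<..<1 / real (Suc k)}. y(i := y i - \<sigma> * \<tau>) \<in> open_nbhd n A (sqrt (r\<^sup>2 - \<tau> / real (Suc k))))}"

lemma line_gap_set_measurable:
  assumes i: "i < n" shows "line_gap_set n A r i \<sigma> k \<in> sets (lborel_n n)"
proof -
  have upd: "(\<lambda>y. y(i := y i - \<sigma> * \<tau>)) \<in> measurable (lborel_n n) (lborel_n n)" for \<tau>
  proof -
    have "(\<lambda>y. \<lambda>j\<in>{..<n}. if j = i then y j - \<sigma> * \<tau> else y j) \<in> measurable (lborel_n n) (lborel_n n)"
    proof (rule measurable_restrict_lborel_n)
      fix j assume "j < n"
      then have "(\<lambda>x. x j) \<in> borel_measurable (lborel_n n)" by (rule measurable_component_lborel_n)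
      then show "(\<lambda>y. if j = i then y j - \<sigma> * \<tau> else y j) \<in> borel_measurable (lborel_n n)" by (cases "j = i") auto
    qed
    moreover have "(\<lambda>j\<in>{..<n}. if j = i then y j - \<sigma> * \<tau> else y j) = y(i := y i - \<sigma> * \<tau>)"
      if "y \<in> space (lborel_n n)" for y
      using that i by (auto simp: space_lborel_n PiE_iff extensional_def fun_eq_iff)
    ultimately show ?thesis by (simp cong: measurable_cong)
  qed
  have "countable (\<rat> \<inter> {0<..<1 / real (Suc k)} :: real set)"
    using countable_rat by (rule countable_Int1)
  then have "(\<Union>\<tau>\<in>\<rat> \<inter> {0<..<1 / real (Suc k)}. space (lborel_n n) -
      ((\<lambda>y. y(i := y i - \<sigma> * \<tau>)) -` open_nbhd n A (sqrt (r\<^sup>2 - \<tau> / real (Suc k))) \<inter> space (lborel_n n))) \<in> sets (lborel_n n)"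
    (is "?U \<in> _")
  proof (rule sets.countable_UN'')
    fix \<tau>
    show "space (lborel_n n) - ((\<lambda>y. y(i := y i - \<sigma> * \<tau>)) -` open_nbhd n A (sqrt (r\<^sup>2 - \<tau> / real (Suc k)))
        \<inter> space (lborel_n n)) \<in> sets (lborel_n n)"
      by (intro sets.Diff sets.top) (rule measurable_sets[OF upd open_nbhd_measurable])
  qed
  moreover have "{y \<in> space (lborel_n n). \<forall>\<tau>\<in>\<rat> \<inter> {0<..<1 / real (Suc k)}.
      y(i := y i - \<sigma> * \<tau>) \<in> open_nbhd n A (sqrt (r\<^sup>2 - \<tau> / real (Suc k)))} = space (lborel_n n) - ?U"
    by blast
  ultimately have c: "{y \<in> space (lborel_n n). \<forall>\<tau>\<in>\<rat> \<inter> {0<..<1 / real (Suc k)}.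
      y(i := y i - \<sigma> * \<tau>) \<in> open_nbhd n A (sqrt (r\<^sup>2 - \<tau> / real (Suc k)))} \<in> sets (lborel_n n)"
    by simp
  have "line_gap_set n A r i \<sigma> k = {y \<in> space (lborel_n n). \<forall>\<tau>\<in>\<rat> \<inter> {0<..<1 / real (Suc k)}.
      y(i := y i - \<sigma> * \<tau>) \<in> open_nbhd n A (sqrt (r\<^sup>2 - \<tau> / real (Suc k)))} - open_nbhd n A r"
    by (auto simp: line_gap_set_def)
  then show ?thesis using c open_nbhd_measurable by auto
qed

text \<open>
  If two such points on a line were closer to each other, then moving from one towards the other by a
  rational \<open>\<tau>\<close> that falls slightly short of their distance would lead into the smaller enlargement. Its radius is
  at most \<open>r - d / (2 * r)\<close> with \<open>d = \<tau> / Suc k\<close>, so that the short remaining step could not leave the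
  enlargement of radius \<open>r\<close>.
\<close>

lemma line_gap_set_separated:
  assumes i: "i < n" and r: "0 < r" and \<sigma>: "\<bar>\<sigma>\<bar> = 1"
    and s: "x(i := s) \<in> line_gap_set n A r i \<sigma> k"
    and s': "x(i := s') \<in> line_gap_set n A r i \<sigma> k"
    and less: "0 < \<sigma> * (s - s')"
  shows "1 / real (Suc k) \<le> \<bar>s - s'\<bar>"
proof (rule ccontr)
  assume "\<not> ?thesis"
  then have close: "\<bar>s - s'\<bar> < 1 / real (Suc k)" by simp
  define \<tau>0 where "\<tau>0 = \<sigma> * (s - s')"
  have \<sigma>2: "\<sigma> * \<sigma> = 1" using \<sigma> by (auto simp: abs_if split: if_splits)
  have \<tau>0: "0 < \<tau>0" "\<tau>0 < 1 / real (Suc k)" using less close \<sigma> by (auto simp: \<tau>0_def abs_mult abs_if split: if_splits)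
  have s'_eq: "s' = s - \<sigma> * \<tau>0" using \<sigma>2 by (simp add: \<tau>0_def mult.assoc[symmetric])
  define \<eta> where "\<eta> = min (\<tau>0 / 2) (\<tau>0 / (4 * r * real (Suc k)))"
  have \<eta>: "0 < \<eta>" using \<tau>0 r by (auto simp: \<eta>_def)
  obtain \<tau> where \<tau>: "\<tau> \<in> \<rat>" "\<tau>0 - \<eta> < \<tau>" "\<tau> < \<tau>0"
    using Rats_dense_in_real[of "\<tau>0 - \<eta>" \<tau>0] \<eta> by auto
  have \<tau>2: "\<tau>0 / 2 < \<tau>" using \<tau> by (auto simp: \<eta>_def)
  then have "\<tau> \<in> \<rat> \<inter> {0<..<1 / real (Suc k)}" using \<tau> \<tau>0 by auto
  with s have "(x(i := s))(i := (x(i := s)) i - \<sigma> * \<tau>) \<in> open_nbhd n A (sqrt (r\<^sup>2 - \<tau> / real (Suc k)))"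
    unfolding line_gap_set_def by blast
  then have "x(i := s - \<sigma> * \<tau>) \<in> open_nbhd n A (sqrt (r\<^sup>2 - \<tau> / real (Suc k)))" by simp
  then obtain a where a: "a \<in> A" "eucl_dist n (x(i := s - \<sigma> * \<tau>)) a < sqrt (r\<^sup>2 - \<tau> / real (Suc k))"
    by (auto simp: open_nbhd_def)
  let ?d = "\<tau> / real (Suc k)"
  have d0: "0 < ?d" using \<tau>2 \<tau>0 by simp
  have "0 < sqrt (r\<^sup>2 - ?d)" using a(2) eucl_dist_nonneg[of n "x(i := s - \<sigma> * \<tau>)" a] by linarith
  then have rd: "?d < r\<^sup>2" by simp
  have "sqrt (r\<^sup>2 - ?d) \<le> r - ?d / (2 * r)"
  proof (rule real_le_lsqrt)
    show "r\<^sup>2 - ?d \<le> (r - ?d / (2 * r))\<^sup>2"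
    proof -
      have "2 * r * (?d / (2 * r)) = ?d" using r by simp
      then have "(r - ?d / (2 * r))\<^sup>2 = r\<^sup>2 - ?d + (?d / (2 * r))\<^sup>2" by (simp only: power2_diff) 
      then show ?thesis by simp
    qed
    have "?d \<le> r * (2 * r)" using rd zero_le_power2[of r] unfolding power2_eq_square by linarith
    then have "?d / (2 * r) \<le> r * (2 * r) / (2 * r)" using r by (intro divide_right_mono) auto
    then show "0 \<le> r - ?d / (2 * r)" using r by simp
  qed
  moreover have "eucl_dist n (x(i := s')) (x(i := s - \<sigma> * \<tau>)) \<le> \<tau>0 - \<tau>"
  proof -
    have "eucl_dist n (x(i := s')) (x(i := s - \<sigma> * \<tau>)) \<le> (\<Sum>j<n. \<bar>(x(i := s')) j - (x(i := s - \<sigma> * \<tau>)) j\<bar>)"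
      unfolding eucl_dist_def by (rule L2_set_le_sum_abs)
    also have "\<dots> = (\<Sum>j<n. if j = i then \<bar>s' - (s - \<sigma> * \<tau>)\<bar> else 0)" by (rule sum.cong) auto
    also have "\<dots> = \<bar>s' - (s - \<sigma> * \<tau>)\<bar>" using i by simp
    also have "s' - (s - \<sigma> * \<tau>) = \<sigma> * (\<tau> - \<tau>0)" by (simp add: s'_eq algebra_simps)
    also have "\<bar>\<sigma> * (\<tau> - \<tau>0)\<bar> = \<tau>0 - \<tau>" using \<sigma> \<tau> by (simp add: abs_mult)
    finally show ?thesis .
  qed
  moreover have "\<tau>0 - \<tau> < ?d / (2 * r)"
  proof -
    have "\<tau>0 - \<tau> < \<tau>0 / (4 * r * real (Suc k))" using \<tau>(2) by (auto simp: \<eta>_def)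
    also have "\<dots> = (\<tau>0 / 2) / real (Suc k) / (2 * r)" by simp
    also have "\<dots> < ?d / (2 * r)" using \<tau>2 r by (intro divide_strict_right_mono) auto
    finally show ?thesis .
  qed
  ultimately have "eucl_dist n (x(i := s')) a < r"
    using eucl_dist_triangle[of n "x(i := s')" a "x(i := s - \<sigma> * \<tau>)"] a(2) by linarith
  then have "x(i := s') \<in> open_nbhd n A r" using s' a(1) by (auto simp: open_nbhd_def line_gap_set_def)
  then show False using s' by (simp add: line_gap_set_def)
qed

lemma separated_imp_countable:
  fixes S :: "real set"
  assumes "0 < \<epsilon>" and sep: "\<And>s s'. s \<in> S \<Longrightarrow> s' \<in> S \<Longrightarrow> s \<noteq> s' \<Longrightarrow> \<epsilon> \<le> \<bar>s - s'\<bar>"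
  shows "countable S"
proof -
  have "inj_on (\<lambda>s. \<lfloor>s / \<epsilon>\<rfloor>) S"
  proof (rule inj_onI, rule ccontr)
    fix s s' assume s: "s \<in> S" "s' \<in> S" "\<lfloor>s / \<epsilon>\<rfloor> = \<lfloor>s' / \<epsilon>\<rfloor>" "s \<noteq> s'"
    then have "\<bar>s / \<epsilon> - s' / \<epsilon>\<bar> < 1" by linarith
    moreover have "\<bar>s / \<epsilon> - s' / \<epsilon>\<bar> = \<bar>s - s'\<bar> / \<epsilon>"
      using assms(1) by (simp add: diff_divide_distrib[symmetric])
    ultimately have "\<bar>s - s'\<bar> < \<epsilon>" using assms(1) by simp
    then show False using sep[OF s(1,2,4)] by simp
  qed
  then show ?thesis by (rule countableI')
qed

text \<open>
  By \<open>line_gap_set_separated\<close> a line in the direction of the \<open>i\<close>-th axis meets the set in points with mutual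
  distance at least \<open>1 / Suc k\<close>, hence in a countable set; Fubini's theorem gives the claim.
\<close>

lemma line_gap_set_null:
  assumes i: "i < n" and r: "0 < r" and \<sigma>: "\<bar>\<sigma>\<bar> = 1"
  shows "line_gap_set n A r i \<sigma> k \<in> null_sets (lborel_n n)"
proof (rule null_setsI)
  let ?E = "line_gap_set n A r i \<sigma> k" and ?I = "{..<n} - {i}"
  show E: "?E \<in> sets (lborel_n n)" by (rule line_gap_set_measurable[OF i])
  have ins: "lborel_n n = Pi\<^sub>M (insert i ?I) (\<lambda>_. lborel)"
    unfolding lborel_n_def using i by (simp add: insert_absorb)
  have "emeasure (lborel_n n) ?E = (\<integral>\<^sup>+y. indicator ?E y \<partial>lborel_n n)" using E by simp
  also have "\<dots> = (\<integral>\<^sup>+x. (\<integral>\<^sup>+s. indicator ?E (x(i := s)) \<partial>lborel) \<partial>Pi\<^sub>M ?I (\<lambda>_. lborel))"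
  proof -
    have "(indicator ?E :: _ \<Rightarrow> ennreal) \<in> borel_measurable (lborel_n n)" using E by simp
    then show ?thesis unfolding ins by (intro lborel_prod.product_nn_integral_insert) auto
  qed
  also have "\<dots> = (\<integral>\<^sup>+x. 0 \<partial>Pi\<^sub>M ?I (\<lambda>_. lborel :: real measure))"
  proof (rule nn_integral_cong)
    fix x
    let ?S = "{s. x(i := s) \<in> ?E}"
    have "countable ?S"
    proof (rule separated_imp_countable[of "1 / real (Suc k)"])
      fix s s' assume s: "s \<in> ?S" "s' \<in> ?S" "s \<noteq> s'"
      then have "0 < \<sigma> * (s - s') \<or> 0 < \<sigma> * (s' - s)" using \<sigma> by (auto simp: abs_if split: if_splits)
      then show "1 / real (Suc k) \<le> \<bar>s - s'\<bar>"
        using line_gap_set_separated[OF i r \<sigma>, of x s A k s'] line_gap_set_separated[OF i r \<sigma>, of x s' A k s] s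
        by (auto simp: abs_minus_commute)
    qed simp
    then have "emeasure lborel ?S = 0" by (rule emeasure_lborel_countable)
    moreover have "(\<integral>\<^sup>+s. indicator ?E (x(i := s)) \<partial>lborel) = (\<integral>\<^sup>+s. indicator ?S s \<partial>lborel)"
      by (intro nn_integral_cong) (auto simp: indicator_def)
    moreover have "?S \<in> sets lborel" using \<open>countable ?S\<close> by (simp add: sets.countable)
    ultimately show "(\<integral>\<^sup>+s. indicator ?E (x(i := s)) \<partial>lborel) = 0" by simp
  qed
  finally show "emeasure (lborel_n n) ?E = 0" by simp
qed

text \<open>
  The point \<open>y\<close> has distance exactly \<open>r\<close> from \<open>a\<close>, so some coordinates \<open>y i\<close> and \<open>a i\<close> differ. Moving \<open>y i\<close> towards
  \<open>a i\<close> by \<open>\<tau>\<close> decreases the squared distance by \<open>2 * \<tau> * c - \<tau>\<^sup>2\<close> with \<open>c = \<bar>y i - a i\<bar>\<close>.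
\<close>

lemma distance_sphere_in_line_gap_set:
  assumes r: "0 < r" and y: "y \<in> space (lborel_n n)" "y \<notin> open_nbhd n A r" and a: "a \<in> A" "eucl_dist n y a \<le> r"
  shows "\<exists>i<n. \<exists>\<sigma>\<in>{1, - 1}. \<exists>k. y \<in> line_gap_set n A r i \<sigma> k"
proof -
  have eq: "eucl_dist n y a = r" using y a by (auto simp: open_nbhd_def)
  have "\<exists>i<n. y i \<noteq> a i"
  proof (rule ccontr)
    assume "\<not> ?thesis"
    then have "eucl_dist n y a = 0" unfolding eucl_dist_def by (subst L2_set_eq_0_iff) auto
    then show False using eq r by simp
  qed
  then obtain i where i: "i < n" "y i \<noteq> a i" by blast
  define \<sigma> where "\<sigma> = sgn (y i - a i)"
  define c where "c = \<bar>y i - a i\<bar>"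
  have \<sigma>: "\<sigma> \<in> {1, - 1}" "\<sigma> * \<sigma> = 1" and c: "0 < c" "y i - a i = \<sigma> * c"
    using i by (auto simp: \<sigma>_def c_def sgn_if)
  obtain k where k: "1 / c < real (Suc k)"
    using reals_Archimedean2[of "1 / c"] by (metis less_trans lessI of_nat_less_iff)
  then have kc: "1 / real (Suc k) < c" using c by (simp add: field_simps)
  have "y \<in> line_gap_set n A r i \<sigma> k"
    unfolding line_gap_set_def
  proof (intro CollectI conjI y ballI)
    fix \<tau> assume \<tau>: "\<tau> \<in> \<rat> \<inter> {0<..<1 / real (Suc k)}"
    let ?y = "y(i := y i - \<sigma> * \<tau>)"
    have ysp: "?y \<in> space (lborel_n n)" using y i by (auto simp: space_lborel_n PiE_iff extensional_def)
    have "(eucl_dist n ?y a)\<^sup>2 - (eucl_dist n y a)\<^sup>2 = (\<Sum>j<n. (?y j - a j)\<^sup>2 - (y j - a j)\<^sup>2)"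
      by (simp only: eucl_dist_square sum_subtractf)
    also have "\<dots> = (\<Sum>j<n. if j = i then (\<sigma> * c - \<sigma> * \<tau>)\<^sup>2 - (\<sigma> * c)\<^sup>2 else 0)"
      using c(2) by (intro sum.cong) (auto simp: algebra_simps)
    also have "\<dots> = (\<sigma> * c - \<sigma> * \<tau>)\<^sup>2 - (\<sigma> * c)\<^sup>2" using i by simp
    also have "\<dots> = (\<sigma> * \<sigma>) * (\<tau> * \<tau> - 2 * (\<tau> * c))" by (simp add: power2_eq_square algebra_simps)
    also have "\<dots> = \<tau> * \<tau> - 2 * (\<tau> * c)" using \<sigma> by simp
    finally have "(eucl_dist n ?y a)\<^sup>2 = r\<^sup>2 + \<tau> * \<tau> - 2 * (\<tau> * c)" using eq by simp
    moreover have "\<tau> * \<tau> < \<tau> * c" using \<tau> kc by (intro mult_strict_left_mono) auto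
    moreover have "\<tau> / real (Suc k) < \<tau> * c" using \<tau> kc mult_strict_left_mono[OF kc, of \<tau>] by simp
    ultimately have "(eucl_dist n ?y a)\<^sup>2 < r\<^sup>2 - \<tau> / real (Suc k)" by linarith
    then have "eucl_dist n ?y a < sqrt (r\<^sup>2 - \<tau> / real (Suc k))" by (rule real_less_rsqrt)
    then show "?y \<in> open_nbhd n A (sqrt (r\<^sup>2 - \<tau> / real (Suc k)))"
      using ysp a(1) by (auto simp: open_nbhd_def)
  qed
  then show ?thesis using i \<sigma> by blast
qed

text \<open>
  By \<open>distance_sphere_in_line_gap_set\<close> the closed enlargement is the open one together with a subset of a
  countable union of null sets.
\<close>

theorem sum_scaled_ball_lebesgue_measurable:
  assumes A: "A \<subseteq> space (lborel_n n)" and r: "0 < r"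
  shows "sum_n n A (scale_n n r (lp_ball 2 n)) \<in> sets (lebesgue_n n)"
  unfolding lebesgue_n_def sum_scaled_ball[OF A r]
proof (rule sets_completionI)
  let ?S = "{y \<in> space (lborel_n n). \<exists>a\<in>A. eucl_dist n y a \<le> r}"
  let ?N = "\<Union>i<n. \<Union>\<sigma>\<in>{1, - 1}. \<Union>k. line_gap_set n A r i \<sigma> k"
  show "?S = open_nbhd n A r \<union> (?S - open_nbhd n A r)" by (auto simp: open_nbhd_def intro: less_imp_le)
  show "?S - open_nbhd n A r \<subseteq> ?N" 
  proof
    fix y assume "y \<in> ?S - open_nbhd n A r"
    then obtain a where "y \<in> space (lborel_n n)" "y \<notin> open_nbhd n A r" "a \<in> A" "eucl_dist n y a \<le> r" by blast
    from distance_sphere_in_line_gap_set[OF r this] show "y \<in> ?N" by auto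
  qed
  show "?N \<in> null_sets (lborel_n n)"
    by (intro null_sets_UN' countable_finite null_sets_UN line_gap_set_null r) auto
qed (rule open_nbhd_measurable)

section \<open>Isoperimetry of the uniform measure on the ball\<close>

text \<open>
  The difference of the two sides has derivative \<open>- (1 - Phi g)\<close> and limit 0.
\<close>

lemma Phi_tail_mult_le:
  assumes "0 \<le> g" shows "g * (1 - Phi g) \<le> std_normal_density g"
proof -
  have "0 \<le> std_normal_density g - g * (1 - Phi g)"
  proof (rule antimono_tendsto_0_imp_nonneg[where D="\<lambda>y. std_normal_density y - y * (1 - Phi y)" and D'="\<lambda>y. - (1 - Phi y)"])
    fix y
    have "((\<lambda>y. std_normal_density y - y * (1 - Phi y)) has_real_derivative
        - y * std_normal_density y - (1 * (1 - Phi y) + (0 - std_normal_density y) * y)) (at y)"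
      by (intro DERIV_diff DERIV_mult DERIV_ident DERIV_const std_normal_density_has_derivative Phi_has_derivative)
    also have "- y * std_normal_density y - (1 * (1 - Phi y) + (0 - std_normal_density y) * y) = - (1 - Phi y)"
      by (simp add: algebra_simps)
    finally show "((\<lambda>y. std_normal_density y - y * (1 - Phi y)) has_real_derivative - (1 - Phi y)) (at y)" .
    show "- (1 - Phi y) \<le> 0" using Phi_bounds[of y] by simp
  next
    have "((\<lambda>y. y * (1 - Phi y)) \<longlongrightarrow> 0) at_top"
    proof (rule tendsto_sandwich[OF _ _ tendsto_const])
      show "\<forall>\<^sub>F y in at_top. 0 \<le> y * (1 - Phi y)"
        using eventually_ge_at_top[of 0]
        by eventually_elim (rule mult_nonneg_nonneg, auto simp: Phi_bounds less_imp_le)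
      show "\<forall>\<^sub>F y in at_top. y * (1 - Phi y) \<le> y * exp (- y\<^sup>2 / 2)"
        using eventually_ge_at_top[of 0]
        by eventually_elim (intro mult_left_mono Phi_tail_upper, auto)
      show "((\<lambda>y::real. y * exp (- y\<^sup>2 / 2)) \<longlongrightarrow> 0) at_top" by real_asymp
    qed
    moreover have "(std_normal_density \<longlongrightarrow> 0) at_top"
      unfolding std_normal_density_def[abs_def] by real_asymp
    ultimately show "((\<lambda>y. std_normal_density y - y * (1 - Phi y)) \<longlongrightarrow> 0) at_top"
      using tendsto_diff by fastforce
  qed
  then show ?thesis by simp
qed

text \<open>
  With \<open>m = 1 - Phi g\<close>, the lower bound on \<open>m\<close> in \<open>Phi_tail_lower\<close> gives \<open>sqrt (ln (1 / m)) \<le> 2 + g\<close>, and the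
  upper bound in \<open>Phi_tail_mult_le\<close> controls \<open>m * (2 + g)\<close>.
\<close>

lemma entropy_profile_le_density:
  obtains K where "0 < K" "\<And>g. 0 \<le> g \<Longrightarrow> (1 - Phi g) * sqrt (ln (1 / (1 - Phi g))) \<le> K * std_normal_density g"
proof
  \<comment> \<open>The first value serves for \<open>g > 1\<close>, the second for \<open>g \<le> 1\<close>.\<close>
  define K where "K = max 3 (3 / std_normal_density 1)"
  show "0 < K" by (simp add: K_def)
  fix g :: real assume g: "0 \<le> g"
  define m where "m = 1 - Phi g"
  have m: "0 < m" "m \<le> 1" using Phi_bounds[of g] by (auto simp: m_def)
  have "ln (1 / m) \<le> 1 + ln (1 + g) + ln (sqrt (2 * pi)) + g\<^sup>2 / 2"
  proof -
    have "std_normal_density g \<le> exp 1 * (1 + g) * m" using Phi_tail_lower[OF g] by (simp add: m_def)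
    then have "ln (std_normal_density g) \<le> ln (exp 1 * (1 + g) * m)" using g m by (subst ln_le_cancel_iff) auto
    also have "\<dots> = 1 + ln (1 + g) + ln m" using g m by (simp add: ln_mult_pos)
    also have "ln (std_normal_density g) = - ln (sqrt (2 * pi)) - g\<^sup>2 / 2"
      by (simp add: std_normal_density_def ln_mult_pos ln_div)
    finally show ?thesis using m by (simp add: ln_div)
  qed
  also have "\<dots> \<le> 1 + g + 2 + g\<^sup>2 / 2"
  proof -
    have "ln (1 + g) \<le> g" using g by (intro ln_add_one_self_le_self)
    moreover have "ln (sqrt (2 * pi)) \<le> 2"
    proof -
      have "ln (sqrt (2 * pi)) \<le> sqrt (2 * pi) - 1" by (intro ln_le_minus_one) simp
      also have "sqrt (2 * pi) \<le> 3" using pi_less_4 by (intro real_le_lsqrt) auto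
      finally show ?thesis by simp
    qed
    ultimately show ?thesis by simp
  qed
  also have "\<dots> \<le> (2 + g)\<^sup>2" using g by (simp add: power2_eq_square algebra_simps)
  finally have "sqrt (ln (1 / m)) \<le> 2 + g" using g by (intro real_le_lsqrt) auto
  then have "m * sqrt (ln (1 / m)) \<le> m * (2 + g)" using m by (intro mult_left_mono) auto
  also have "\<dots> \<le> K * std_normal_density g"
  proof (cases "g \<le> 1")
    case True
    have "m * (2 + g) \<le> 1 * 3" using m g True by (intro mult_mono) auto
    also have "\<dots> = 3 / std_normal_density 1 * std_normal_density 1"
    proof -
      have "std_normal_density 1 \<noteq> 0" using std_normal_density_pos[of 1] by linarith
      then show ?thesis by simp
    qed
    also have "\<dots> \<le> K * std_normal_density g"
      using True g by (intro mult_mono std_normal_density_antimono) (auto simp: K_def)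
    finally show ?thesis .
  next
    case False
    have "m * (2 + g) \<le> 3 * (g * m)" using False m by (simp add: algebra_simps)
    also have "\<dots> \<le> 3 * std_normal_density g" using Phi_tail_mult_le[OF g] by (simp add: m_def)
    also have "\<dots> \<le> K * std_normal_density g" by (intro mult_right_mono) (auto simp: K_def)
    finally show ?thesis .
  qed
  finally show "(1 - Phi g) * sqrt (ln (1 / (1 - Phi g))) \<le> K * std_normal_density g" by (simp add: m_def)
qed

lemma prob_space_mu:
  assumes "2 \<le> p" "1 \<le> n" shows "prob_space (mu p n)"
proof -
  have "scale_n n (lp_radius p n) (lp_ball p n) \<in> sets (lborel_n n)"
    using assms lp_radius_range_ball(1)[OF assms] by (intro lp_ball_measurable) auto
  then show ?thesis
    unfolding mu_def using lp_radius_range_ball(2)[OF assms]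
    by (intro prob_space_uniform_measure) (auto simp: lebesgue_n_def)
qed

lemma sets_mu: "sets (mu p n) = sets (lebesgue_n n)"
  by (simp add: mu_def)

text \<open>
  The identity \<open>measure_mu_eq_gauss\<close> is available for Borel sets. As \<open>18 * t < 18 * sqrt 2 * t\<close>, it can be applied
  to the open enlargement, which is contained in the closed one.
\<close>

theorem mu_isoperimetry:
  assumes n: "1 \<le> n" and p: "2 \<le> p" and A: "A \<in> sets (lborel_n n)"
    and x: "measure (mu p n) A = Phi x" and t: "0 < t"
  shows "Phi (x + t) \<le> measure (mu p n) (sum_n n A (scale_n n (18 * sqrt 2 * t) (lp_ball 2 n)))"
proof -
  interpret mu: prob_space "mu p n" by (rule prob_space_mu[OF p n])
  let ?F = "gauss_to_ball p n" and ?r = "18 * sqrt 2 * t"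
  have r: "0 < ?r" using t by simp
  define B where "B = open_nbhd n A ?r"
  have B: "B \<in> sets (lborel_n n)" unfolding B_def by (rule open_nbhd_measurable)
  have Asp: "A \<subseteq> space (lborel_n n)" using sets.sets_into_space[OF A] .
  have "Phi (x + t) \<le> measure (gauss_n n) (?F -` B \<inter> space (gauss_n n))"
  proof (rule gaussian_isoperimetry)
    show "?F -` A \<inter> space (gauss_n n) \<in> sets (gauss_n n)" "?F -` B \<inter> space (gauss_n n) \<in> sets (gauss_n n)"
      using measurable_sets[OF gauss_to_ball_measurable[OF p n]] A B by auto
    show "measure (gauss_n n) (?F -` A \<inter> space (gauss_n n)) = Phi x"
      using x measure_mu_eq_gauss[OF p n A] by simp
    show "0 \<le> t" using t by simp
    fix g h assume g: "g \<in> ?F -` A \<inter> space (gauss_n n)" and h: "h \<in> space (gauss_n n)"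
      and d: "(\<Sum>i<n. (g i - h i)\<^sup>2) \<le> t\<^sup>2"
    have "eucl_dist n h g \<le> t"
      unfolding eucl_dist_def L2_set_def using d t by (intro real_le_lsqrt) (auto simp: power2_commute)
    then have "eucl_dist n (?F h) (?F g) \<le> 18 * t"
      using gauss_to_ball_lipschitz[OF p n, of h g] by (simp add: eucl_dist_def)
    also have "\<dots> < ?r" using t by simp
    finally have "?F h \<in> B"
      unfolding B_def open_nbhd_def using g measurable_space[OF gauss_to_ball_measurable[OF p n] h] by auto
    then show "h \<in> ?F -` B \<inter> space (gauss_n n)" using h by simp
  qed
  also have "\<dots> = measure (mu p n) B" by (rule measure_mu_eq_gauss[OF p n B, symmetric])
  also have "\<dots> \<le> measure (mu p n) (sum_n n A (scale_n n ?r (lp_ball 2 n)))"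
  proof (rule mu.finite_measure_mono)
    show "B \<subseteq> sum_n n A (scale_n n ?r (lp_ball 2 n))"
      unfolding sum_scaled_ball[OF Asp r] B_def open_nbhd_def by (auto intro: less_imp_le)
    show "sum_n n A (scale_n n ?r (lp_ball 2 n)) \<in> sets (mu p n)"
      unfolding sets_mu by (rule sum_scaled_ball_lebesgue_measurable[OF Asp r])
  qed
  finally show ?thesis .
qed

lemma mu_plus_nonneg:
  assumes n: "1 \<le> n" and p: "2 \<le> p" and A: "A \<in> sets (lborel_n n)"
  shows "0 \<le> mu_plus n (mu p n) A"
  unfolding mu_plus_def
proof (rule Liminf_bounded)
  interpret mu: prob_space "mu p n" by (rule prob_space_mu[OF p n])
  have Asp: "A \<subseteq> space (lborel_n n)" using sets.sets_into_space[OF A] .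
  have "0 \<le> (measure (mu p n) (sum_n n A (scale_n n t (lp_ball 2 n))) - measure (mu p n) A) / t" if t: "0 < t" for t
  proof -
    have "measure (mu p n) A \<le> measure (mu p n) (sum_n n A (scale_n n t (lp_ball 2 n)))"
    proof (rule mu.finite_measure_mono)
      show "A \<subseteq> sum_n n A (scale_n n t (lp_ball 2 n))"
        unfolding sum_scaled_ball[OF Asp t] using Asp t
        by (auto simp: eucl_dist_def L2_set_def intro!: bexI)
      show "sum_n n A (scale_n n t (lp_ball 2 n)) \<in> sets (mu p n)"
        unfolding sets_mu by (rule sum_scaled_ball_lebesgue_measurable[OF Asp t])
    qed
    then show ?thesis using t by simp
  qed
  then show "\<forall>\<^sub>F t in at_right 0. 0 \<le> ereal ((measure (mu p n) (sum_n n A (scale_n n t (lp_ball 2 n))) - measure (mu p n) A) / t)"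
    by (auto simp: eventually_at_right_field intro!: exI[of _ 1])
qed

text \<open>
  The difference quotients of \<open>\<lambda>s. Phi (x + s / (18 * sqrt 2))\<close> at 0 are lower bounds by \<open>mu_isoperimetry\<close>.
\<close>

lemma mu_plus_ge_density:
  assumes n: "1 \<le> n" and p: "2 \<le> p" and A: "A \<in> sets (lborel_n n)"
    and x: "measure (mu p n) A = Phi x"
  shows "ereal (std_normal_density x / (18 * sqrt 2)) \<le> mu_plus n (mu p n) A"
proof -
  let ?L = "18 * sqrt 2 :: real"
  have "((\<lambda>s. Phi (x + s / ?L)) has_real_derivative std_normal_density (x + 0 / ?L) * (1 / ?L)) (at 0)"
    using DERIV_add[OF DERIV_const[of x] DERIV_cdivide[OF DERIV_ident, of ?L]]
    by (intro DERIV_chain2[OF Phi_has_derivative]) simp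
  then have "((\<lambda>s. (Phi (x + s / ?L) - Phi x) / s) \<longlongrightarrow> std_normal_density x / ?L) (at 0)"
    by (simp add: DERIV_def)
  then have "((\<lambda>s. (Phi (x + s / ?L) - Phi x) / s) \<longlongrightarrow> std_normal_density x / ?L) (at_right 0)"
    by (simp add: filterlim_at_split)
  then have "((\<lambda>s. ereal ((Phi (x + s / ?L) - Phi x) / s)) \<longlongrightarrow> ereal (std_normal_density x / ?L)) (at_right 0)"
    by simp
  then have "Liminf (at_right 0) (\<lambda>s. ereal ((Phi (x + s / ?L) - Phi x) / s)) = ereal (std_normal_density x / ?L)"
    by (intro lim_imp_Liminf) auto
  moreover have "Liminf (at_right 0) (\<lambda>s. ereal ((Phi (x + s / ?L) - Phi x) / s)) \<le> mu_plus n (mu p n) A"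
    unfolding mu_plus_def
  proof (rule Liminf_mono)
    have "(Phi (x + s / ?L) - Phi x) / s \<le> (measure (mu p n) (sum_n n A (scale_n n s (lp_ball 2 n))) - measure (mu p n) A) / s"
      if s: "0 < s" for s
    proof (rule divide_right_mono)
      have "Phi (x + s / ?L) \<le> measure (mu p n) (sum_n n A (scale_n n (?L * (s / ?L)) (lp_ball 2 n)))"
        using s by (intro mu_isoperimetry[OF n p A x]) simp
      then show "Phi (x + s / ?L) - Phi x \<le> measure (mu p n) (sum_n n A (scale_n n s (lp_ball 2 n))) - measure (mu p n) A"
        using x by simp
    qed (use s in simp)
    then show "\<forall>\<^sub>F s in at_right 0. ereal ((Phi (x + s / ?L) - Phi x) / s)
        \<le> ereal ((measure (mu p n) (sum_n n A (scale_n n s (lp_ball 2 n))) - measure (mu p n) A) / s)"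
      by (auto simp: eventually_at_right_field intro!: exI[of _ 1])
  qed
  ultimately show ?thesis by simp
qed

theorem theorem5p31:
  shows "(\<forall>(n::nat) (p::real) (A::(nat \<Rightarrow> real) set) (x::real).
            n \<ge> 1 \<longrightarrow> p \<ge> 2 \<longrightarrow> A \<in> sets (lborel_n n) \<longrightarrow>
            measure (mu p n) A = Phi x \<longrightarrow>
            (\<forall>t>0. measure (mu p n) (sum_n n A (scale_n n (18 * sqrt 2 * t) (lp_ball 2 n)))
                     \<ge> Phi (x + t)))
       \<and> (\<exists>C::real. C > 0 \<and>
            (\<forall>(n::nat) (p::real) (A::(nat \<Rightarrow> real) set).
               n \<ge> 1 \<longrightarrow> p \<ge> 2 \<longrightarrow> A \<in> sets (lborel_n n) \<longrightarrow>
               mu_plus n (mu p n) A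
                 \<ge> ereal (1 / C *
                     min (measure (mu p n) A * sqrt (ln (1 / measure (mu p n) A)))
                         ((1 - measure (mu p n) A) * sqrt (ln (1 / (1 - measure (mu p n) A)))))))"
proof (intro conjI)
  obtain K where K: "0 < K" "\<And>g. 0 \<le> g \<Longrightarrow> (1 - Phi g) * sqrt (ln (1 / (1 - Phi g))) \<le> K * std_normal_density g"
    using entropy_profile_le_density by blast
  let ?L = "18 * sqrt 2 :: real"
  have "ereal (1 / (K * ?L) * min (measure (mu p n) A * sqrt (ln (1 / measure (mu p n) A)))
      ((1 - measure (mu p n) A) * sqrt (ln (1 / (1 - measure (mu p n) A))))) \<le> mu_plus n (mu p n) A"
    if n: "1 \<le> n" and p: "2 \<le> p" and A: "A \<in> sets (lborel_n n)" for n p A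
  proof -
    interpret mu: prob_space "mu p n" by (rule prob_space_mu[OF p n])
    define m where "m = measure (mu p n) A"
    have m: "0 \<le> m" "m \<le> 1" by (simp_all add: m_def)
    let ?M = "min (m * sqrt (ln (1 / m))) ((1 - m) * sqrt (ln (1 / (1 - m))))"
    \<comment> \<open>If \<open>m\<close> is 0 or 1, then \<open>m\<close> is not a value of \<open>Phi\<close>, but the minimum vanishes.\<close>
    show ?thesis
    proof (cases "m = 0 \<or> m = 1")
      case True
      then have "?M = 0" by auto
      then show ?thesis using mu_plus_nonneg[OF n p A] by (simp add: m_def[symmetric] zero_ereal_def[symmetric])
    next
      case False
      then obtain x where x: "m = Phi x" using Phi_surj[of m] m by auto
      have "?M \<le> K * std_normal_density x"
      proof (cases "0 \<le> x")
        case True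
        then show ?thesis using K(2)[OF True] by (simp add: x)
      next
        case False
        have "std_normal_density (- x) = std_normal_density x" by (simp add: std_normal_density_def)
        then show ?thesis using K(2)[of "- x"] False by (simp add: x Phi_minus)
      qed
      then have "1 / (K * ?L) * ?M \<le> 1 / (K * ?L) * (K * std_normal_density x)"
        using K by (intro mult_left_mono) auto
      also have "\<dots> = std_normal_density x / ?L" using K by simp
      finally have "ereal (1 / (K * ?L) * ?M) \<le> ereal (std_normal_density x / ?L)" by simp
      also have "\<dots> \<le> mu_plus n (mu p n) A"
        by (rule mu_plus_ge_density[OF n p A]) (simp add: x[symmetric] m_def)
      finally show ?thesis by (simp add: m_def)
    qed
  qed
  moreover have "0 < K * ?L" using K by simp
  ultimately show "\<exists>C::real. C > 0 \<and> (\<forall>(n::nat) (p::real) (A::(nat \<Rightarrow> real) set).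
      n \<ge> 1 \<longrightarrow> p \<ge> 2 \<longrightarrow> A \<in> sets (lborel_n n) \<longrightarrow> mu_plus n (mu p n) A
        \<ge> ereal (1 / C * min (measure (mu p n) A * sqrt (ln (1 / measure (mu p n) A)))
             ((1 - measure (mu p n) A) * sqrt (ln (1 / (1 - measure (mu p n) A))))))"
    by blast
qed (use mu_isoperimetry in blast)

end
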